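(* Let $T=[\boldsymbol{v}_1,\boldsymbol{v}_2,\boldsymbol{v}_3]$ and $\tilde T=[\boldsymbol{v}_1,\boldsymbol{v}_2,\tilde{\boldsymbol{v}}_3]$ be nondegenerate triangles in $\mathbb{R}^2$ with disjoint interiors sharing the edge $[\boldsymbol{v}_1,\boldsymbol{v}_2]$, and let $(\beta_1,\beta_2,\beta_3)$ be the barycentric coordinates of $\tilde{\boldsymbol{v}}_3$ with respect to $T$. Let $S_1,\dots,S_{39}$ be the basis $\mathcal{B}_c$ on $T$ and $\tilde S_1,\dots,\tilde S_{39}$ the correspondingly ordered basis on $\tilde T$ (see context), and let $$f(\boldsymbol{v})=\sum_{i=1}^{39}c_iS_i(\boldsymbol{v}),\ \boldsymbol{v}\in T,\qquad \tilde f(\boldsymbol{v})=\sum_{i=1}^{39}\tilde c_i\tilde S_i(\boldsymbol{v}),\ \boldsymbol{v}\in\tilde T,$$ with real coefficients $c_i,\tilde c_i$. Then $f$ and $\tilde f$ meet along $[\boldsymbol{v}_1,\boldsymbol{v}_2]$ with (i) $C^0$ smoothness if and only if $\tilde c_i=c_i$ for $i=1,\dots,8$; (ii) $C^1$ smoothness if and only if in addition $$\tilde c_9=\beta_1c_1+\beta_2c_2+\beta_3c_9,\qquad \tilde c_{10}=\beta_1c_2+\beta_2c_3+\beta_3c_{10},$$ $$\tilde c_{11}=\beta_1(2c_3-c_2)+\beta_2c_4+\beta_3c_{11},\qquad \tilde c_{12}=\beta_1\tfrac{2c_4+c_5}{3}+\beta_2\tfrac{c_4+2c_5}{3}+\beta_3c_{12},$$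 $$\tilde c_{13}=\beta_1c_5+\beta_2(2c_6-c_7)+\beta_3c_{13},\qquad \tilde c_{14}=\beta_1c_6+\beta_2c_7+\beta_3c_{14},\qquad \tilde c_{15}=\beta_1c_7+\beta_2c_8+\beta_3c_{15};$$ (iii) $C^2$ smoothness if and only if in addition (to the conditions in (i) and (ii)) $$\tilde c_{16}=\beta_1^2c_1+2\beta_1\beta_2c_2+\beta_2^2c_3+2\beta_1\beta_3c_9+2\beta_2\beta_3c_{10}+\beta_3^2c_{16},$$ $$\tilde c_{17}=\beta_1^2c_2+\beta_2^2c_4+\beta_3^2c_{17}+2\beta_1\beta_2\tfrac{3c_3-c_2}{2}+2\beta_1\beta_3\tfrac{3c_{10}-c_2}{2}+2\beta_2\beta_3\tfrac{c_{10}+2c_{11}-c_3}{2},$$ $$\tilde c_{18}=\beta_1^2\tfrac{2c_3+2c_4-c_2}{3}+\beta_2^2\tfrac{c_4+2c_5}{3}+\beta_3^2c_{18}+2\beta_1\beta_2\tfrac{c_2-2c_3+6c_4+c_5}{6}+2\beta_1\beta_3\tfrac{c_2-2c_3+2c_4-c_5+3c_{11}+3c_{12}}{6}+2\beta_2\beta_3\tfrac{9c_{12}-2c_5-c_{11}}{6},$$ $$\tilde c_{19}=\beta_2^2\tfrac{2c_6+2c_5-c_7}{3}+\beta_1^2\tfrac{c_5+2c_4}{3}+\beta_3^2c_{19}+2\beta_1\beta_2\tfrac{c_7-2c_6+6c_5+c_4}{6}+2\beta_2\beta_3\tfrac{c_7-2c_6+2c_5-c_4+3c_{13}+3c_{12}}{6}+2\beta_1\beta_3\tfrac{9c_{12}-2c_4-c_{13}}{6},$$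 $$\tilde c_{20}=\beta_2^2c_7+\beta_1^2c_5+\beta_3^2c_{20}+2\beta_1\beta_2\tfrac{3c_6-c_7}{2}+2\beta_2\beta_3\tfrac{3c_{14}-c_7}{2}+2\beta_1\beta_3\tfrac{c_{14}+2c_{13}-c_6}{2},$$ $$\tilde c_{21}=\beta_2^2c_8+2\beta_1\beta_2c_7+\beta_1^2c_6+2\beta_2\beta_3c_{15}+2\beta_1\beta_3c_{14}+\beta_3^2c_{21}.$$
   Context: For a nondegenerate triangle $T=[\boldsymbol{v}_1,\boldsymbol{v}_2,\boldsymbol{v}_3]$ let $\boldsymbol{v}_4=(\boldsymbol{v}_1+\boldsymbol{v}_2)/2$, $\boldsymbol{v}_5=(\boldsymbol{v}_2+\boldsymbol{v}_3)/2$, $\boldsymbol{v}_6=(\boldsymbol{v}_1+\boldsymbol{v}_3)/2$. The Powell-Sabin 12-split of $T$ is the subdivision of $T$ into 12 triangles obtained by drawing all segments connecting pairs among $\boldsymbol{v}_1,\dots,\boldsymbol{v}_6$. Simplex splines: for nonnegative integers $m_1,\dots,m_6$ with sum 8, let $K$ be the multiset containing $\boldsymbol{v}_i$ with multiplicity $m_i$ (and having convex hull of positive area). Choose a nondegenerate simplex $\sigma\subset\mathbb{R}^7$ whose 8 vertices are mapped onto the elements of $K$ (with multiplicity) by the projection $\pi:\mathbb{R}^7\to\mathbb{R}^2$ onto the first two coordinates, and define $$Q[m_1m_2m_3m_4m_5m_6](\boldsymbol{x})=\frac{\mathrm{area}(T)}{\binom{7}{2}}\cdot\frac{\mathrm{vol}_5(\sigma\cap\pi^{-1}(\boldsymbol{x}))}{\mathrm{vol}_7(\sigma)},\quad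 \boldsymbol{x}\in T,$$ independent of the choice of $\sigma$. The basis $\mathcal{B}_c$ of the 39-dimensional space of $C^3$ piecewise quintics on the 12-split of $T$ consists of the $S_3$-orbits (under permutations of $\boldsymbol{v}_1,\boldsymbol{v}_2,\boldsymbol{v}_3$, with the induced permutations of the midpoints $\boldsymbol{v}_4,\boldsymbol{v}_5,\boldsymbol{v}_6$) of $\frac14Q[600101]$, $\frac14Q[500201]$, $\frac12Q[410201]$, $\frac12Q[320201]$, $\frac34Q[220211]$, $Q[141110]$, $\frac12Q[131210]$, $\frac34Q[121211]$. It is ordered so that the first 21 elements are $S_1=\frac14Q[600101]$, $S_2=\frac14Q[500201]$, $S_3=\frac12Q[410201]$, $S_4=\frac12Q[320201]$, $S_5=\frac12Q[230210]$, $S_6=\frac12Q[140210]$, $S_7=\frac14Q[050210]$, $S_8=\frac14Q[060110]$; $S_9=\frac14Q[500102]$, $S_{10}=Q[411101]$, $S_{11}=\frac12Q[311201]$, $S_{12}=\frac34Q[220211]$, $S_{13}=\frac12Q[131210]$, $S_{14}=Q[141110]$, $S_{15}=\frac14Q[050120]$; $S_{16}=\frac12Q[401102]$, $S_{17}=\frac12Q[311102]$, $S_{18}=\frac34Q[211211]$, $S_{19}=\frac34Q[121211]$, $S_{20}=\frac12Q[131120]$, $S_{21}=\frac12Q[041120]$; the remaining 18 elements are $S_{22},\dots,S_{39}$ in any fixed order. The basis $\tilde S_1,\dots,\tilde S_{39}$ on $\tilde T$ is defined in the same way with $\boldsymbol{v}_3$ replaced by $\tilde{\boldsymbol{v}}_3$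 (and the midpoints and the normalizing area changed accordingly), with the same ordering. $f$ and $\tilde f$ meet with $C^r$ smoothness if all partial derivatives of order at most $r$ of $f$ and $\tilde f$ (one-sided, from $T$ and from $\tilde T$) agree at every point of the edge $[\boldsymbol{v}_1,\boldsymbol{v}_2]$. *)

theory Defs
  imports "HOL-Analysis.Analysis" "HOL-Library.Multiset"
begin

definition triangle :: "real^2 \<Rightarrow> real^2 \<Rightarrow> real^2 \<Rightarrow> (real^2) set" where
  "triangle v1 v2 v3 = convex hull {v1, v2, v3}"

definition split_points :: "real^2 \<Rightarrow> real^2 \<Rightarrow> real^2 \<Rightarrow> (real^2) list" where
  "split_points v1 v2 v3 =
     [v1, v2, v3, midpoint v1 v2, midpoint v2 v3, midpoint v1 v3]"

text \<open>A multi-index is the list \<open>[m1, ..., m6]\<close> of the knot multiplicities.\<close>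

definition knots :: "real^2 \<Rightarrow> real^2 \<Rightarrow> real^2 \<Rightarrow> nat list \<Rightarrow> (real^2) multiset" where
  "knots v1 v2 v3 m =
     (\<Sum>(k, p) \<leftarrow> zip m (split_points v1 v2 v3). replicate_mset k p)"

text \<open>
  \<open>\<real>\<^sup>7\<close> is represented as \<open>\<real>\<^sup>2 \<times> \<real>\<^sup>5\<close>, so that the projection onto the first two
  coordinates is \<open>fst\<close>.  \<open>W\<close> is the vertex set of a nondegenerate simplex over \<open>K\<close>; for
  \<open>size K = 8\<close> this simplex is 7-dimensional, and it exists iff the points of \<open>K\<close> are
  not collinear.
\<close>

definition simplex_over :: "(real^2) multiset \<Rightarrow> ((real^2) \<times> (real^5)) set \<Rightarrow> bool" where
  "simplex_over K W \<longleftrightarrow>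
     finite W \<and> \<not> affine_dependent W \<and> image_mset fst (mset_set W) = K"

text \<open>
  The fibre of the simplex over \<open>x\<close> lies in the 5-dimensional flat \<open>{x} \<times> \<real>\<^sup>5\<close>; its
  5-dimensional volume is the Lebesgue measure of its image in \<open>\<real>\<^sup>5\<close>.
\<close>

definition simplex_spline ::
    "real^2 \<Rightarrow> real^2 \<Rightarrow> real^2 \<Rightarrow> nat list \<Rightarrow> real^2 \<Rightarrow> real" where
  "simplex_spline v1 v2 v3 m x =
     (let \<sigma> = convex hull (SOME W. simplex_over (knots v1 v2 v3 m) W)
      in measure lborel (triangle v1 v2 v3) / real (7 choose 2)
         * (measure lborel {y. (x, y) \<in> \<sigma>} / measure lborel \<sigma>))"

text \<open>
  The action of \<open>S\<^sub>3\<close> on multi-indices.  The positions 4, 5, 6 belong to the edges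
  12, 23, 13 and are permuted along with the vertices; the six images below are those under the
  identity, the transpositions (12), (23), (13) and the two 3-cycles.
\<close>

fun orbit :: "nat list \<Rightarrow> nat list set" where
  "orbit [a, b, c, d, e, f] =
     {[a, b, c, d, e, f], [b, a, c, d, f, e], [a, c, b, f, e, d],
      [c, b, a, e, d, f], [b, c, a, e, f, d], [c, a, b, f, d, e]}"
| "orbit _ = {}"

text \<open>
  A basis function is identified by its weight and its multi-index; using such labels rather than
  functions makes it possible to order the bases on two triangles in the same way.
\<close>

definition generators :: "(real \<times> nat list) set" where
  "generators =
     {(1/4, [6,0,0,1,0,1]), (1/4, [5,0,0,2,0,1]), (1/2, [4,1,0,2,0,1]), (1/2, [3,2,0,2,0,1]),
      (3/4, [2,2,0,2,1,1]), (1, [1,4,1,1,1,0]), (1/2, [1,3,1,2,1,0]), (3/4, [1,2,1,2,1,1])}"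

definition basis_labels :: "(real \<times> nat list) set" where
  "basis_labels = (\<Union>(w, m) \<in> generators. Pair w ` orbit m)"

definition leading_labels :: "(real \<times> nat list) list" where
  "leading_labels =
     [(1/4, [6,0,0,1,0,1]), (1/4, [5,0,0,2,0,1]), (1/2, [4,1,0,2,0,1]), (1/2, [3,2,0,2,0,1]),
      (1/2, [2,3,0,2,1,0]), (1/2, [1,4,0,2,1,0]), (1/4, [0,5,0,2,1,0]), (1/4, [0,6,0,1,1,0]),
      (1/4, [5,0,0,1,0,2]), (1, [4,1,1,1,0,1]), (1/2, [3,1,1,2,0,1]), (3/4, [2,2,0,2,1,1]),
      (1/2, [1,3,1,2,1,0]), (1, [1,4,1,1,1,0]), (1/4, [0,5,0,1,2,0]),
      (1/2, [4,0,1,1,0,2]), (1/2, [3,1,1,1,0,2]), (3/4, [2,1,1,2,1,1]), (3/4, [1,2,1,2,1,1]),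
      (1/2, [1,3,1,1,2,0]), (1/2, [0,4,1,1,2,0])]"

definition basis_ordering :: "(nat \<Rightarrow> real \<times> nat list) \<Rightarrow> bool" where
  "basis_ordering lab \<longleftrightarrow>
     bij_betw lab {1..39} basis_labels \<and> map lab [1..<22] = leading_labels"

lemma card_basis_labels: "card basis_labels = 39"
  by (simp add: basis_labels_def generators_def card_insert_if)

lemma leading_labels_in_basis:
  "distinct leading_labels" "length leading_labels = 21" "set leading_labels \<subseteq> basis_labels"
  by (simp_all add: leading_labels_def basis_labels_def generators_def)

definition basis_fun ::
    "real^2 \<Rightarrow> real^2 \<Rightarrow> real^2 \<Rightarrow> real \<times> nat list \<Rightarrow> real^2 \<Rightarrow> real" where
  "basis_fun v1 v2 v3 l x = fst l * simplex_spline v1 v2 v3 (snd l) x"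

text \<open>
  \<open>has_partial T ds f g\<close>: the iterated partial derivative of \<open>f\<close> along the coordinate
  directions \<open>ds\<close> exists on \<open>T\<close> and equals \<open>g\<close> there.  Derivatives are taken within \<open>T\<close>,
  hence they are one-sided on the boundary and depend only on the values on \<open>T\<close>; for a
  nondegenerate triangle \<open>T\<close> the derivative \<open>D\<close> within \<open>T\<close> is unique at every point of \<open>T\<close>.
\<close>

primrec has_partial ::
    "(real^2) set \<Rightarrow> 2 list \<Rightarrow> (real^2 \<Rightarrow> real) \<Rightarrow> (real^2 \<Rightarrow> real) \<Rightarrow> bool" where
  "has_partial T [] f g \<longleftrightarrow> (\<forall>x\<in>T. g x = f x)"
| "has_partial T (d # ds) f g \<longleftrightarrow>
     (\<exists>h. has_partial T ds f h \<and>
          (\<forall>x\<in>T. \<exists>D. (h has_derivative D) (at x within T) \<and> g x = D (axis d 1)))"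

definition meet_smoothly ::
    "nat \<Rightarrow> (real^2) set \<Rightarrow> (real^2) set \<Rightarrow> (real^2) set \<Rightarrow>
     (real^2 \<Rightarrow> real) \<Rightarrow> (real^2 \<Rightarrow> real) \<Rightarrow> bool" where
  "meet_smoothly r E T T' f f' \<longleftrightarrow>
     (\<forall>ds. length ds \<le> r \<longrightarrow>
        (\<exists>g g'. has_partial T ds f g \<and> has_partial T' ds f' g' \<and> (\<forall>p\<in>E. g p = g' p)))"

end

theory Submission
  imports Defs
begin

text \<open>
  A basis function depends on its triangle only through the barycentric coordinates
  \<open>(a, b, c)\<close> of the argument, and on the triangle it is a sum of products of polynomials of
  degree at most 1 with fourth and fifth powers of positive parts of linear forms in
  \<open>a, b, c\<close> (\<open>closed_form_basis\<close>).  The same formula makes sense in the whole plane and is twice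
  differentiable there.  So \<open>f\<close> and \<open>f'\<close> are restrictions of two functions of the plane, and
  they meet with smoothness \<open>r \<le> 2\<close> iff the difference \<open>G\<close> of these functions has vanishing
  partial derivatives up to order \<open>r\<close> on the edge.  Derivatives along the edge are inherited
  from lower order and the Hessian is symmetric, so only the derivatives of orders \<open>0, \<dots>, r\<close> in
  the one transversal direction \<open>u = v3' - v1\<close> have to vanish
  (\<open>meet_smoothly_iff_transversal\<close>).

  On the edge, where \<open>c = 0\<close>, the last 18 basis functions vanish with their first two
  derivatives, \<open>S16, \<dots>, S21\<close> vanish with their first derivatives, and \<open>S9, \<dots>, S15\<close> vanish.
  Hence order 0 involves 8 coefficients, order 1 brings 7 new ones and order 2 another 6.  The
  values of the first group, the \<open>u\<close>-slopes of the second and the \<open>u\<close>-curvatures of the third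
  are linearly independent functions on the edge: they are bases of the univariate splines of
  degrees 5, 4, 3 with a single breakpoint at the midpoint and smoothness 3, 2, 1.

  It remains to know coefficients \<open>d\<close> on the second triangle which reproduce the 2-jet of \<open>f\<close>.
  They are the right-hand sides of the asserted equations (\<open>continuation\<close>).  With them the
  jet of \<open>G\<close> at a point of the edge is the combination of the jets of \<open>S1, \<dots>, S21\<close> with
  coefficients \<open>c' i - d i\<close> (\<open>continuation_slope\<close>, \<open>continuation_curvature\<close>; these are
  identities between piecewise polynomials in one variable, one for each \<open>c i\<close>).  By the
  triangular structure and the independence, it vanishes up to order \<open>r\<close> iff
  \<open>c' i = d i\<close> in the first \<open>r + 1\<close> groups.

  The closed forms come from computing the fibre volumes.  Choose three noncollinear knots as
  pivots.  A point of the fibre over \<open>x\<close> is determined by the weights of the five other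
  vertices, and this parametrisation of the fibre is affine, with a determinant which is the
  same for all \<open>x\<close>; by Fubini it is also a factor of the volume of the simplex, so it cancels
  (\<open>fibre_ratio\<close>).  What is left is the volume of the set of those weights, an iterated
  integral along rays in the directions of the five knots, starting from the indicator of the
  cone of the pivots.  Each of these one-dimensional integrals is found by guessing an
  antiderivative in the direction of the knot that vanishes where the ray leaves the octant
  (\<open>represents_ray_integral\<close>).  Doing this for the eight generators and permuting the
  vertices gives all 39 functions.
\<close>

section \<open>Volumes of weight sets as iterated ray integrals\<close>

text \<open>
  If \<open>V b\<close> is the volume of the weights with which some given vectors can be subtracted from
  \<open>b\<close> without leaving a set, then \<open>ray_integral a V b\<close> is that volume with the further
  vector \<open>a\<close>: its weight is the variable of integration.
\<close>

definition ray_integral :: "'a::real_vector \<Rightarrow> ('a \<Rightarrow> ennreal) \<Rightarrow> 'a \<Rightarrow> ennreal" where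
  "ray_integral a V b = (\<integral>\<^sup>+t\<in>{0..}. V (b - t *\<^sub>R a) \<partial>lborel)"

text \<open>
  Tonelli, one coordinate at a time.  The base point \<open>b\<close> is generalised because the weight of
  the vector that is split off shifts it.
\<close>

lemma nn_integral_PiM_rays:
  fixes a :: "'i \<Rightarrow> 'a::euclidean_space" and F :: "'a \<Rightarrow> ennreal"
  assumes "distinct is" and F[measurable]: "F \<in> borel_measurable borel"
  shows "(\<integral>\<^sup>+f. F (b - (\<Sum>i\<in>set is. f i *\<^sub>R a i)) * (\<Prod>i\<in>set is. indicator {0..} (f i))
            \<partial>Pi\<^sub>M (set is) (\<lambda>_. lborel))
         = foldr (\<lambda>i. ray_integral (a i)) is F b"
  using assms(1)
proof (induction "is" arbitrary: b)
  case Nil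
  interpret product_sigma_finite "\<lambda>_. lborel :: real measure" by standard
  show ?case by (simp add: nn_integral_empty space_PiM)
next
  case (Cons i "is")
  interpret product_sigma_finite "\<lambda>_. lborel :: real measure" by standard
  have i: "i \<notin> set is" "finite (set is)" "distinct is" using Cons.prems by auto
  define G where "G b f = F (b - (\<Sum>i\<in>set is. f i *\<^sub>R a i)) * (\<Prod>i\<in>set is. indicator {0..} (f i))"
    for b and f :: "'i \<Rightarrow> real"
  have G[measurable]: "G b \<in> borel_measurable (Pi\<^sub>M (set is) (\<lambda>_. lborel))" for b
    unfolding G_def by measurable
  have "(\<integral>\<^sup>+f. F (b - (\<Sum>i\<in>set (i # is). f i *\<^sub>R a i)) * (\<Prod>i\<in>set (i # is). indicator {0..} (f i))
            \<partial>Pi\<^sub>M (set (i # is)) (\<lambda>_. lborel))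
     = (\<integral>\<^sup>+t. (\<integral>\<^sup>+f. F (b - (\<Sum>j\<in>insert i (set is). (f(i:=t)) j *\<^sub>R a j)) *
          (\<Prod>j\<in>insert i (set is). indicator {0..} ((f(i:=t)) j)) \<partial>Pi\<^sub>M (set is) (\<lambda>_. lborel)) \<partial>lborel)"
    unfolding list.set using i by (intro product_nn_integral_insert_rev) (measurable)
  also have "\<dots> = (\<integral>\<^sup>+t. (\<integral>\<^sup>+f. G (b - t *\<^sub>R a i) f * indicator {0..} t \<partial>Pi\<^sub>M (set is) (\<lambda>_. lborel)) \<partial>lborel)"
  proof (intro nn_integral_cong)
    fix t f
    have "(\<Sum>j\<in>set is. (f(i:=t)) j *\<^sub>R a j) = (\<Sum>j\<in>set is. f j *\<^sub>R a j)"
      and "(\<Prod>j\<in>set is. indicator {0..} ((f(i:=t)) j) :: ennreal) = (\<Prod>j\<in>set is. indicator {0..} (f j))"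
      using i by (auto intro!: sum.cong prod.cong)
    with i show "F (b - (\<Sum>j\<in>insert i (set is). (f(i:=t)) j *\<^sub>R a j)) *
          (\<Prod>j\<in>insert i (set is). indicator {0..} ((f(i:=t)) j)) = G (b - t *\<^sub>R a i) f * indicator {0..} t"
      by (simp add: G_def algebra_simps)
  qed
  also have "\<dots> = (\<integral>\<^sup>+t. (\<integral>\<^sup>+f. G (b - t *\<^sub>R a i) f \<partial>Pi\<^sub>M (set is) (\<lambda>_. lborel)) * indicator {0..} t \<partial>lborel)"
    by (simp add: nn_integral_multc)
  also have "\<dots> = ray_integral (a i) (foldr (\<lambda>i. ray_integral (a i)) is F) b"
    unfolding G_def Cons.IH[OF i(3)] ray_integral_def[of "a i"] by simp
  finally show ?case by simp
qed

lemma measurable_vec_lambda[measurable]: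
  "vec_lambda \<in> Pi\<^sub>M UNIV (\<lambda>_::'n::finite. lborel) \<rightarrow>\<^sub>M (borel :: (real^'n) measure)"
proof (rule borel_measurable_euclidean_space[THEN iffD2], rule ballI)
  fix b :: "real^'n" assume "b \<in> Basis"
  then obtain i where "b = axis i 1" by (auto simp: Basis_vec_def)
  then show "(\<lambda>x. vec_lambda x \<bullet> b) \<in> borel_measurable (Pi\<^sub>M UNIV (\<lambda>_. lborel))"
    by (simp add: inner_axis)
qed

lemma lborel_vec_eq_PiM:
  "(lborel :: (real^'n) measure) = distr (Pi\<^sub>M UNIV (\<lambda>_::'n::finite. lborel)) borel vec_lambda"
proof (rule lborel_eqI)
  fix l u :: "real^'n" assume le: "\<And>b. b \<in> Basis \<Longrightarrow> l \<bullet> b \<le> u \<bullet> b"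
  interpret product_sigma_finite "\<lambda>_. lborel :: real measure" by standard
  have le': "l $ i \<le> u $ i" for i
    using le[of "axis i 1"] by (simp add: inner_axis axis_in_Basis_iff)
  have "vec_lambda -` box l u \<inter> space (Pi\<^sub>M UNIV (\<lambda>_::'n. lborel)) = Pi\<^sub>E UNIV (\<lambda>i. {l$i<..<u$i})"
    by (auto simp: space_PiM mem_box_cart PiE_def Pi_iff)
  then have "emeasure (distr (Pi\<^sub>M UNIV (\<lambda>_::'n. lborel)) borel vec_lambda) (box l u) =
     (\<Prod>i\<in>UNIV. emeasure lborel {l$i<..<u$i})"
    by (simp add: emeasure_distr emeasure_PiM)
  also have "\<dots> = ennreal (\<Prod>i\<in>UNIV. u$i - l$i)"
    using le' by (simp add: prod_ennreal)
  also have "(\<Prod>i\<in>UNIV. u$i - l$i) = (\<Prod>b\<in>Basis. (u - l) \<bullet> b)"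
    unfolding Basis_vec_def
    by (simp add: UNION_singleton_eq_range prod.reindex inj_on_def axis_eq_axis inner_axis)
  finally show "emeasure (distr (Pi\<^sub>M UNIV (\<lambda>_::'n. lborel)) borel vec_lambda) (box l u)
     = (\<Prod>b\<in>Basis. (u - l) \<bullet> b)" .
qed simp

lemma nn_integral_orthant_rays:
  fixes a :: "'n::finite \<Rightarrow> 'a::euclidean_space" and F :: "'a \<Rightarrow> ennreal"
  assumes "distinct is" "set is = UNIV" and F[measurable]: "F \<in> borel_measurable borel"
  shows "(\<integral>\<^sup>+l\<in>{l::real^'n. \<forall>i. 0 \<le> l $ i}. F (b - (\<Sum>i\<in>UNIV. (l $ i) *\<^sub>R a i)) \<partial>lborel)
         = foldr (\<lambda>i. ray_integral (a i)) is F b"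
proof -
  have ind: "indicator {l::real^'n. \<forall>i. 0 \<le> l $ i} (vec_lambda f) = (\<Prod>i\<in>UNIV. indicator {0..} (f i) :: ennreal)" for f
    by (auto simp: indicator_def of_nat_eq_0_iff)
  have [measurable]: "{l::real^'n. \<forall>i. 0 \<le> l $ i} \<in> sets borel"
    by (intro borel_closed closed_Collect_all closed_Collect_le continuous_intros)
  have "(\<integral>\<^sup>+l\<in>{l::real^'n. \<forall>i. 0 \<le> l $ i}. F (b - (\<Sum>i\<in>UNIV. (l $ i) *\<^sub>R a i)) \<partial>lborel)
    = (\<integral>\<^sup>+f. F (b - (\<Sum>i\<in>UNIV. f i *\<^sub>R a i)) * (\<Prod>i\<in>UNIV. indicator {0..} (f i)) \<partial>Pi\<^sub>M UNIV (\<lambda>_::'n. lborel))"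
    by (subst lborel_vec_eq_PiM, subst nn_integral_distr) (simp_all add: ind)
  then show ?thesis
    using nn_integral_PiM_rays[OF assms(1) F, of b a] assms(2) by simp
qed

section \<open>Barycentric coordinates in the plane\<close>

text \<open>
  The oriented area of a parallelogram; its nonvanishing is the working form of noncollinearity.
\<close>

definition cross2 :: "real^2 \<Rightarrow> real^2 \<Rightarrow> real" where
  "cross2 u w = u$1 * w$2 - u$2 * w$1"

definition comb3 :: "'a::real_vector \<Rightarrow> 'a \<Rightarrow> 'a \<Rightarrow> real \<times> real \<times> real \<Rightarrow> 'a" where
  "comb3 p1 p2 p3 b = fst b *\<^sub>R p1 + fst (snd b) *\<^sub>R p2 + snd (snd b) *\<^sub>R p3"

definition coord_sum :: "real \<times> real \<times> real \<Rightarrow> real" where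
  "coord_sum b = fst b + fst (snd b) + snd (snd b)"

definition octant :: "(real \<times> real \<times> real) set" where
  "octant = {b. 0 \<le> fst b \<and> 0 \<le> fst (snd b) \<and> 0 \<le> snd (snd b)}"

text \<open>
  Cramer's rule.  The first coordinate is defined as the complement of the other two, so that
  the coordinates always add up to 1.
\<close>

definition bary :: "real^2 \<Rightarrow> real^2 \<Rightarrow> real^2 \<Rightarrow> real^2 \<Rightarrow> real \<times> real \<times> real" where
  "bary p1 p2 p3 x =
     (let D = cross2 (p2 - p1) (p3 - p1);
          \<beta> = cross2 (x - p1) (p3 - p1) / D;
          \<gamma> = cross2 (p2 - p1) (x - p1) / D
      in (1 - \<beta> - \<gamma>, \<beta>, \<gamma>))"

lemma linear_comb3: "linear (comb3 p1 p2 p3)"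
  by (rule linearI) (simp_all add: comb3_def algebra_simps)

lemma linear_coord_sum: "linear coord_sum"
  by (rule linearI) (simp_all add: coord_sum_def algebra_simps)

lemma coord_sum_bary: "coord_sum (bary p1 p2 p3 x) = 1"
  by (simp add: coord_sum_def bary_def Let_def)

lemma comb3_bary:
  assumes "cross2 (p2 - p1) (p3 - p1) \<noteq> 0"
  shows "comb3 p1 p2 p3 (bary p1 p2 p3 x) = x"
proof -
  have "(comb3 p1 p2 p3 (bary p1 p2 p3 x)) $ i = x $ i" if "i = 1 \<or> i = 2" for i
    using assms that
    by (elim disjE; simp add: comb3_def bary_def Let_def cross2_def divide_simps) (simp_all add: algebra_simps)
  then show ?thesis by (simp add: vec_eq_iff forall_2)
qed

lemma bary_comb3:
  assumes "cross2 (p2 - p1) (p3 - p1) \<noteq> 0" "coord_sum b = 1"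
  shows "bary p1 p2 p3 (comb3 p1 p2 p3 b) = b"
proof -
  obtain \<beta> \<gamma> where b: "b = (1 - \<beta> - \<gamma>, \<beta>, \<gamma>)"
    using assms(2) by (cases b) (auto simp: coord_sum_def algebra_simps)
  have x: "comb3 p1 p2 p3 b - p1 = \<beta> *\<^sub>R (p2 - p1) + \<gamma> *\<^sub>R (p3 - p1)"
    by (simp add: b comb3_def algebra_simps)
  have "cross2 (comb3 p1 p2 p3 b - p1) (p3 - p1) = \<beta> * cross2 (p2 - p1) (p3 - p1)"
       "cross2 (p2 - p1) (comb3 p1 p2 p3 b - p1) = \<gamma> * cross2 (p2 - p1) (p3 - p1)"
    unfolding x by (simp_all add: cross2_def algebra_simps)
  with assms(1) show ?thesis by (simp add: bary_def b Let_def)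
qed

lemma bary_affine_combination:
  fixes l :: "'i::finite \<Rightarrow> real"
  assumes D: "cross2 (p2 - p1) (p3 - p1) \<noteq> 0" and s: "coord_sum b + (\<Sum>j\<in>UNIV. l j) = 1"
  shows "bary p1 p2 p3 (comb3 p1 p2 p3 b + (\<Sum>j\<in>UNIV. l j *\<^sub>R q j))
         = b + (\<Sum>j\<in>UNIV. l j *\<^sub>R bary p1 p2 p3 (q j))"
proof -
  let ?b = "b + (\<Sum>j\<in>UNIV. l j *\<^sub>R bary p1 p2 p3 (q j))"
  have "coord_sum ?b = 1"
    using s by (simp add: linear_add[OF linear_coord_sum] linear_sum[OF linear_coord_sum]
        linear_cmul[OF linear_coord_sum] coord_sum_bary)
  moreover have "comb3 p1 p2 p3 ?b = comb3 p1 p2 p3 b + (\<Sum>j\<in>UNIV. l j *\<^sub>R q j)"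
    by (simp add: linear_add[OF linear_comb3] linear_sum[OF linear_comb3]
        linear_cmul[OF linear_comb3] comb3_bary[OF D])
  ultimately show ?thesis using bary_comb3[OF D, of ?b] by simp
qed

lemma sum_over_vertices:
  fixes R :: "'i::finite \<Rightarrow> 'a" and g :: "'a \<Rightarrow> 'b::comm_monoid_add"
  assumes "distinct [P1, P2, P3]" "inj R" "P1 \<notin> range R" "P2 \<notin> range R" "P3 \<notin> range R"
  shows "(\<Sum>w\<in>{P1, P2, P3} \<union> range R. g w) = g P1 + g P2 + g P3 + (\<Sum>j\<in>UNIV. g (R j))"
proof -
  have "(\<Sum>w\<in>{P1, P2, P3} \<union> range R. g w) = (\<Sum>w\<in>{P1, P2, P3}. g w) + (\<Sum>w\<in>range R. g w)"
    using assms by (intro sum.union_disjoint) auto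
  also have "(\<Sum>w\<in>range R. g w) = (\<Sum>j\<in>UNIV. g (R j))"
    using assms(2) by (simp add: sum.reindex)
  finally show ?thesis using assms(1) by (simp add: add.assoc)
qed

lemma hull_vertices:
  fixes R :: "'i::finite \<Rightarrow> 'a::real_vector"
  assumes V: "distinct [P1, P2, P3]" "inj R" "P1 \<notin> range R" "P2 \<notin> range R" "P3 \<notin> range R"
  shows "z \<in> convex hull ({P1, P2, P3} \<union> range R) \<longleftrightarrow>
     (\<exists>b (l::real^'i). b \<in> octant \<and> (\<forall>j. 0 \<le> l $ j) \<and> coord_sum b + (\<Sum>j\<in>UNIV. l $ j) = 1 \<and>
            z = comb3 P1 P2 P3 b + (\<Sum>j\<in>UNIV. (l $ j) *\<^sub>R R j))" (is "_ \<longleftrightarrow> ?rhs")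
proof
  assume "z \<in> convex hull ({P1, P2, P3} \<union> range R)"
  then obtain u where u: "\<forall>x\<in>{P1, P2, P3} \<union> range R. 0 \<le> u x" "sum u ({P1, P2, P3} \<union> range R) = 1"
      "(\<Sum>x\<in>{P1, P2, P3} \<union> range R. u x *\<^sub>R x) = z"
    by (subst (asm) convex_hull_finite) auto
  show ?rhs
    using u unfolding sum_over_vertices[OF V]
    by (intro exI[of _ "(u P1, u P2, u P3)"] exI[of _ "\<chi> j. u (R j)"])
       (simp add: octant_def coord_sum_def comb3_def)
next
  assume ?rhs
  then obtain b and l :: "real^'i" where bl: "b \<in> octant" "\<forall>j. 0 \<le> l $ j" "coord_sum b + (\<Sum>j\<in>UNIV. l $ j) = 1"
    "z = comb3 P1 P2 P3 b + (\<Sum>j\<in>UNIV. (l $ j) *\<^sub>R R j)" by blast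
  define u where "u x = (if x = P1 then fst b else if x = P2 then fst (snd b) else if x = P3 then snd (snd b)
     else l $ (inv R x))" for x
  have u: "u P1 = fst b" "u P2 = fst (snd b)" "u P3 = snd (snd b)" "\<And>j. u (R j) = l $ j"
    using V by (auto simp: u_def)
  have "\<forall>x\<in>{P1, P2, P3} \<union> range R. 0 \<le> u x" using bl u by (auto simp: octant_def)
  moreover have "sum u ({P1, P2, P3} \<union> range R) = 1"
    using bl(3) unfolding sum_over_vertices[OF V] u coord_sum_def by simp
  moreover have "(\<Sum>x\<in>{P1, P2, P3} \<union> range R. u x *\<^sub>R x) = z"
    unfolding sum_over_vertices[OF V] u bl(4) by (simp add: comb3_def)
  ultimately show "z \<in> convex hull ({P1, P2, P3} \<union> range R)"
    by (subst convex_hull_finite) auto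
qed

section \<open>Fibre volumes of a simplex\<close>

text \<open>
  The vertices of a simplex over eight knots, with three of them, whose projections are not
  collinear, singled out as pivots.
\<close>

locale simplex_vertices =
  fixes P1 P2 P3 :: "(real^2) \<times> (real^5)" and R :: "5 \<Rightarrow> (real^2) \<times> (real^5)"
  assumes distinct_vertices: "distinct [P1, P2, P3]" "inj R" "P1 \<notin> range R" "P2 \<notin> range R" "P3 \<notin> range R"
    and indep: "\<not> affine_dependent ({P1, P2, P3} \<union> range R)"
    and pivots: "cross2 (fst P2 - fst P1) (fst P3 - fst P1) \<noteq> 0"
begin

abbreviation "B \<equiv> bary (fst P1) (fst P2) (fst P3)"
abbreviation "a j \<equiv> B (fst (R j))"
definition \<sigma> :: "((real^2) \<times> (real^5)) set" where
  "\<sigma> = convex hull ({P1, P2, P3} \<union> range R)"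

text \<open>
  The possible weights of the five other vertices in points of the fibre over \<open>x\<close>: the pivots
  must then supply the rest of \<open>x\<close> with nonnegative weights.
\<close>

definition weights :: "real^2 \<Rightarrow> (real^5) set" where
  "weights x = {l. (\<forall>j. 0 \<le> l $ j) \<and> B x - (\<Sum>j\<in>UNIV. (l $ j) *\<^sub>R a j) \<in> octant}"

text \<open>
  Moving weight from the pivots to \<open>R j\<close> while staying in the fibre changes the second component
  by the height of \<open>R j\<close> above the plane through the pivots, measured in the fibre of \<open>R j\<close>.
\<close>

definition M :: "real^5 \<Rightarrow> real^5" where
  "M l = (\<Sum>j\<in>UNIV. (l $ j) *\<^sub>R (snd (R j) - comb3 (snd P1) (snd P2) (snd P3) (a j)))"

lemma linear_M: "linear M"
  by (rule linearI) (simp_all add: M_def algebra_simps sum.distrib scaleR_sum_right sum_subtractf)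

lemma fst_comb3: "fst (comb3 P1 P2 P3 b) = comb3 (fst P1) (fst P2) (fst P3) b"
  and snd_comb3: "snd (comb3 P1 P2 P3 b) = comb3 (snd P1) (snd P2) (snd P3) b"
  by (simp_all add: comb3_def)

text \<open>
  The pivots' weights are functions of \<open>x\<close> and of the other weights, so the fibre is an affine
  image of the set of the other weights, with a linear part that does not depend on \<open>x\<close>.
\<close>

lemma fibre_eq:
  "{y. (x, y) \<in> \<sigma>} = (+) (comb3 (snd P1) (snd P2) (snd P3) (B x)) ` M ` weights x"
proof -
  let ?Y = "comb3 (snd P1) (snd P2) (snd P3)"
  have M': "?Y (B x) + M l = ?Y (B x - (\<Sum>j\<in>UNIV. (l $ j) *\<^sub>R a j)) + (\<Sum>j\<in>UNIV. (l $ j) *\<^sub>R snd (R j))" for l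
    by (simp add: M_def linear_diff[OF linear_comb3] linear_sum[OF linear_comb3]
        linear_cmul[OF linear_comb3] algebra_simps sum_subtractf)
  have "y \<in> (+) (?Y (B x)) ` M ` weights x" if xy: "(x, y) \<in> \<sigma>" for y
  proof -
    obtain b and l :: "real^5" where bl: "b \<in> octant" "\<forall>j. 0 \<le> l $ j" "coord_sum b + (\<Sum>j\<in>UNIV. l $ j) = 1"
      and z: "(x, y) = comb3 P1 P2 P3 b + (\<Sum>j\<in>UNIV. (l $ j) *\<^sub>R R j)"
      using xy unfolding \<sigma>_def hull_vertices[OF distinct_vertices] by blast
    have x: "x = comb3 (fst P1) (fst P2) (fst P3) b + (\<Sum>j\<in>UNIV. (l $ j) *\<^sub>R fst (R j))"
      using arg_cong[OF z, of fst] by (simp add: fst_comb3 fst_sum)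
    have y: "y = ?Y b + (\<Sum>j\<in>UNIV. (l $ j) *\<^sub>R snd (R j))"
      using arg_cong[OF z, of snd] by (simp add: snd_comb3 snd_sum)
    have b: "B x - (\<Sum>j\<in>UNIV. (l $ j) *\<^sub>R a j) = b"
      unfolding x bary_affine_combination[OF pivots bl(3)] by simp
    then have "l \<in> weights x" using bl by (simp add: weights_def)
    moreover have "y = ?Y (B x) + M l" unfolding M' b y ..
    ultimately show ?thesis by blast
  qed
  moreover have "(x, ?Y (B x) + M l) \<in> \<sigma>" if l: "l \<in> weights x" for l
  proof -
    let ?b = "B x - (\<Sum>j\<in>UNIV. (l $ j) *\<^sub>R a j)"
    have "coord_sum ?b + (\<Sum>j\<in>UNIV. l $ j) = 1"
      by (simp add: linear_diff[OF linear_coord_sum] linear_sum[OF linear_coord_sum]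
          linear_cmul[OF linear_coord_sum] coord_sum_bary)
    moreover have "fst (comb3 P1 P2 P3 ?b + (\<Sum>j\<in>UNIV. (l $ j) *\<^sub>R R j)) = x"
      by (simp add: fst_comb3 fst_sum linear_diff[OF linear_comb3] linear_sum[OF linear_comb3]
          linear_cmul[OF linear_comb3] comb3_bary[OF pivots])
    moreover have "snd (comb3 P1 P2 P3 ?b + (\<Sum>j\<in>UNIV. (l $ j) *\<^sub>R R j)) = ?Y (B x) + M l"
      unfolding M' by (simp add: snd_comb3 snd_sum)
    ultimately show ?thesis
      unfolding \<sigma>_def hull_vertices[OF distinct_vertices] using l
      by (intro exI[of _ ?b] exI[of _ l]) (simp add: weights_def prod_eq_iff)
  qed
  ultimately show ?thesis by auto
qed

text \<open>
  A kernel vector of \<open>M\<close>, completed by the weights that it takes from the pivots, is an affine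
  dependence of the vertices.
\<close>

lemma det_M: "det (matrix M) \<noteq> 0"
proof -
  have "inj M"
  proof (rule linear_injective_0[OF linear_M, THEN iffD2], intro allI impI)
    fix l assume M0: "M l = 0"
    \<comment> \<open>the weights that the pivots lose\<close>
    let ?b = "- (\<Sum>j\<in>UNIV. (l $ j) *\<^sub>R a j)"
    define u where "u x = (if x = P1 then fst ?b else if x = P2 then fst (snd ?b) else if x = P3 then snd (snd ?b)
       else l $ (inv R x))" for x
    have u: "u P1 = fst ?b" "u P2 = fst (snd ?b)" "u P3 = snd (snd ?b)" "\<And>j. u (R j) = l $ j"
      using distinct_vertices by (auto simp: u_def)
    have tot: "coord_sum ?b = - (\<Sum>j\<in>UNIV. l $ j)"
      by (simp add: linear_neg[OF linear_coord_sum] linear_sum[OF linear_coord_sum]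
          linear_cmul[OF linear_coord_sum] coord_sum_bary)
    have s0: "sum u ({P1, P2, P3} \<union> range R) = 0"
      using tot unfolding sum_over_vertices[OF distinct_vertices] u coord_sum_def by simp
    have "fst (comb3 P1 P2 P3 ?b + (\<Sum>j\<in>UNIV. (l $ j) *\<^sub>R R j)) = 0"
      by (simp add: fst_comb3 fst_sum linear_neg[OF linear_comb3] linear_sum[OF linear_comb3]
          linear_cmul[OF linear_comb3] comb3_bary[OF pivots])
    moreover have "snd (comb3 P1 P2 P3 ?b + (\<Sum>j\<in>UNIV. (l $ j) *\<^sub>R R j)) = M l"
      by (simp add: M_def snd_comb3 snd_sum linear_neg[OF linear_comb3] linear_sum[OF linear_comb3]
          linear_cmul[OF linear_comb3] algebra_simps sum_subtractf)
    ultimately have "comb3 P1 P2 P3 ?b + (\<Sum>j\<in>UNIV. (l $ j) *\<^sub>R R j) = 0"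
      using M0 by (simp add: prod_eq_iff)
    then have v0: "(\<Sum>x\<in>{P1, P2, P3} \<union> range R. u x *\<^sub>R x) = 0"
      unfolding sum_over_vertices[OF distinct_vertices] u comb3_def by simp
    have "u (R j) = 0" for j
      using indep s0 v0 by (subst (asm) affine_dependent_explicit_finite) auto
    then show "l = 0" by (simp add: u vec_eq_iff)
  qed
  then show ?thesis
    using linear_M by (metis det_nz_iff_inj)
qed

end

lemma ray_integral_pos_power:
  assumes "c \<ge> 0" "n > 0"
  shows "ray_integral 1 (\<lambda>r::real. ennreal (c * max 0 r ^ n)) = (\<lambda>r. ennreal (c / real (Suc n) * max 0 r ^ Suc n))"
proof
  fix r :: real
  show "ray_integral 1 (\<lambda>r. ennreal (c * max 0 r ^ n)) r = ennreal (c / real (Suc n) * max 0 r ^ Suc n)"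
  proof (cases "r \<le> 0")
    case True
    then have "ray_integral 1 (\<lambda>r. ennreal (c * max 0 r ^ n)) r = (\<integral>\<^sup>+t. 0 \<partial>(lborel :: real measure))"
      unfolding ray_integral_def using assms(2)
      by (intro nn_integral_cong) (auto simp: indicator_def max_absorb1 zero_power)
    with True show ?thesis by (simp add: max_def)
  next
    case False
    have "ray_integral 1 (\<lambda>r. ennreal (c * max 0 r ^ n)) r =
        (\<integral>\<^sup>+t. ennreal (c * (r - t) ^ n) * indicator {0..r} t \<partial>lborel)"
      unfolding ray_integral_def using assms(2)
      by (intro nn_integral_cong) (auto simp: indicator_def max_absorb1 max_absorb2 zero_power)
    also have "\<dots> = ennreal (- (c * (r - r) ^ Suc n / real (Suc n)) - (- (c * (r - 0) ^ Suc n / real (Suc n))))"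
    proof (rule nn_integral_FTC_Icc)
      show "((\<lambda>t. - (c * (r - t) ^ Suc n / real (Suc n))) has_real_derivative c * (r - t) ^ n) (at t)" for t
        by (rule derivative_eq_intros refl | simp)+
    qed (use False assms in auto)
    finally show ?thesis using False by (simp add: max_def field_simps)
  qed
qed

lemma closed_octant: "closed octant"
  unfolding octant_def by (intro closed_Collect_conj closed_Collect_le continuous_intros)

lemma continuous_on_bary: "continuous_on UNIV (bary p1 p2 p3)"
  unfolding bary_def Let_def cross2_def divide_inverse by (intro continuous_intros)

lemma area_scaled_triangle:
  assumes "r \<ge> 0"
  shows "measure lborel (convex hull {c + r *\<^sub>R p1, c + r *\<^sub>R p2, c + r *\<^sub>R p3}) =
         r\<^sup>2 * measure lborel (convex hull {p1, p2, p3 :: real^2})"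
proof -
  let ?d = "\<lambda>A B C :: real^2. (C $ 1 - A $ 1) * (B $ 2 - A $ 2) - (B $ 1 - A $ 1) * (C $ 2 - A $ 2)"
  have "?d (c + r *\<^sub>R p1) (c + r *\<^sub>R p2) (c + r *\<^sub>R p3) = r\<^sup>2 * ?d p1 p2 p3"
    by (simp add: algebra_simps power2_eq_square)
  then show ?thesis unfolding content_triangle by (simp only: abs_mult) simp
qed

lemma five_indices: obtains "is" :: "5 list" where "distinct is" "set is = UNIV" "length is = 5"
proof -
  obtain xs :: "5 list" where "set xs = UNIV" "distinct xs"
    using finite_distinct_list[of "UNIV :: 5 set"] by auto
  moreover have "length xs = 5" using calculation distinct_card[of xs] by simp
  ultimately show ?thesis using that by blast
qed

context simplex_vertices
begin

lemma compact_weights: "compact (weights x)"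
proof -
  have "closed (weights x)"
    unfolding weights_def
    by (intro closed_Collect_conj closed_Collect_all closed_Collect_le continuous_intros
       continuous_closed_preimage[of UNIV, OF _ _ closed_octant, unfolded vimage_def, simplified])
  moreover have "l $ j \<le> 1" "0 \<le> l $ j" if "l \<in> weights x" for l j
  proof -
    have l: "\<forall>j. 0 \<le> l $ j" "B x - (\<Sum>j\<in>UNIV. (l $ j) *\<^sub>R a j) \<in> octant"
      using that by (auto simp: weights_def)
    have "coord_sum (B x - (\<Sum>j\<in>UNIV. (l $ j) *\<^sub>R a j)) = 1 - (\<Sum>j\<in>UNIV. l $ j)"
      by (simp add: linear_diff[OF linear_coord_sum] linear_sum[OF linear_coord_sum]
          linear_cmul[OF linear_coord_sum] coord_sum_bary)
    then have "(\<Sum>j\<in>UNIV. l $ j) \<le> 1" using l(2) by (auto simp: octant_def coord_sum_def)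
    moreover have "l $ j \<le> (\<Sum>j\<in>UNIV. l $ j)" using l(1) by (intro member_le_sum) auto
    ultimately show "l $ j \<le> 1" "0 \<le> l $ j" using l(1) by auto
  qed
  then have "weights x \<subseteq> cbox 0 (\<chi> j. 1)" by (auto simp: mem_box_cart)
  then have "bounded (weights x)" using bounded_cbox bounded_subset by blast
  ultimately show ?thesis by (simp add: compact_eq_bounded_closed)
qed

lemma compact_fibre: "compact {y. (x, y) \<in> \<sigma>}"
  unfolding fibre_eq
  by (intro compact_translation compact_continuous_image compact_weights linear_continuous_on
      linear_M[unfolded linear_conv_bounded_linear])

lemma compact_simplex: "compact \<sigma>"
  unfolding \<sigma>_def by (intro finite_imp_compact_convex_hull) auto

lemma measure_fibre: "measure lborel {y. (x, y) \<in> \<sigma>} = \<bar>det (matrix M)\<bar> * measure lborel (weights x)"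
proof -
  have "measure lborel {y. (x, y) \<in> \<sigma>} = measure lebesgue {y. (x, y) \<in> \<sigma>}"
    using compact_fibre[of x] by (simp add: compact_imp_closed)
  also have "\<dots> = measure lebesgue (M ` weights x)"
    unfolding fibre_eq by (rule measure_translation)
  also have "\<dots> = \<bar>det (matrix M)\<bar> * measure lebesgue (weights x)"
    by (intro measure_linear_image linear_M lmeasurable_compact compact_weights)
  also have "measure lebesgue (weights x) = measure lborel (weights x)"
    using compact_weights[of x] by (simp add: compact_imp_closed)
  finally show ?thesis .
qed

lemma emeasure_compact:
  "compact S \<Longrightarrow> emeasure lborel S = ennreal (measure lborel (S :: 'b::euclidean_space set))"
  using emeasure_bounded_finite[of S] by (intro emeasure_eq_ennreal_measure) (auto simp: compact_imp_bounded)

lemma emeasure_fibre: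
  "emeasure lborel {y. (x, y) \<in> \<sigma>} = ennreal \<bar>det (matrix M)\<bar> * emeasure lborel (weights x)"
  unfolding emeasure_compact[OF compact_fibre] emeasure_compact[OF compact_weights] measure_fibre
  by (simp add: ennreal_mult)

lemma emeasure_weights_eq_integral:
  "emeasure lborel (weights x) =
     (\<integral>\<^sup>+l\<in>{l. \<forall>i. 0 \<le> l $ i}. indicator octant (B x - (\<Sum>j\<in>UNIV. (l $ j) *\<^sub>R a j)) \<partial>lborel)"
proof -
  have "emeasure lborel (weights x) = (\<integral>\<^sup>+l. indicator (weights x) l \<partial>lborel)"
    using compact_weights[of x] by (simp add: compact_imp_closed)
  also have "\<dots> = (\<integral>\<^sup>+l\<in>{l. \<forall>i. 0 \<le> l $ i}. indicator octant (B x - (\<Sum>j\<in>UNIV. (l $ j) *\<^sub>R a j)) \<partial>lborel)"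
    by (intro nn_integral_cong) (auto simp: weights_def indicator_def)
  finally show ?thesis .
qed

lemma emeasure_weights:
  assumes "distinct is" "set is = UNIV"
  shows "emeasure lborel (weights x) = foldr (\<lambda>j. ray_integral (a j)) is (indicator octant) (B x)"
  unfolding emeasure_weights_eq_integral
  by (rule nn_integral_orthant_rays[OF assms]) (simp add: closed_octant)

text \<open>
  For fixed weights with sum \<open>1 - r\<close>, the points \<open>x\<close> fill a copy of the triangle of the pivots
  scaled by \<open>r\<close>; this is the inner integral when the volume of the simplex is computed with
  the two integrations exchanged.
\<close>

lemma emeasure_slice:
  assumes l: "\<forall>j. 0 \<le> l $ j"
  shows "(\<integral>\<^sup>+x. indicator octant (B x - (\<Sum>j\<in>UNIV. (l $ j) *\<^sub>R a j)) \<partial>lborel)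
     = ennreal (measure lborel (convex hull {fst P1, fst P2, fst P3})) * ennreal (max 0 (1 - (\<Sum>j\<in>UNIV. l $ j)) ^ 2)"
proof -
  let ?s = "\<Sum>j\<in>UNIV. (l $ j) *\<^sub>R a j"
  let ?c = "\<Sum>j\<in>UNIV. (l $ j) *\<^sub>R fst (R j)"
  let ?p = "comb3 (fst P1) (fst P2) (fst P3)"
  let ?S = "{x. B x - ?s \<in> octant}"
  define r where "r = 1 - (\<Sum>j\<in>UNIV. l $ j)"
  have tot: "coord_sum (B x - ?s) = r" for x
    by (simp add: linear_diff[OF linear_coord_sum] linear_sum[OF linear_coord_sum]
          linear_cmul[OF linear_coord_sum] coord_sum_bary r_def)
  have closed: "closed ?S"
    by (intro continuous_closed_preimage[of UNIV, OF _ _ closed_octant, unfolded vimage_def, simplified]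
        continuous_intros continuous_on_bary)
  have "(\<integral>\<^sup>+x. indicator octant (B x - ?s) \<partial>lborel) = (\<integral>\<^sup>+x. indicator ?S x \<partial>lborel)"
    by (intro nn_integral_cong) (auto simp: indicator_def)
  also have "\<dots> = emeasure lborel ?S" using closed by simp
  finally have int: "(\<integral>\<^sup>+x. indicator octant (B x - ?s) \<partial>lborel) = emeasure lborel ?S" .
  have x: "x = ?c + ?p (B x - ?s)" for x
    by (simp add: linear_diff[OF linear_comb3] linear_sum[OF linear_comb3]
          linear_cmul[OF linear_comb3] comb3_bary[OF pivots])
  consider "r < 0" | "r = 0" | "r > 0" by linarith
  then show ?thesis
  proof cases
    case 1
    have False if "x \<in> ?S" for x
      using that tot[of x] 1 unfolding octant_def coord_sum_def by auto
    then have "?S = {}" by blast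
    then show ?thesis using int 1 by (simp flip: r_def)
  next
    case 2
    have "?S \<subseteq> {?c}"
    proof
      fix x assume "x \<in> ?S"
      then have "B x - ?s = 0" using tot[of x] 2
        by (auto simp: octant_def coord_sum_def prod_eq_iff)
      then show "x \<in> {?c}" using x[of x] by (simp add: comb3_def)
    qed
    then have "emeasure lborel ?S \<le> emeasure lborel {?c}" by (intro emeasure_mono) auto
    then show ?thesis using int 2 by (simp flip: r_def)
  next
    case 3
    have "?S = convex hull {?c + r *\<^sub>R fst P1, ?c + r *\<^sub>R fst P2, ?c + r *\<^sub>R fst P3}" (is "_ = ?H")
    proof (intro set_eqI iffI)
      fix x assume "x \<in> ?S"
      then have oct: "B x - ?s \<in> octant" by (rule CollectD)
      obtain b1 b2 b3 where b: "B x - ?s = (b1, b2, b3)" by (rule prod_cases3)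
      have pos: "0 \<le> b1" "0 \<le> b2" "0 \<le> b3" using oct[unfolded b] by (simp_all add: octant_def)
      have sum: "b1 + b2 + b3 = r" using tot[of x] by (simp add: b coord_sum_def)
      then have 1: "b1 / r + b2 / r + b3 / r = 1" using 3 by (simp flip: add_divide_distrib)
      have "x = (b1 / r + b2 / r + b3 / r) *\<^sub>R ?c + (b1 *\<^sub>R fst P1 + b2 *\<^sub>R fst P2 + b3 *\<^sub>R fst P3)"
        using x[of x] unfolding 1 by (simp add: b comb3_def)
      also have "\<dots> = (b1 / r) *\<^sub>R (?c + r *\<^sub>R fst P1) + (b2 / r) *\<^sub>R (?c + r *\<^sub>R fst P2)
            + (b3 / r) *\<^sub>R (?c + r *\<^sub>R fst P3)"
        using 3 by (simp add: algebra_simps)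
      finally show "x \<in> ?H" unfolding convex_hull_3 using pos 1 3 by fastforce
    next
      fix x assume "x \<in> ?H"
      then obtain u v w where uvw: "0 \<le> u" "0 \<le> v" "0 \<le> w" "u + v + w = 1"
        "x = u *\<^sub>R (?c + r *\<^sub>R fst P1) + v *\<^sub>R (?c + r *\<^sub>R fst P2) + w *\<^sub>R (?c + r *\<^sub>R fst P3)"
        unfolding convex_hull_3 by auto
      let ?b = "r *\<^sub>R (u, v, w)"
      have "x = (u + v + w) *\<^sub>R ?c + ?p ?b" unfolding uvw(5) by (simp add: comb3_def algebra_simps)
      then have x': "x = ?p ?b + ?c" using uvw(4) by simp
      have "r * u + r * v + r * w = r * (u + v + w)" by (simp only: distrib_left)
      then have "coord_sum ?b = r" using uvw(4) by (simp add: coord_sum_def)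
      then have "coord_sum ?b + (\<Sum>j\<in>UNIV. l $ j) = 1" by (simp add: r_def)
      from bary_affine_combination[OF pivots this, of "\<lambda>j. fst (R j)"]
      have "B x - ?s = ?b" unfolding x' by simp
      moreover have "?b \<in> octant" using uvw 3 by (simp add: octant_def)
      ultimately show "x \<in> ?S" by (simp only: mem_Collect_eq)
    qed
    moreover have "compact ?H" by (intro finite_imp_compact_convex_hull) auto
    ultimately show ?thesis
      unfolding int r_def[symmetric] using 3 by (simp only: emeasure_compact area_scaled_triangle[OF less_imp_le])
       (simp add: ennreal_mult mult.commute)
  qed
qed

text \<open>
  The factor is \<open>2! / 7!\<close>: five integrations turn the squared scale \<open>r\<^sup>2\<close> of a slice into
  \<open>2 r\<^sup>7 / 7!\<close>, evaluated at \<open>r = 1\<close>.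
\<close>

lemma measure_simplex:
  "measure lborel \<sigma> = \<bar>det (matrix M)\<bar> * measure lborel (convex hull {fst P1, fst P2, fst P3}) / 2520"
proof -
  let ?d = "\<bar>det (matrix M)\<bar>" and ?A = "measure lborel (convex hull {fst P1, fst P2, fst P3})"
  obtain "is" :: "5 list" where is5: "distinct is" "set is = UNIV" "length is = 5" by (rule five_indices)
  let ?h = "\<lambda>x l. indicator octant (B x - (\<Sum>j\<in>UNIV. (l $ j) *\<^sub>R a j)) * indicator {l. \<forall>i. 0 \<le> l $ i} l :: ennreal"
  have cl: "closed {(x, l :: real^5). B x - (\<Sum>j\<in>UNIV. (l $ j) *\<^sub>R a j) \<in> octant \<and> (\<forall>i. 0 \<le> l $ i)}"
    (is "closed ?C")
    unfolding split_beta'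
    by (intro closed_Collect_conj closed_Collect_all closed_Collect_le continuous_intros
       continuous_closed_preimage[of UNIV, OF _ _ closed_octant, unfolded vimage_def, simplified]
       continuous_on_compose2[OF continuous_on_bary]) auto
  have "(\<lambda>(x, l). ?h x l) = indicator ?C" by (auto simp: indicator_def)
  moreover have "?C \<in> sets (lborel \<Otimes>\<^sub>M lborel)" using cl by (simp only: lborel_prod) simp
  ultimately have meas: "(\<lambda>(x, l). ?h x l) \<in> borel_measurable (lborel \<Otimes>\<^sub>M lborel)" by simp
  have oct: "{l::real^5. \<forall>i. 0 \<le> l $ i} \<in> sets lborel"
    unfolding sets_lborel by (intro borel_closed closed_Collect_all closed_Collect_le continuous_intros)
  have "emeasure lborel \<sigma> = emeasure (lborel \<Otimes>\<^sub>M lborel) \<sigma>" by (simp add: lborel_prod)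
  also have "\<dots> = (\<integral>\<^sup>+x. emeasure lborel (Pair x -` \<sigma>) \<partial>lborel)"
    using compact_simplex
    by (intro lborel.emeasure_pair_measure_alt) (simp only: lborel_prod, simp add: compact_imp_closed)
  also have "\<dots> = (\<integral>\<^sup>+x. ennreal ?d * (\<integral>\<^sup>+l. ?h x l \<partial>lborel) \<partial>lborel)"
    by (simp add: vimage_def emeasure_fibre emeasure_weights_eq_integral)
  also have "\<dots> = ennreal ?d * (\<integral>\<^sup>+x. (\<integral>\<^sup>+l. ?h x l \<partial>lborel) \<partial>lborel)"
    using lborel.borel_measurable_nn_integral[OF meas] by (intro nn_integral_cmult) simp
  \<comment> \<open>with the weights outside, the inner integral is the area of a triangle\<close>
  also have "(\<integral>\<^sup>+x. (\<integral>\<^sup>+l. ?h x l \<partial>lborel) \<partial>lborel) = (\<integral>\<^sup>+l. (\<integral>\<^sup>+x. ?h x l \<partial>lborel) \<partial>lborel)"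
    using lborel_pair.Fubini'[OF meas] by simp
  also have "\<dots> = (\<integral>\<^sup>+l. ennreal ?A * (ennreal (1 * max 0 (1 - (\<Sum>j\<in>UNIV. (l $ j) *\<^sub>R 1)) ^ 2) * indicator {l. \<forall>i. 0 \<le> l $ i} l) \<partial>(lborel :: (real^5) measure))"
  proof (intro nn_integral_cong)
    fix l :: "real^5"
    show "(\<integral>\<^sup>+x. ?h x l \<partial>lborel) =
       ennreal ?A * (ennreal (1 * max 0 (1 - (\<Sum>j\<in>UNIV. (l $ j) *\<^sub>R 1)) ^ 2) * indicator {l. \<forall>i. 0 \<le> l $ i} l)"
    proof (cases "\<forall>i. 0 \<le> l $ i")
      case True
      have ind: "indicator {l. \<forall>i. 0 \<le> l $ i} l = (1::ennreal)" using True by simp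
      show ?thesis unfolding ind mult_1_right emeasure_slice[OF True] by simp
    next
      case False
      have ind: "indicator {l. \<forall>i. 0 \<le> l $ i} l = (0::ennreal)" using False by simp
      show ?thesis unfolding ind by simp
    qed
  qed
  also have "\<dots> = ennreal ?A * (\<integral>\<^sup>+l\<in>{l. \<forall>i. 0 \<le> l $ i}. ennreal (1 * max 0 (1 - (\<Sum>j\<in>UNIV. (l $ j) *\<^sub>R 1)) ^ 2) \<partial>(lborel :: (real^5) measure))"
    using oct by (intro nn_integral_cmult) measurable
  also have "(\<integral>\<^sup>+l\<in>{l. \<forall>i. 0 \<le> l $ i}. ennreal (1 * max 0 (1 - (\<Sum>j\<in>UNIV. (l $ j) *\<^sub>R 1)) ^ 2) \<partial>(lborel :: (real^5) measure))
     = foldr (\<lambda>_. ray_integral (1::real)) is (\<lambda>r. ennreal (1 * max 0 r ^ 2)) 1"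
    by (rule nn_integral_orthant_rays[OF is5(1,2), where F="\<lambda>r. ennreal (1 * max 0 r ^ 2)"]) measurable
  also have "\<dots> = ennreal (1 / 2520)"
  proof -
    obtain i1 i2 i3 i4 i5 where is5': "is = [i1, i2, i3, i4, i5]"
      using is5(3) by (auto simp: numeral_eq_Suc length_Suc_conv)
    have 1: "ray_integral 1 (\<lambda>r::real. ennreal (1 * max 0 r ^ 2)) = (\<lambda>r. ennreal (1/3 * max 0 r ^ 3))"
      using ray_integral_pos_power[of 1 2] by simp
    have 2: "ray_integral 1 (\<lambda>r::real. ennreal (1/3 * max 0 r ^ 3)) = (\<lambda>r. ennreal (1/12 * max 0 r ^ 4))"
      using ray_integral_pos_power[of "1/3" 3] by simp
    have 3: "ray_integral 1 (\<lambda>r::real. ennreal (1/12 * max 0 r ^ 4)) = (\<lambda>r. ennreal (1/60 * max 0 r ^ 5))"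
      using ray_integral_pos_power[of "1/12" 4] by simp
    have 4: "ray_integral 1 (\<lambda>r::real. ennreal (1/60 * max 0 r ^ 5)) = (\<lambda>r. ennreal (1/360 * max 0 r ^ 6))"
      using ray_integral_pos_power[of "1/60" 5] by simp
    have 5: "ray_integral 1 (\<lambda>r::real. ennreal (1/360 * max 0 r ^ 6)) = (\<lambda>r. ennreal (1/2520 * max 0 r ^ 7))"
      using ray_integral_pos_power[of "1/360" 6] by simp
    show ?thesis unfolding is5' foldr.simps o_apply id_apply 1 2 3 4 5 by simp
  qed
  also have "ennreal ?d * (ennreal ?A * ennreal (1 / 2520)) = ennreal (?d * ?A / 2520)"
  proof -
    have A: "ennreal ?A * ennreal (1 / 2520) = ennreal (?A * (1 / 2520))"
      by (rule ennreal_mult[symmetric]) (rule measure_nonneg, simp)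
    have "ennreal ?d * ennreal (?A * (1 / 2520)) = ennreal (?d * (?A * (1 / 2520)))"
      by (rule ennreal_mult[symmetric]) (rule abs_ge_zero, rule mult_nonneg_nonneg, rule measure_nonneg, simp)
    then show ?thesis unfolding A by (simp only: times_divide_eq_right mult_1_right)
  qed
  finally have e: "emeasure lborel \<sigma> = ennreal (?d * ?A / 2520)" .
  have "0 \<le> ?d * ?A / 2520"
    by (intro divide_nonneg_nonneg mult_nonneg_nonneg abs_ge_zero measure_nonneg) simp
  note nonneg = this
  have "measure lborel \<sigma> = enn2real (emeasure lborel \<sigma>)" by (rule measure_def)
  also have "\<dots> = enn2real (ennreal (?d * ?A / 2520))" by (rule arg_cong[OF e])
  also have "\<dots> = ?d * ?A / 2520" by (rule enn2real_ennreal) (rule nonneg)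
  finally show ?thesis .
qed

lemma fibre_ratio:
  assumes "distinct is" "set is = UNIV"
  shows "measure lborel {y. (x, y) \<in> \<sigma>} / measure lborel \<sigma> =
     2520 / measure lborel (convex hull {fst P1, fst P2, fst P3})
       * enn2real (foldr (\<lambda>j. ray_integral (a j)) is (indicator octant) (B x))"
proof -
  have w: "measure lborel (weights x) = enn2real (foldr (\<lambda>j. ray_integral (a j)) is (indicator octant) (B x))"
    by (simp only: measure_def emeasure_weights[OF assms])
  have cancel: "(d * w) / (d * A / 2520) = 2520 / A * w" if "d \<noteq> 0" for d w A :: real
    using that by (cases "A = 0") (simp_all add: field_simps)
  have "\<bar>det (matrix M)\<bar> \<noteq> 0" using det_M by simp
  from cancel[OF this] show ?thesis by (simp only: measure_simplex measure_fibre w)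
qed

end

lemma image_mset_eq_mset_list:
  "image_mset f M = mset ys \<Longrightarrow> \<exists>xs. mset xs = M \<and> map f xs = ys"
proof (induction ys arbitrary: M)
  case (Cons y ys)
  then obtain x M' where x: "M = add_mset x M'" "f x = y" "image_mset f M' = mset ys"
    by (auto dest!: msed_map_invR)
  then obtain xs where "mset xs = M'" "map f xs = ys" using Cons.IH by blast
  with x show ?case by (intro exI[of _ "x # xs"]) simp
qed simp

lemma ex_fun_map_eq:
  assumes "distinct xs" "length ys = length xs"
  shows "\<exists>f. map f xs = ys"
  using assms
proof (induction xs arbitrary: ys)
  case (Cons x xs)
  then obtain y ys' where y: "ys = y # ys'" "length ys' = length xs" by (cases ys) auto
  then obtain f where "map f xs = ys'" using Cons by auto
  then have "map (f(x := y)) (x # xs) = ys" using Cons.prems y by simp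
  then show ?case by (intro exI[of _ "f(x := y)"])
qed simp

text \<open>
  Put the pivots at height zero and lift each of the other five knots along its own coordinate
  axis of \<open>\<real>\<^sup>5\<close>.
\<close>

lemma simplex_over_exists:
  assumes D: "cross2 (p2 - p1) (p3 - p1) \<noteq> 0" and len: "length qs = 5"
  shows "\<exists>W. simplex_over (mset ([p1, p2, p3] @ qs)) W"
proof -
  obtain "is" :: "5 list" where is5: "distinct is" "set is = UNIV" "length is = 5" by (rule five_indices)
  then obtain q where q: "map q is = qs" using ex_fun_map_eq[of "is" qs] len by auto
  let ?P1 = "(p1, 0 :: real^5)" and ?P2 = "(p2, 0 :: real^5)" and ?P3 = "(p3, 0 :: real^5)"
  define R where "R j = (q j, axis j 1 :: real^5)" for j
  let ?W = "{?P1, ?P2, ?P3} \<union> range R"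
  have ne: "p1 \<noteq> p2" "p1 \<noteq> p3" "p2 \<noteq> p3" using D by (auto simp: cross2_def algebra_simps)
  have "x \<notin> range R" if "snd x = 0" for x
    using that by (auto simp: R_def axis_eq_0_iff)
  moreover have "inj R" by (auto simp: R_def inj_def axis_eq_axis)
  ultimately have V: "distinct [?P1, ?P2, ?P3]" "inj R" "?P1 \<notin> range R" "?P2 \<notin> range R" "?P3 \<notin> range R"
    using ne by simp_all
  have "\<not> affine_dependent ?W"
  proof
    assume "affine_dependent ?W"
    then obtain u where u: "sum u ?W = 0" "\<exists>v\<in>?W. u v \<noteq> 0" "(\<Sum>v\<in>?W. u v *\<^sub>R v) = 0"
      by (subst (asm) affine_dependent_explicit_finite) auto
    have s: "u ?P1 + u ?P2 + u ?P3 + (\<Sum>j\<in>UNIV. u (R j)) = 0"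
      using u(1) unfolding sum_over_vertices[OF V] .
    have v: "u ?P1 *\<^sub>R ?P1 + u ?P2 *\<^sub>R ?P2 + u ?P3 *\<^sub>R ?P3 + (\<Sum>j\<in>UNIV. u (R j) *\<^sub>R R j) = 0"
      using u(3) unfolding sum_over_vertices[OF V] .
    have "(\<Sum>j\<in>UNIV. u (R j) *\<^sub>R axis j (1::real)) = 0"
      using arg_cong[OF v, of snd] by (simp add: snd_sum R_def)
    then have "(\<Sum>j\<in>UNIV. u (R j) * (axis j (1::real) $ i)) = 0" for i
      by (simp add: vec_eq_iff)
    then have uR: "u (R i) = 0" for i
      by (simp add: axis_def if_distrib[of "\<lambda>z. _ * z"] cong: if_cong)
    have s': "u ?P1 = - u ?P2 - u ?P3" using s uR by simp
    have "u ?P1 *\<^sub>R p1 + u ?P2 *\<^sub>R p2 + u ?P3 *\<^sub>R p3 = 0"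
      using arg_cong[OF v, of fst] uR by (simp add: fst_sum)
    then have v': "u ?P2 *\<^sub>R (p2 - p1) + u ?P3 *\<^sub>R (p3 - p1) = 0"
      unfolding s' by (simp add: algebra_simps)
    have "u ?P2 * cross2 (p2 - p1) (p3 - p1) = cross2 (u ?P2 *\<^sub>R (p2 - p1) + u ?P3 *\<^sub>R (p3 - p1)) (p3 - p1)"
      "u ?P3 * cross2 (p2 - p1) (p3 - p1) = cross2 (p2 - p1) (u ?P2 *\<^sub>R (p2 - p1) + u ?P3 *\<^sub>R (p3 - p1))"
      by (simp_all add: cross2_def algebra_simps)
    then have "u ?P2 = 0" "u ?P3 = 0" using D unfolding v' by (simp_all add: cross2_def)
    then show False using u(2) uR s' by auto
  qed
  moreover have "image_mset fst (mset_set ?W) = mset ([p1, p2, p3] @ qs)"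
  proof -
    have W: "?W = set ([?P1, ?P2, ?P3] @ map R is)" using is5 by simp
    have "distinct ([?P1, ?P2, ?P3] @ map R is)"
      using V is5 by (auto simp: distinct_map inj_on_def)
    then have "mset_set ?W = mset ([?P1, ?P2, ?P3] @ map R is)"
      unfolding W by (rule mset_set_set)
    moreover have "map (fst \<circ> R) is = qs" using q by (simp add: R_def comp_def)
    ultimately show ?thesis by (simp flip: mset_map add: o_def)
  qed
  ultimately show ?thesis unfolding simplex_over_def by (intro exI[of _ ?W]) auto
qed

text \<open>
  The factor is \<open>2520 / 21\<close>, that is \<open>5!\<close>.  The right-hand side does not mention the simplex, so
  the arbitrary choice in the definition is harmless.
\<close>

theorem simplex_spline_eq_rays:
  assumes K: "knots v1 v2 v3 m = mset ([p1, p2, p3] @ qs)" and len: "length qs = 5"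
    and D: "cross2 (p2 - p1) (p3 - p1) \<noteq> 0"
  shows "simplex_spline v1 v2 v3 m x =
     120 * measure lborel (triangle v1 v2 v3) / measure lborel (triangle p1 p2 p3) *
       enn2real (foldr (\<lambda>q. ray_integral (bary p1 p2 p3 q)) qs (indicator octant) (bary p1 p2 p3 x))"
proof -
  obtain "is" :: "5 list" where is5: "distinct is" "set is = UNIV" "length is = 5" by (rule five_indices)
  define W where "W = (SOME W. simplex_over (knots v1 v2 v3 m) W)"
  have "simplex_over (knots v1 v2 v3 m) W"
    unfolding W_def K by (rule someI_ex) (rule simplex_over_exists[OF D len])
  then have W: "finite W" "\<not> affine_dependent W" "image_mset fst (mset_set W) = mset ([p1, p2, p3] @ qs)"
    by (auto simp: simplex_over_def K)
  obtain ws where ws: "mset ws = mset_set W" "map fst ws = [p1, p2, p3] @ qs"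
    using image_mset_eq_mset_list[OF W(3)] by blast
  obtain P1 P2 P3 rs where wsp: "ws = [P1, P2, P3] @ rs" "fst P1 = p1" "fst P2 = p2" "fst P3 = p3" "map fst rs = qs"
    using ws(2) by (auto simp: map_eq_append_conv map_eq_Cons_conv)
  obtain R where R: "map R is = rs"
  proof -
    have "length rs = length is" using wsp(5) len is5(3) by auto
    from ex_fun_map_eq[OF is5(1) this] show ?thesis using that by blast
  qed
  have set_ws: "set ws = W" using ws(1) W(1) by (metis finite_set_mset_mset_set set_mset_mset)
  have "distinct ws"
  proof -
    have "card (set ws) = length ws"
      unfolding set_ws using ws(1) by (metis size_mset size_mset_set)
    then show ?thesis by (rule card_distinct)
  qed
  then have dist: "distinct ([P1, P2, P3] @ map R is)" unfolding wsp(1) R .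
  have range: "range R = set rs" using R is5(2) by (metis list.set_map)
  have Weq: "W = {P1, P2, P3} \<union> range R" using set_ws unfolding wsp(1) range by auto
  interpret simplex_vertices P1 P2 P3 R
  proof
    show "inj R" using dist is5(2) by (simp add: distinct_map)
    show "\<not> affine_dependent ({P1, P2, P3} \<union> range R)" using W(2) Weq by simp
    show "cross2 (fst P2 - fst P1) (fst P3 - fst P1) \<noteq> 0" using D by (simp add: wsp)
  qed (use dist is5(2) in auto)
  have qs: "map (fst \<circ> R) is = qs" using R wsp(5) by auto
  have "measure lborel {y. (x, y) \<in> \<sigma>} / measure lborel \<sigma> =
     2520 / measure lborel (triangle p1 p2 p3)
       * enn2real (foldr (\<lambda>q. ray_integral (bary p1 p2 p3 q)) qs (indicator octant) (bary p1 p2 p3 x))"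
    unfolding fibre_ratio[OF is5(1,2)] wsp triangle_def
    by (simp flip: qs add: foldr_map comp_def wsp)
  then have "measure lborel {y. (x, y) \<in> convex hull W} / measure lborel (convex hull W) =
     2520 / measure lborel (triangle p1 p2 p3)
       * enn2real (foldr (\<lambda>q. ray_integral (bary p1 p2 p3 q)) qs (indicator octant) (bary p1 p2 p3 x))"
    unfolding \<sigma>_def Weq .
  moreover have "(7::nat) choose 2 = 21" by (simp add: choose_two)
  ultimately show ?thesis unfolding simplex_spline_def W_def[symmetric] Let_def by simp
qed

section \<open>Truncated powers and integration along rays\<close>

text \<open>
  For \<open>n = 0\<close> this is the constant 1 and not the Heaviside function; only positive exponents
  truncate.
\<close>

definition pos_pow :: "nat \<Rightarrow> real \<Rightarrow> real" where
  "pos_pow n x = max 0 x ^ n"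

lemma pos_pow_nonneg_arg: "0 \<le> x \<Longrightarrow> pos_pow n x = x ^ n"
  and pos_pow_nonpos_arg: "x \<le> 0 \<Longrightarrow> 0 < n \<Longrightarrow> pos_pow n x = 0"
  by (simp_all add: pos_pow_def max_absorb1 max_absorb2)

lemma continuous_on_pos_pow [continuous_intros]:
  "continuous_on A f \<Longrightarrow> continuous_on A (\<lambda>x. pos_pow n (f x))"
  unfolding pos_pow_def by (intro continuous_intros)

text \<open>
  For \<open>n = 1\<close> and \<open>x < 0\<close> the derivative is 0 although \<open>pos_pow 0 x = 1\<close>, hence the case distinction.
\<close>

lemma DERIV_pos_pow:
  assumes "n \<ge> 2 \<or> x \<noteq> 0"
  shows "(pos_pow n has_real_derivative real n * (if x < 0 then 0 else pos_pow (n - 1) x)) (at x)"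
proof -
  consider "x < 0" | "x > 0" | "x = 0" "n \<ge> 2" using assms by linarith
  then show ?thesis
  proof cases
    case 1
    have "((\<lambda>_. 0 ^ n) has_real_derivative 0) (at x)" by simp
    then have "(pos_pow n has_real_derivative 0) (at x)"
      by (rule has_field_derivative_transform_within_open[where S = "{..<0}"])
         (use 1 in \<open>auto simp: pos_pow_def\<close>)
    then show ?thesis using 1 by simp
  next
    case 2
    have "((\<lambda>y. y ^ n) has_real_derivative real n * x ^ (n - 1)) (at x)"
      using DERIV_pow[of n x] by simp
    then have "(pos_pow n has_real_derivative real n * x ^ (n - 1)) (at x)"
      by (rule has_field_derivative_transform_within_open[where S = "{0<..}"])
         (use 2 in \<open>auto simp: pos_pow_def max_absorb2\<close>)
    then show ?thesis using 2 by (simp add: pos_pow_def max_absorb2)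
  next
    case 3
    have "((\<lambda>h. pos_pow n h / h) \<longlongrightarrow> 0) (at 0)"
    proof (rule Lim_null_comparison)
      show "\<forall>\<^sub>F h in at 0. norm (pos_pow n h / h) \<le> \<bar>h\<bar> ^ (n - 1)"
      proof (rule eventually_at_filter[THEN iffD2], rule always_eventually, intro allI impI)
        fix h :: real assume "h \<noteq> 0"
        have "\<bar>max 0 h ^ n\<bar> \<le> \<bar>h\<bar> ^ n" by (simp add: power_abs[symmetric] power_mono abs_if max_def)
        also have "\<bar>h\<bar> ^ n = \<bar>h\<bar> ^ (n - 1) * \<bar>h\<bar>" using 3 by (cases n) auto
        finally show "norm (pos_pow n h / h) \<le> \<bar>h\<bar> ^ (n - 1)"
          using \<open>h \<noteq> 0\<close> by (simp add: pos_pow_def divide_le_eq)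
      qed
      have "((\<lambda>h::real. \<bar>h\<bar> ^ (n - 1)) \<longlongrightarrow> \<bar>0\<bar> ^ (n - 1)) (at 0)" by (intro tendsto_intros)
      then show "((\<lambda>h::real. \<bar>h\<bar> ^ (n - 1)) \<longlongrightarrow> 0) (at 0)" using 3 by (simp add: zero_power)
    qed
    then show ?thesis using 3 by (simp add: DERIV_def pos_pow_def zero_power)
  qed
qed

lemma DERIV_pos_pow_chain [derivative_intros]:
  assumes "(f has_real_derivative D) (at x within S)" "n \<ge> 2"
  shows "((\<lambda>x. pos_pow n (f x)) has_real_derivative real n * pos_pow (n - 1) (f x) * D) (at x within S)"
proof -
  have "real n * (if f x < 0 then 0 else pos_pow (n - 1) (f x)) = real n * pos_pow (n - 1) (f x)"
    using assms(2) by (auto simp: pos_pow_def max_absorb1 zero_power)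
  then show ?thesis
    using DERIV_chain[OF DERIV_pos_pow[of n "f x"] assms(1)] assms(2) by (simp add: o_def)
qed

text \<open>
  \<open>V\<close> is given on the octant by the formula \<open>h\<close> and is zero elsewhere.  Nonnegativity is
  included because \<^typ>\<open>ennreal\<close> would cut off negative values; it propagates from \<open>h\<close> to
  its integrals.
\<close>

definition represents :: "(real \<times> real \<times> real \<Rightarrow> ennreal) \<Rightarrow> (real \<Rightarrow> real \<Rightarrow> real \<Rightarrow> real) \<Rightarrow> bool" where
  "represents V h \<longleftrightarrow>
     (\<forall>a b c. 0 \<le> a \<longrightarrow> 0 \<le> b \<longrightarrow> 0 \<le> c \<longrightarrow> 0 \<le> h a b c) \<and>
     V = (\<lambda>(a, b, c). if 0 \<le> a \<and> 0 \<le> b \<and> 0 \<le> c then ennreal (h a b c) else 0)"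

text \<open>
  The fundamental theorem of calculus on the part of the ray inside the octant: \<open>\<tau>\<close> is the
  parameter at which the ray from \<open>(a, b, c)\<close> leaves it, and \<open>H\<close> is normalised to vanish there.
  Since \<open>(d1, d2, d3)\<close> is nonnegative, a ray never returns.  Finitely many exceptional points are
  allowed because the first integrand of a chain is discontinuous.
\<close>

lemma represents_ray_integral:
  assumes V: "represents V h" and d: "0 \<le> d1" "0 \<le> d2" "0 \<le> d3"
    and exit: "\<And>a b c. 0 \<le> a \<Longrightarrow> 0 \<le> b \<Longrightarrow> 0 \<le> c \<Longrightarrow>
        0 \<le> \<tau> a b c \<and>
        (\<forall>t\<ge>0. t \<le> \<tau> a b c \<longleftrightarrow> 0 \<le> a - t * d1 \<and> 0 \<le> b - t * d2 \<and> 0 \<le> c - t * d3) \<and>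
        H (a - \<tau> a b c * d1) (b - \<tau> a b c * d2) (c - \<tau> a b c * d3) = 0"
    and cont: "\<And>a b c. continuous_on UNIV (\<lambda>t. H (a - t * d1) (b - t * d2) (c - t * d3))"
    and deriv: "\<And>a b c. \<exists>S. finite S \<and> (\<forall>t. t \<notin> S \<longrightarrow>
        ((\<lambda>t. H (a - t * d1) (b - t * d2) (c - t * d3)) has_real_derivative
           - h (a - t * d1) (b - t * d2) (c - t * d3)) (at t))"
  shows "represents (ray_integral (d1, d2, d3) V) H"
proof -
  have Veq: "V (a, b, c) = (if 0 \<le> a \<and> 0 \<le> b \<and> 0 \<le> c then ennreal (h a b c) else 0)" for a b c
    using V by (simp add: represents_def)
  have h: "0 \<le> h a b c" if "0 \<le> a" "0 \<le> b" "0 \<le> c" for a b c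
    using V that by (simp add: represents_def)
  have inside: "0 \<le> H a b c \<and> ray_integral (d1, d2, d3) V (a, b, c) = ennreal (H a b c)"
    if abc: "0 \<le> a" "0 \<le> b" "0 \<le> c" for a b c
  proof -
    let ?h = "\<lambda>t. h (a - t * d1) (b - t * d2) (c - t * d3)"
    let ?H = "\<lambda>t. H (a - t * d1) (b - t * d2) (c - t * d3)"
    define T where "T = \<tau> a b c"
    have T: "0 \<le> T" "\<And>t. 0 \<le> t \<Longrightarrow> t \<le> T \<longleftrightarrow> 0 \<le> a - t * d1 \<and> 0 \<le> b - t * d2 \<and> 0 \<le> c - t * d3"
        "?H T = 0"
      using exit[OF abc] by (auto simp: T_def)
    obtain S where S: "finite S" "\<And>t. t \<notin> S \<Longrightarrow> (?H has_real_derivative - ?h t) (at t)"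
      using deriv by blast
    have vd: "(?H has_vector_derivative - ?h t) (at t)" if "t \<in> {0<..<T} - S" for t
    proof -
      have "t \<notin> S" using that by blast
      from S(2)[OF this] show ?thesis unfolding has_real_derivative_iff_has_vector_derivative .
    qed
    have "((\<lambda>t. - ?h t) has_integral (?H T - ?H 0)) {0..T}"
      by (rule fundamental_theorem_of_calculus_interior_strong[OF S(1) T(1) vd])
         (simp, rule continuous_on_subset[OF cont subset_UNIV])
    from has_integral_neg[OF this] have int: "(?h has_integral H a b c) {0..T}"
      unfolding T(3) by simp
    have nn: "0 \<le> ?h t" if "t \<in> {0..T}" for t using that T(2)[of t] by (intro h) auto
    have "ray_integral (d1, d2, d3) V (a, b, c) = (\<integral>\<^sup>+t. ennreal (?h t) * indicator {0..T} t \<partial>lborel)"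
      unfolding ray_integral_def using T(2)
      by (intro nn_integral_cong) (auto simp: Veq indicator_def)
    also have "\<dots> = ennreal (H a b c)"
      by (rule nn_integral_has_integral_lebesgue'[OF nn int])
    finally show ?thesis using has_integral_nonneg[OF int nn] by simp
  qed
  have outside: "ray_integral (d1, d2, d3) V (a, b, c) = 0" if "\<not> (0 \<le> a \<and> 0 \<le> b \<and> 0 \<le> c)" for a b c
  proof -
    have "\<not> (0 \<le> a - t * d1 \<and> 0 \<le> b - t * d2 \<and> 0 \<le> c - t * d3)" if "0 \<le> t" for t
      using \<open>\<not> (0 \<le> a \<and> 0 \<le> b \<and> 0 \<le> c)\<close> mult_nonneg_nonneg[OF that d(1)] mult_nonneg_nonneg[OF that d(2)]
        mult_nonneg_nonneg[OF that d(3)] by linarith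
    then have "ray_integral (d1, d2, d3) V (a, b, c) = (\<integral>\<^sup>+t. 0 \<partial>(lborel :: real measure))"
      unfolding ray_integral_def by (intro nn_integral_cong) (auto simp: Veq indicator_def)
    then show ?thesis by simp
  qed
  show ?thesis
    unfolding represents_def
  proof (intro conjI ext)
    fix x show "ray_integral (d1, d2, d3) V x =
      (case x of (a, b, c) \<Rightarrow> if 0 \<le> a \<and> 0 \<le> b \<and> 0 \<le> c then ennreal (H a b c) else 0)"
      using inside outside by (cases x) auto
  qed (use inside in auto)
qed

text \<open>
  The five directions that occur.  A vertex direction leaves the octant through one face, the
  direction of an edge midpoint through one of two.
\<close>

lemma represents_ray_v1:
  assumes "represents V h" and "\<And>b c. 0 \<le> b \<Longrightarrow> 0 \<le> c \<Longrightarrow> H 0 b c = 0"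
    and "\<And>a b c. continuous_on UNIV (\<lambda>t. H (a - t) b c)"
    and "\<And>a b c. \<exists>S. finite S \<and> (\<forall>t. t \<notin> S \<longrightarrow>
        ((\<lambda>t. H (a - t) b c) has_real_derivative - h (a - t) b c) (at t))"
  shows "represents (ray_integral (1, 0, 0) V) H"
  by (rule represents_ray_integral[OF assms(1), where \<tau> = "\<lambda>a b c. a"]) (use assms in auto)

lemma represents_ray_v2:
  assumes "represents V h" and "\<And>a c. 0 \<le> a \<Longrightarrow> 0 \<le> c \<Longrightarrow> H a 0 c = 0"
    and "\<And>a b c. continuous_on UNIV (\<lambda>t. H a (b - t) c)"
    and "\<And>a b c. \<exists>S. finite S \<and> (\<forall>t. t \<notin> S \<longrightarrow>
        ((\<lambda>t. H a (b - t) c) has_real_derivative - h a (b - t) c) (at t))"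
  shows "represents (ray_integral (0, 1, 0) V) H"
  by (rule represents_ray_integral[OF assms(1), where \<tau> = "\<lambda>a b c. b"]) (use assms in auto)

lemma represents_ray_v2_smooth:
  assumes "represents V h" and "\<And>a c. 0 \<le> a \<Longrightarrow> 0 \<le> c \<Longrightarrow> H a 0 c = 0"
    and "\<And>a b c t. ((\<lambda>t. H a (b - t) c) has_real_derivative - h a (b - t) c) (at t)"
  shows "represents (ray_integral (0, 1, 0) V) H"
proof (rule represents_ray_v2[OF assms(1)])
  fix a b c
  show "continuous_on UNIV (\<lambda>t. H a (b - t) c)"
    using assms(3) by (auto intro!: DERIV_continuous_on)
  show "\<exists>S. finite S \<and> (\<forall>t. t \<notin> S \<longrightarrow>
        ((\<lambda>t. H a (b - t) c) has_real_derivative - h a (b - t) c) (at t))"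
    using assms(3) by (intro exI[of _ "{}"]) simp
qed (use assms(2) in auto)

lemma represents_ray_v4:
  assumes "represents V h"
    and "\<And>b c. 0 \<le> b \<Longrightarrow> 0 \<le> c \<Longrightarrow> H 0 b c = 0" "\<And>a c. 0 \<le> a \<Longrightarrow> 0 \<le> c \<Longrightarrow> H a 0 c = 0"
    and "\<And>a b c t. ((\<lambda>t. H (a - t / 2) (b - t / 2) c) has_real_derivative - h (a - t / 2) (b - t / 2) c) (at t)"
  shows "represents (ray_integral (1/2, 1/2, 0) V) H"
proof (rule represents_ray_integral[OF assms(1), where \<tau> = "\<lambda>a b c. min (2 * a) (2 * b)"])
  fix a b c
  show "continuous_on UNIV (\<lambda>t. H (a - t * (1/2)) (b - t * (1/2)) (c - t * 0))"
    using assms(4) by (auto intro!: DERIV_continuous_on)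
  show "\<exists>S. finite S \<and> (\<forall>t. t \<notin> S \<longrightarrow>
        ((\<lambda>t. H (a - t * (1/2)) (b - t * (1/2)) (c - t * 0)) has_real_derivative
           - h (a - t * (1/2)) (b - t * (1/2)) (c - t * 0)) (at t))"
    using assms(4) by (intro exI[of _ "{}"]) simp
qed (use assms(2,3) in \<open>auto simp: min_def field_simps\<close>)

lemma represents_ray_v5:
  assumes "represents V h"
    and "\<And>a c. 0 \<le> a \<Longrightarrow> 0 \<le> c \<Longrightarrow> H a 0 c = 0" "\<And>a b. 0 \<le> a \<Longrightarrow> 0 \<le> b \<Longrightarrow> H a b 0 = 0"
    and "\<And>a b c t. ((\<lambda>t. H a (b - t / 2) (c - t / 2)) has_real_derivative - h a (b - t / 2) (c - t / 2)) (at t)"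
  shows "represents (ray_integral (0, 1/2, 1/2) V) H"
proof (rule represents_ray_integral[OF assms(1), where \<tau> = "\<lambda>a b c. min (2 * b) (2 * c)"])
  fix a b c
  show "continuous_on UNIV (\<lambda>t. H (a - t * 0) (b - t * (1/2)) (c - t * (1/2)))"
    using assms(4) by (auto intro!: DERIV_continuous_on)
  show "\<exists>S. finite S \<and> (\<forall>t. t \<notin> S \<longrightarrow>
        ((\<lambda>t. H (a - t * 0) (b - t * (1/2)) (c - t * (1/2))) has_real_derivative
           - h (a - t * 0) (b - t * (1/2)) (c - t * (1/2))) (at t))"
    using assms(4) by (intro exI[of _ "{}"]) simp
qed (use assms(2,3) in \<open>auto simp: min_def field_simps\<close>)

lemma represents_ray_v6:
  assumes "represents V h"
    and "\<And>b c. 0 \<le> b \<Longrightarrow> 0 \<le> c \<Longrightarrow> H 0 b c = 0" "\<And>a b. 0 \<le> a \<Longrightarrow> 0 \<le> b \<Longrightarrow> H a b 0 = 0"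
    and "\<And>a b c t. ((\<lambda>t. H (a - t / 2) b (c - t / 2)) has_real_derivative - h (a - t / 2) b (c - t / 2)) (at t)"
  shows "represents (ray_integral (1/2, 0, 1/2) V) H"
proof (rule represents_ray_integral[OF assms(1), where \<tau> = "\<lambda>a b c. min (2 * a) (2 * c)"])
  fix a b c
  show "continuous_on UNIV (\<lambda>t. H (a - t * (1/2)) (b - t * 0) (c - t * (1/2)))"
    using assms(4) by (auto intro!: DERIV_continuous_on)
  show "\<exists>S. finite S \<and> (\<forall>t. t \<notin> S \<longrightarrow>
        ((\<lambda>t. H (a - t * (1/2)) (b - t * 0) (c - t * (1/2))) has_real_derivative
           - h (a - t * (1/2)) (b - t * 0) (c - t * (1/2))) (at t))"
    using assms(4) by (intro exI[of _ "{}"]) simp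
qed (use assms(2,3) in \<open>auto simp: min_def field_simps\<close>)

lemma represents_cong:
  "represents V h \<Longrightarrow> (\<And>a b c. h' a b c = h a b c) \<Longrightarrow> represents V h'"
proof -
  assume "represents V h" "\<And>a b c. h' a b c = h a b c"
  moreover from this(2) have "h' = h" by (intro ext)
  ultimately show "represents V h'" by simp
qed

text \<open>
  The indicator of the cone of the pivots, when this cone is cut out of the octant by a single
  half-space.
\<close>

lemma represents_start:
  assumes "\<And>a b c. 0 \<le> a \<Longrightarrow> 0 \<le> b \<Longrightarrow> 0 \<le> c \<Longrightarrow> L (a, b, c) \<in> octant \<longleftrightarrow> 0 \<le> l a b c"
    and "\<And>a b c. L (a, b, c) \<in> octant \<Longrightarrow> 0 \<le> a \<and> 0 \<le> b \<and> 0 \<le> c"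
  shows "represents (indicator octant \<circ> L) (\<lambda>a b c. if 0 \<le> l a b c then 1 else 0)"
  unfolding represents_def
proof (intro conjI ext)
  fix x show "(indicator octant \<circ> L) x = (case x of (a, b, c) \<Rightarrow>
      if 0 \<le> a \<and> 0 \<le> b \<and> 0 \<le> c then ennreal (if 0 \<le> l a b c then 1 else 0) else 0)"
  proof (cases x)
    case (fields a b c)
    then show ?thesis
      using assms(1)[of a b c] assms(2)[of a b c] by (cases "L (a, b, c) \<in> octant") auto
  qed
qed simp

lemma DERIV_pos_pow_line:
  assumes "n \<ge> 1"
  shows "\<exists>S. finite S \<and> (\<forall>t. t \<notin> S \<longrightarrow>
     ((\<lambda>t. pos_pow n (x - t) / fact n) has_real_derivative
        - (if n = 1 then if 0 \<le> x - t then 1 else 0 else pos_pow (n - 1) (x - t) / fact (n - 1))) (at t))"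
proof (intro exI[of _ "{x}"] conjI allI impI)
  fix t assume "t \<notin> {x}"
  then have "x - t \<noteq> 0" by simp
  then have "(pos_pow n has_real_derivative real n * (if x - t < 0 then 0 else pos_pow (n - 1) (x - t))) (at (x - t))"
    by (intro DERIV_pos_pow) simp
  moreover have "((\<lambda>t. x - t) has_real_derivative -1) (at t)"
    by (rule derivative_eq_intros refl | simp)+
  ultimately have "((\<lambda>t. pos_pow n (x - t)) has_real_derivative
      real n * (if x - t < 0 then 0 else pos_pow (n - 1) (x - t)) * -1) (at t)"
    using DERIV_chain by (fastforce simp: o_def)
  from DERIV_cdivide[OF this, of "fact n"]
  show "((\<lambda>t. pos_pow n (x - t) / fact n) has_real_derivative
        - (if n = 1 then if 0 \<le> x - t then 1 else 0 else pos_pow (n - 1) (x - t) / fact (n - 1))) (at t)"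
  proof (rule DERIV_cong)
    have "real n / fact n = 1 / fact (n - 1)"
      using assms by (cases n) (simp_all del: of_nat_Suc)
    then show "real n * (if x - t < 0 then 0 else pos_pow (n - 1) (x - t)) * - 1 / fact n =
       - (if n = 1 then if 0 \<le> x - t then 1 else 0 else pos_pow (n - 1) (x - t) / fact (n - 1))"
      using assms by (auto simp: pos_pow_def max_absorb1 zero_power field_simps)
  qed
qed simp

lemma represents_powers_v1:
  assumes V: "represents V (\<lambda>a b c. if 0 \<le> l a b c then 1 else 0)"
    and l: "\<And>a b c t. l (a - t) b c = l a b c - t" "\<And>b c. 0 \<le> b \<Longrightarrow> 0 \<le> c \<Longrightarrow> l 0 b c \<le> 0"
  shows "represents ((ray_integral (1, 0, 0) ^^ Suc n) V) (\<lambda>a b c. pos_pow (Suc n) (l a b c) / fact (Suc n))"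
proof (induction n)
  case 0
  show ?case
  proof (simp only: funpow.simps o_id, rule represents_ray_v1[OF V])
    show "continuous_on UNIV (\<lambda>t. pos_pow (Suc 0) (l (a - t) b c) / fact (Suc 0))" for a b c
      unfolding l(1) by (intro continuous_intros) simp
  qed (use l(2) DERIV_pos_pow_line[of 1] in \<open>auto simp: pos_pow_nonpos_arg l(1)\<close>)
next
  case (Suc n)
  show ?case
    unfolding funpow.simps(2)[of "Suc n"] o_apply
  proof (rule represents_ray_v1[OF Suc])
    show "continuous_on UNIV (\<lambda>t. pos_pow (Suc (Suc n)) (l (a - t) b c) / fact (Suc (Suc n)))" for a b c
      unfolding l(1) by (intro continuous_intros) simp
  qed (use l(2) DERIV_pos_pow_line[of "Suc (Suc n)"] in \<open>auto simp: pos_pow_nonpos_arg l(1) simp del: fact_Suc\<close>)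
qed

lemma represents_powers_v2:
  assumes V: "represents V (\<lambda>a b c. if 0 \<le> l a b c then 1 else 0)"
    and l: "\<And>a b c t. l a (b - t) c = l a b c - t" "\<And>a c. 0 \<le> a \<Longrightarrow> 0 \<le> c \<Longrightarrow> l a 0 c \<le> 0"
  shows "represents ((ray_integral (0, 1, 0) ^^ Suc n) V) (\<lambda>a b c. pos_pow (Suc n) (l a b c) / fact (Suc n))"
proof (induction n)
  case 0
  show ?case
  proof (simp only: funpow.simps o_id, rule represents_ray_v2[OF V])
    show "continuous_on UNIV (\<lambda>t. pos_pow (Suc 0) (l a (b - t) c) / fact (Suc 0))" for a b c
      unfolding l(1) by (intro continuous_intros) simp
  qed (use l(2) DERIV_pos_pow_line[of 1] in \<open>auto simp: pos_pow_nonpos_arg l(1)\<close>)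
next
  case (Suc n)
  show ?case
    unfolding funpow.simps(2)[of "Suc n"] o_apply
  proof (rule represents_ray_v2[OF Suc])
    show "continuous_on UNIV (\<lambda>t. pos_pow (Suc (Suc n)) (l a (b - t) c) / fact (Suc (Suc n)))" for a b c
      unfolding l(1) by (intro continuous_intros) simp
  qed (use l(2) DERIV_pos_pow_line[of "Suc (Suc n)"] in \<open>auto simp: pos_pow_nonpos_arg l(1) simp del: fact_Suc\<close>)
qed

text \<open>
  Along the direction of \<open>v4\<close> both \<open>l\<close> and \<open>k\<close> decrease at rate \<open>1/2\<close>, so \<open>l - k\<close> is
  constant; the subtracted terms make the antiderivative vanish where \<open>k = 0\<close>.
\<close>

lemma represents_v4_v4:
  assumes V: "represents V (\<lambda>a b c. pos_pow n (l a b c) / fact n)" and n: "n \<ge> 1"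
    and l: "\<And>a b c t. l (a - t / 2) (b - t / 2) c = l a b c - t / 2"
    and k: "\<And>a b c t. k (a - t / 2) (b - t / 2) c = k a b c - t / 2"
    and exit: "\<And>b c. 0 \<le> b \<Longrightarrow> 0 \<le> c \<Longrightarrow> k 0 b c = 0 \<or> l 0 b c \<le> 0 \<and> l 0 b c \<le> k 0 b c"
              "\<And>a c. 0 \<le> a \<Longrightarrow> 0 \<le> c \<Longrightarrow> k a 0 c = 0 \<or> l a 0 c \<le> 0 \<and> l a 0 c \<le> k a 0 c"
  shows "represents (ray_integral (1/2, 1/2, 0) V) (\<lambda>a b c. 2 * (pos_pow (n + 1) (l a b c)
            - pos_pow (n + 1) (l a b c - k a b c)) / fact (n + 1))" (is "represents ?V1 ?H1")
    and "represents (ray_integral (1/2, 1/2, 0) (ray_integral (1/2, 1/2, 0) V))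
           (\<lambda>a b c. 4 * ((pos_pow (n + 2) (l a b c) - pos_pow (n + 2) (l a b c - k a b c)) / (n + 2)
                 - k a b c * pos_pow (n + 1) (l a b c - k a b c)) / fact (n + 1))"
proof -
  have fact: "real (n + 1) / fact (n + 1) = 1 / fact n" by (simp del: of_nat_Suc)
  show H1: "represents ?V1 ?H1"
  proof (rule represents_ray_v4[OF V])
    fix a b c t
    have "((\<lambda>t. 2 * (pos_pow (n + 1) (l a b c - t / 2) - pos_pow (n + 1) (l a b c - k a b c)) / fact (n + 1))
       has_real_derivative 2 * (real (n + 1) * pos_pow n (l a b c - t / 2) * (- 1 / 2)) / fact (n + 1)) (at t)"
      using n by (auto intro!: derivative_eq_intros simp del: fact_Suc)
    moreover have "2 * (N * p * (- 1 / 2)) / F = - (p * (N / F))" for N p F :: real by simp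
    then have "2 * (real (n + 1) * pos_pow n (l a b c - t / 2) * (- 1 / 2)) / fact (n + 1)
        = - (pos_pow n (l a b c - t / 2) / fact n)"
      unfolding fact by simp
    ultimately show "((\<lambda>t. 2 * (pos_pow (n + 1) (l (a - t / 2) (b - t / 2) c)
            - pos_pow (n + 1) (l (a - t / 2) (b - t / 2) c - k (a - t / 2) (b - t / 2) c)) / fact (n + 1))
        has_real_derivative - (pos_pow n (l (a - t / 2) (b - t / 2) c) / fact n)) (at t)"
      by (simp add: l k)
  qed (use exit in \<open>fastforce simp: pos_pow_nonpos_arg\<close>)+
  show "represents (ray_integral (1/2, 1/2, 0) (ray_integral (1/2, 1/2, 0) V))
           (\<lambda>a b c. 4 * ((pos_pow (n + 2) (l a b c) - pos_pow (n + 2) (l a b c - k a b c)) / (n + 2)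
                 - k a b c * pos_pow (n + 1) (l a b c - k a b c)) / fact (n + 1))"
  proof (rule represents_ray_v4[OF H1])
    fix a b c t
    have P: "((\<lambda>t. pos_pow (n + 2) (l a b c - t / 2)) has_real_derivative
        real (n + 2) * pos_pow (n + 1) (l a b c - t / 2) * (- 1 / 2)) (at t)"
      by (auto intro!: derivative_eq_intros)
    have combine: "((\<lambda>t. 4 * ((f t - E) / N - (k0 - t / 2) * F) / G) has_real_derivative
        4 * (D / N + 1 / 2 * F) / G) (at t)"
      if "(f has_real_derivative D) (at t)" for f D E N k0 F G
      using that unfolding divide_inverse by (auto intro!: derivative_eq_intros)
    note D = combine[OF P]
    have slope: "4 * ((N * p * (- 1 / 2)) / N + 1 / 2 * q) / F = - (2 * (p - q) / F)"
      if "N \<noteq> 0" for N F p q :: real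
      using that by (simp add: algebra_simps diff_divide_distrib)
    have diff: "x - s - (y - s) = x - y" for x y s :: real by simp
    show "((\<lambda>t. 4 * ((pos_pow (n + 2) (l (a - t / 2) (b - t / 2) c)
            - pos_pow (n + 2) (l (a - t / 2) (b - t / 2) c - k (a - t / 2) (b - t / 2) c)) / (n + 2)
                 - k (a - t / 2) (b - t / 2) c * pos_pow (n + 1) (l (a - t / 2) (b - t / 2) c - k (a - t / 2) (b - t / 2) c)) / fact (n + 1))
        has_real_derivative - (2 * (pos_pow (n + 1) (l (a - t / 2) (b - t / 2) c)
            - pos_pow (n + 1) (l (a - t / 2) (b - t / 2) c - k (a - t / 2) (b - t / 2) c)) / fact (n + 1))) (at t)"
      unfolding l k diff by (rule DERIV_cong[OF D]) (rule slope, simp)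
  qed (use exit in \<open>fastforce simp: pos_pow_nonpos_arg\<close>)+
qed

section \<open>Closed forms of the ray integrals\<close>

abbreviation "V1 \<equiv> (1, 0, 0) :: real \<times> real \<times> real"
abbreviation "V2 \<equiv> (0, 1, 0) :: real \<times> real \<times> real"
abbreviation "V3 \<equiv> (0, 0, 1) :: real \<times> real \<times> real"
abbreviation "V4 \<equiv> (1/2, 1/2, 0) :: real \<times> real \<times> real"
abbreviation "V5 \<equiv> (0, 1/2, 1/2) :: real \<times> real \<times> real"
abbreviation "V6 \<equiv> (1/2, 0, 1/2) :: real \<times> real \<times> real"

text \<open>
  Coordinates with respect to the pivots \<open>v1, v4, v6\<close> and \<open>v1, v2, v6\<close> in terms of those with
  respect to \<open>v1, v2, v3\<close>.
\<close>

definition pivots146 :: "real \<times> real \<times> real \<Rightarrow> real \<times> real \<times> real" where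
  "pivots146 = (\<lambda>(a, b, c). (a - b - c, 2 * b, 2 * c))"
definition pivots126 :: "real \<times> real \<times> real \<Rightarrow> real \<times> real \<times> real" where
  "pivots126 = (\<lambda>(a, b, c). (a - c, b, 2 * c))"

lemma mult_pos_pow: "0 < n \<Longrightarrow> x * pos_pow n x = pos_pow (Suc n) x"
  by (cases "x \<le> 0") (simp_all add: pos_pow_nonpos_arg pos_pow_nonneg_arg)

lemma start_146: "represents (indicator octant \<circ> pivots146) (\<lambda>a b c. if 0 \<le> a - b - c then 1 else 0)"
  by (rule represents_start) (auto simp: pivots146_def octant_def)

lemma start_126: "represents (indicator octant \<circ> pivots126) (\<lambda>a b c. if 0 \<le> a - c then 1 else 0)"
  by (rule represents_start) (auto simp: pivots126_def octant_def)

lemma start_123: "represents (indicator octant \<circ> id) (\<lambda>a b c. if 0 \<le> b then 1 else 0)"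
  by (rule represents_start) (auto simp: octant_def)

lemmas powers_146 = represents_powers_v1[OF start_146]
lemmas powers_126 = represents_powers_v1[OF start_126]
lemmas powers_123 = represents_powers_v2[OF start_123]

text \<open>
  In each list the knots are the five which are not pivots; the rightmost is integrated first.
\<close>

lemma rays_600101:
  "represents (foldr ray_integral [V1, V1, V1, V1, V1] (indicator octant \<circ> pivots146))
     (\<lambda>a b c. pos_pow 5 (a - b - c) / 120)"
  using powers_146[of 4] by (simp add: numeral_eq_Suc)

lemma rays_500201:
  "represents (foldr ray_integral [V4, V1, V1, V1, V1] (indicator octant \<circ> pivots146))
     (\<lambda>a b c. b * pos_pow 4 (a - b - c) / 12)"
proof -
  have "represents (foldr ray_integral [V1, V1, V1, V1] (indicator octant \<circ> pivots146))
     (\<lambda>a b c. pos_pow 4 (a - b - c) / 24)"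
    using powers_146[of 3] by (simp add: numeral_eq_Suc)
  then have "represents (ray_integral V4 (foldr ray_integral [V1, V1, V1, V1] (indicator octant \<circ> pivots146)))
     (\<lambda>a b c. b * pos_pow 4 (a - b - c) / 12)"
  proof (rule represents_ray_v4)
    fix a b c t :: real
    show "((\<lambda>t. (b - t / 2) * pos_pow 4 (a - t / 2 - (b - t / 2) - c) / 12) has_real_derivative
       - (pos_pow 4 (a - t / 2 - (b - t / 2) - c) / 24)) (at t)"
      by (rule derivative_eq_intros refl | simp)+
  qed (auto simp: pos_pow_nonpos_arg)
  then show ?thesis by simp
qed

lemma rays_126_power3: "represents (foldr ray_integral [V1, V1, V1] (indicator octant \<circ> pivots126)) (\<lambda>a b c. pos_pow 3 (a - c) / fact 3)"
  using powers_126[of 2] by (simp add: numeral_eq_Suc)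
lemma rays_126_power2: "represents (foldr ray_integral [V1, V1] (indicator octant \<circ> pivots126)) (\<lambda>a b c. pos_pow 2 (a - c) / fact 2)"
  using powers_126[of 1] by (simp add: numeral_eq_Suc)
lemma rays_126_power1: "represents (foldr ray_integral [V1] (indicator octant \<circ> pivots126)) (\<lambda>a b c. pos_pow 1 (a - c) / fact 1)"
  using powers_126[of 0] by (simp add: numeral_eq_Suc)
lemma rays_123_power3: "represents (foldr ray_integral [V2, V2, V2] (indicator octant \<circ> id)) (\<lambda>a b c. pos_pow 3 b / fact 3)"
  using powers_123[of 2] by (simp add: numeral_eq_Suc)
lemma rays_123_power2: "represents (foldr ray_integral [V2, V2] (indicator octant \<circ> id)) (\<lambda>a b c. pos_pow 2 b / fact 2)"
  using powers_123[of 1] by (simp add: numeral_eq_Suc)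
lemma rays_123_power1: "represents (foldr ray_integral [V2] (indicator octant \<circ> id)) (\<lambda>a b c. pos_pow 1 b / fact 1)"
  using powers_123[of 0] by (simp add: numeral_eq_Suc)

lemmas v4_v4_126 = represents_v4_v4[where l = "\<lambda>a b c. a - c" and k = "\<lambda>a b c. b"]
lemmas v4_v4_123 = represents_v4_v4[where l = "\<lambda>a b c. b" and k = "\<lambda>a b c. a"]

lemma rays_410201:
  "represents (foldr ray_integral [V4, V4, V1, V1, V1] (indicator octant \<circ> pivots126))
     (\<lambda>a b c. (pos_pow 5 (a - c) - pos_pow 5 (a - c - b)) / 30 - b * pos_pow 4 (a - c - b) / 6)"
  unfolding foldr.simps o_apply id_apply
    by (rule represents_cong[OF v4_v4_126(2)[OF rays_126_power3[unfolded foldr.simps o_apply id_apply]]])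
      (simp_all add: fact_numeral field_simps eval_nat_numeral)

lemma rays_320201:
  "represents (foldr ray_integral [V2, V4, V4, V1, V1] (indicator octant \<circ> pivots126))
     (\<lambda>a b c. b * (pos_pow 4 (a - c) + pos_pow 4 (a - c - b)) / 6
          - (pos_pow 5 (a - c) - pos_pow 5 (a - c - b)) / 15)"
proof -
  have "represents (foldr ray_integral [V4, V4, V1, V1] (indicator octant \<circ> pivots126))
     (\<lambda>a b c. (pos_pow 4 (a - c) - pos_pow 4 (a - c - b)) / 6 - b * pos_pow 3 (a - c - b) * (2 / 3))"
    unfolding foldr.simps o_apply id_apply
    by (rule represents_cong[OF v4_v4_126(2)[OF rays_126_power2[unfolded foldr.simps o_apply id_apply]]])
      (simp_all add: fact_numeral field_simps eval_nat_numeral)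
  then have "represents (ray_integral V2 (foldr ray_integral [V4, V4, V1, V1] (indicator octant \<circ> pivots126)))
     (\<lambda>a b c. b * (pos_pow 4 (a - c) + pos_pow 4 (a - c - b)) / 6
          - (pos_pow 5 (a - c) - pos_pow 5 (a - c - b)) / 15)"
  proof (rule represents_ray_v2_smooth)
    fix a b c t :: real
    show "((\<lambda>t. (b - t) * (pos_pow 4 (a - c) + pos_pow 4 (a - c - (b - t))) / 6
          - (pos_pow 5 (a - c) - pos_pow 5 (a - c - (b - t))) / 15) has_real_derivative
       - ((pos_pow 4 (a - c) - pos_pow 4 (a - c - (b - t))) / 6 - (b - t) * pos_pow 3 (a - c - (b - t)) * (2 / 3))) (at t)"
      by (rule derivative_eq_intros refl | simp)+ (simp add: field_simps)
  qed simp
  then show ?thesis by simp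
qed

text \<open>
  The antiderivative in the direction of \<open>v5\<close> that can be read off term by term is determined
  only up to functions of the quantities \<open>a\<close>, \<open>b - c\<close> which are constant in this direction.
  The terms with \<open>b - c\<close>, \<open>b - a - c\<close> and \<open>a + b - c\<close> are the correction of this kind that
  makes it vanish on both exit faces \<open>b = 0\<close> and \<open>c = 0\<close>.  The result is symmetric in \<open>a\<close>, \<open>b\<close>,
  like the knots.
\<close>

lemma rays_220211:
  "represents (foldr ray_integral [V5, V2, V4, V4, V1] (indicator octant \<circ> pivots126))
     (\<lambda>a b c. (pos_pow 5 (a - c) - 5 * b * pos_pow 4 (a - c)) / 15
          + (pos_pow 5 (b - c) - 5 * a * pos_pow 4 (b - c)) / 15
          - (a + b - c) * (pos_pow 4 (a - c - b) + pos_pow 4 (b - a - c)) / 12 + pos_pow 5 (a + b - c) / 60)"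
  (is "represents _ ?H")
proof -
  have "represents (foldr ray_integral [V4, V4, V1] (indicator octant \<circ> pivots126))
     (\<lambda>a b c. (pos_pow 3 (a - c) - pos_pow 3 (a - c - b)) * (2 / 3) - b * pos_pow 2 (a - c - b) * 2)"
    unfolding foldr.simps o_apply id_apply
    by (rule represents_cong[OF v4_v4_126(2)[OF rays_126_power1[unfolded foldr.simps o_apply id_apply]]])
      (simp_all add: fact_numeral field_simps eval_nat_numeral)
  then have "represents (ray_integral V2 (foldr ray_integral [V4, V4, V1] (indicator octant \<circ> pivots126)))
     (\<lambda>a b c. b * (pos_pow 3 (a - c) + pos_pow 3 (a - c - b)) * (2 / 3)
          - (pos_pow 4 (a - c) - pos_pow 4 (a - c - b)) / 3)"
  proof (rule represents_ray_v2_smooth)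
    fix a b c t :: real
    show "((\<lambda>t. (b - t) * (pos_pow 3 (a - c) + pos_pow 3 (a - c - (b - t))) * (2 / 3)
          - (pos_pow 4 (a - c) - pos_pow 4 (a - c - (b - t))) / 3) has_real_derivative
       - ((pos_pow 3 (a - c) - pos_pow 3 (a - c - (b - t))) * (2 / 3) - (b - t) * pos_pow 2 (a - c - (b - t)) * 2)) (at t)"
      by (rule derivative_eq_intros refl | simp)+ (simp add: field_simps)
  qed simp
  then have "represents (foldr ray_integral [V2, V4, V4, V1] (indicator octant \<circ> pivots126))
     (\<lambda>a b c. b * (pos_pow 3 (a - c) + pos_pow 3 (a - c - b)) * (2 / 3)
          - (pos_pow 4 (a - c) - pos_pow 4 (a - c - b)) / 3)" by simp
  then have "represents (ray_integral V5 (foldr ray_integral [V2, V4, V4, V1] (indicator octant \<circ> pivots126))) ?H"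
  proof (rule represents_ray_v5)
    fix a b c t :: real
    show "((\<lambda>t. ?H a (b - t / 2) (c - t / 2)) has_real_derivative
       - ((b - t / 2) * (pos_pow 3 (a - (c - t / 2)) + pos_pow 3 (a - (c - t / 2) - (b - t / 2))) * (2 / 3)
          - (pos_pow 4 (a - (c - t / 2)) - pos_pow 4 (a - (c - t / 2) - (b - t / 2))) / 3)) (at t)"
      by (rule derivative_eq_intros refl | simp)+
         (use mult_pos_pow[of 3 "a + t - (b + c)"] in \<open>simp add: field_simps\<close>)
  next
    fix a c :: real assume "0 \<le> a" "0 \<le> c"
    then show "?H a 0 c = 0"
      by (cases "a \<le> c") (simp_all add: pos_pow_nonneg_arg pos_pow_nonpos_arg, simp add: eval_nat_numeral field_simps)
  next
    fix a b :: real assume "0 \<le> a" "0 \<le> b"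
    then show "?H a b 0 = 0"
      by (cases "a \<le> b") (simp_all add: pos_pow_nonneg_arg pos_pow_nonpos_arg, simp_all add: eval_nat_numeral field_simps)
  qed
  then show ?thesis by simp
qed

lemma rays_141110:
  "represents (foldr ray_integral [V5, V4, V2, V2, V2] (indicator octant \<circ> id))
     (\<lambda>a b c. (pos_pow 5 b - pos_pow 5 (b - c) - pos_pow 5 (b - a) + pos_pow 5 (b - a - c)) / 30)"
  (is "represents _ ?H")
proof -
  have "represents (foldr ray_integral [V4, V2, V2, V2] (indicator octant \<circ> id))
     (\<lambda>a b c. (pos_pow 4 b - pos_pow 4 (b - a)) / 12)"
    unfolding foldr.simps o_apply id_apply
    by (rule represents_cong[OF v4_v4_123(1)[OF rays_123_power3[unfolded foldr.simps o_apply id_apply]]])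
      (simp_all add: fact_numeral field_simps eval_nat_numeral)
  then have "represents (ray_integral V5 (foldr ray_integral [V4, V2, V2, V2] (indicator octant \<circ> id))) ?H"
  proof (rule represents_ray_v5)
    fix a b c t :: real
    show "((\<lambda>t. ?H a (b - t / 2) (c - t / 2)) has_real_derivative
       - ((pos_pow 4 (b - t / 2) - pos_pow 4 ((b - t / 2) - a)) / 12)) (at t)"
      by (rule derivative_eq_intros refl | simp)+ (simp add: field_simps)
  qed (auto simp: pos_pow_nonneg_arg pos_pow_nonpos_arg)
  then show ?thesis by simp
qed

lemma rays_131210:
  "represents (foldr ray_integral [V5, V4, V4, V2, V2] (indicator octant \<circ> id))
     (\<lambda>a b c. (pos_pow 5 b - pos_pow 5 (b - c) - pos_pow 5 (b - a) + pos_pow 5 (b - a - c)) / 15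
        - a * (pos_pow 4 (b - a) - pos_pow 4 (b - a - c)) / 3)"
  (is "represents _ ?H")
proof -
  have "represents (foldr ray_integral [V4, V4, V2, V2] (indicator octant \<circ> id))
     (\<lambda>a b c. (pos_pow 4 b - pos_pow 4 (b - a)) / 6 - a * pos_pow 3 (b - a) * (2 / 3))"
    unfolding foldr.simps o_apply id_apply
    by (rule represents_cong[OF v4_v4_123(2)[OF rays_123_power2[unfolded foldr.simps o_apply id_apply]]])
      (simp_all add: fact_numeral field_simps eval_nat_numeral)
  then have "represents (ray_integral V5 (foldr ray_integral [V4, V4, V2, V2] (indicator octant \<circ> id))) ?H"
  proof (rule represents_ray_v5)
    fix a b c t :: real
    show "((\<lambda>t. ?H a (b - t / 2) (c - t / 2)) has_real_derivative
       - ((pos_pow 4 (b - t / 2) - pos_pow 4 ((b - t / 2) - a)) / 6 - a * pos_pow 3 ((b - t / 2) - a) * (2 / 3))) (at t)"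
      by (rule derivative_eq_intros refl | simp)+ (simp add: field_simps)
  qed (auto simp: pos_pow_nonneg_arg pos_pow_nonpos_arg)
  then show ?thesis by simp
qed

text \<open>
  For the last direction \<open>v6\<close> the quantities \<open>b\<close> and \<open>a - c\<close> are constant; the terms in
  \<open>pos_pow 5 b\<close>, \<open>a + b - c\<close>, \<open>a - c\<close> and \<open>a - b - c\<close> form the correction which makes the
  antiderivative vanish on \<open>a = 0\<close> and \<open>c = 0\<close>.
\<close>

lemma rays_121211:
  "represents (foldr ray_integral [V6, V5, V4, V4, V2] (indicator octant \<circ> id))
     (\<lambda>a b c. 2 / 3 * a * pos_pow 4 b - 4 / 15 * pos_pow 5 b + 2 / 15 * pos_pow 5 (b - c)
        + 4 / 15 * pos_pow 5 (b - a) + 2 / 3 * a * pos_pow 4 (b - a)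
        - pos_pow 5 (b - a - c) / 10 - a * pos_pow 4 (b - a - c) / 3
        - pos_pow 5 (a + b - c) / 30 + 2 / 3 * b * pos_pow 4 (a - c) - 2 / 15 * pos_pow 5 (a - c)
        + (a + b - c) * pos_pow 4 (a - b - c) / 6)"
  (is "represents _ ?H")
proof -
  have "represents (foldr ray_integral [V4, V4, V2] (indicator octant \<circ> id))
     (\<lambda>a b c. (pos_pow 3 b - pos_pow 3 (b - a)) * (2 / 3) - a * pos_pow 2 (b - a) * 2)" (is "represents ?W ?h")
    unfolding foldr.simps o_apply id_apply
    by (rule represents_cong[OF v4_v4_123(2)[OF rays_123_power1[unfolded foldr.simps o_apply id_apply]]])
      (simp_all add: fact_numeral field_simps eval_nat_numeral)
  then have "represents (ray_integral V5 ?W)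
     (\<lambda>a b c. (pos_pow 4 b - pos_pow 4 (b - c) - pos_pow 4 (b - a) + pos_pow 4 (b - a - c)) / 3
        - a * (pos_pow 3 (b - a) - pos_pow 3 (b - a - c)) * (4 / 3))" (is "represents ?W' ?h'")
  proof (rule represents_ray_v5)
    fix a b c t :: real
    show "((\<lambda>t. ?h' a (b - t / 2) (c - t / 2)) has_real_derivative - ?h a (b - t / 2) (c - t / 2)) (at t)"
      by (rule derivative_eq_intros refl | simp)+ (simp add: field_simps)
  qed (auto simp: pos_pow_nonneg_arg pos_pow_nonpos_arg)
  then have "represents (ray_integral V6 ?W') ?H"
  proof (rule represents_ray_v6)
    fix a b c t :: real
    show "((\<lambda>t. ?H (a - t / 2) b (c - t / 2)) has_real_derivative - ?h' (a - t / 2) b (c - t / 2)) (at t)"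
      by (rule derivative_eq_intros refl | simp)+ (simp add: field_simps)
  next
    fix b c :: real assume "0 \<le> b" "0 \<le> c"
    then show "?H 0 b c = 0"
      by (cases "b \<le> c") (simp_all add: pos_pow_nonneg_arg pos_pow_nonpos_arg)
  next
    fix a b :: real assume "0 \<le> a" "0 \<le> b"
    then show "?H a b 0 = 0"
      by (cases "a \<le> b") (simp_all add: pos_pow_nonneg_arg pos_pow_nonpos_arg, simp_all add: eval_nat_numeral field_simps)
  qed
  then show ?thesis by simp
qed

section \<open>Closed forms of the basis functions\<close>

text \<open>
  The eight generators, each with its weight in the basis, as functions of barycentric
  coordinates.  Normalised in this way, the 39 functions of the basis add up to 1.
\<close>

definition q600101 :: "real \<Rightarrow> real \<Rightarrow> real \<Rightarrow> real" where
  "q600101 a b c = pos_pow 5 (a - b - c)"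
definition q500201 :: "real \<Rightarrow> real \<Rightarrow> real \<Rightarrow> real" where
  "q500201 a b c = 10 * b * pos_pow 4 (a - b - c)"
definition q410201 :: "real \<Rightarrow> real \<Rightarrow> real \<Rightarrow> real" where
  "q410201 a b c = 4 * pos_pow 5 (a - c) - 4 * pos_pow 5 (a - b - c) - 20 * b * pos_pow 4 (a - b - c)"
definition q320201 :: "real \<Rightarrow> real \<Rightarrow> real \<Rightarrow> real" where
  "q320201 a b c = 20 * b * (pos_pow 4 (a - c) + pos_pow 4 (a - b - c))
     - 8 * (pos_pow 5 (a - c) - pos_pow 5 (a - b - c))"
definition q220211 :: "real \<Rightarrow> real \<Rightarrow> real \<Rightarrow> real" where
  "q220211 a b c = 12 * pos_pow 5 (a - c) - 60 * b * pos_pow 4 (a - c)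
     + 12 * pos_pow 5 (b - c) - 60 * a * pos_pow 4 (b - c)
     - 15 * (a + b - c) * (pos_pow 4 (a - b - c) + pos_pow 4 (b - a - c)) + 3 * pos_pow 5 (a + b - c)"
definition q141110 :: "real \<Rightarrow> real \<Rightarrow> real \<Rightarrow> real" where
  "q141110 a b c = 4 * (pos_pow 5 b - pos_pow 5 (b - c) - pos_pow 5 (b - a) + pos_pow 5 (b - a - c))"
definition q131210 :: "real \<Rightarrow> real \<Rightarrow> real \<Rightarrow> real" where
  "q131210 a b c = 4 * (pos_pow 5 b - pos_pow 5 (b - c) - pos_pow 5 (b - a) + pos_pow 5 (b - a - c))
     - 20 * a * (pos_pow 4 (b - a) - pos_pow 4 (b - a - c))"
definition q121211 :: "real \<Rightarrow> real \<Rightarrow> real \<Rightarrow> real" where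
  "q121211 a b c = 60 * a * pos_pow 4 b - 24 * pos_pow 5 b + 12 * pos_pow 5 (b - c)
     + 24 * pos_pow 5 (b - a) + 60 * a * pos_pow 4 (b - a)
     - 9 * pos_pow 5 (b - a - c) - 30 * a * pos_pow 4 (b - a - c)
     - 3 * pos_pow 5 (a + b - c) + 60 * b * pos_pow 4 (a - c) - 12 * pos_pow 5 (a - c)
     + 15 * (a + b - c) * pos_pow 4 (a - b - c)"

lemmas q_defs = q600101_def q500201_def q410201_def q320201_def q220211_def q141110_def q131210_def q121211_def

lemma measure_triangle: "measure lborel (triangle p1 p2 p3) = \<bar>cross2 (p2 - p1) (p3 - p1)\<bar> / 2"
  unfolding triangle_def content_triangle cross2_def
  by (simp add: abs_minus_commute algebra_simps)

text \<open>
  Rays are mapped to rays, so the whole chain may be computed in the coordinates with respect to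
  the triangle instead of those with respect to the pivots.
\<close>

lemma foldr_rays_linear:
  assumes "linear L"
  shows "foldr ray_integral (map L as) F (L b) = foldr ray_integral as (F \<circ> L) b"
proof (induction as arbitrary: b)
  case (Cons a as)
  have shift: "L b - t *\<^sub>R L a = L (b - t *\<^sub>R a)" for t
    by (simp add: linear_diff[OF assms] linear_cmul[OF assms])
  show ?case
    unfolding list.map foldr.simps o_apply ray_integral_def[of "L a"] ray_integral_def[of a]
      shift Cons.IH ..
qed simp

lemma simplex_spline_eq_represented:
  fixes L :: "real \<times> real \<times> real \<Rightarrow> real \<times> real \<times> real"
  assumes K: "knots v1 v2 v3 m = mset (map (comb3 v1 v2 v3) ([\<pi>1, \<pi>2, \<pi>3] @ as))" and len: "length as = 5"
    and D: "cross2 (v2 - v1) (v3 - v1) \<noteq> 0"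
    and \<rho>: "\<rho> * cross2 (comb3 v1 v2 v3 \<pi>2 - comb3 v1 v2 v3 \<pi>1) (comb3 v1 v2 v3 \<pi>3 - comb3 v1 v2 v3 \<pi>1)
              = cross2 (v2 - v1) (v3 - v1)" "0 < \<rho>"
    and L: "linear L" "\<And>b. coord_sum (L b) = coord_sum b"
      "\<And>b. comb3 (comb3 v1 v2 v3 \<pi>1) (comb3 v1 v2 v3 \<pi>2) (comb3 v1 v2 v3 \<pi>3) (L b) = comb3 v1 v2 v3 b"
    and tot: "\<forall>q\<in>set as. coord_sum q = 1"
    and H: "represents (foldr ray_integral as (indicator octant \<circ> L)) H"
    and x: "bary v1 v2 v3 x = (a, b, c)" "0 \<le> a" "0 \<le> b" "0 \<le> c"
  shows "simplex_spline v1 v2 v3 m x = 120 * \<rho> * H a b c"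
proof -
  let ?p1 = "comb3 v1 v2 v3 \<pi>1" and ?p2 = "comb3 v1 v2 v3 \<pi>2" and ?p3 = "comb3 v1 v2 v3 \<pi>3"
  have Dp: "cross2 (?p2 - ?p1) (?p3 - ?p1) \<noteq> 0" using D \<rho>(1) by auto
  have pivot: "bary ?p1 ?p2 ?p3 (comb3 v1 v2 v3 b) = L b" if "coord_sum b = 1" for b
    using bary_comb3[OF Dp, of "L b"] that L(2,3) by simp
  have qs: "map (bary ?p1 ?p2 ?p3) (map (comb3 v1 v2 v3) as) = map L as"
    using tot pivot by simp
  have "bary ?p1 ?p2 ?p3 x = L (bary v1 v2 v3 x)"
    using pivot[OF coord_sum_bary, of v1 v2 v3 x] comb3_bary[OF D] by simp
  then have "foldr (\<lambda>q. ray_integral (bary ?p1 ?p2 ?p3 q)) (map (comb3 v1 v2 v3) as) (indicator octant) (bary ?p1 ?p2 ?p3 x)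
     = foldr ray_integral (map (bary ?p1 ?p2 ?p3) (map (comb3 v1 v2 v3) as)) (indicator octant) (L (bary v1 v2 v3 x))"
    by (simp add: foldr_map comp_def)
  also have "\<dots> = foldr ray_integral as (indicator octant \<circ> L) (a, b, c)"
    unfolding qs foldr_rays_linear[OF L(1)] x(1) ..
  also have "\<dots> = ennreal (H a b c)" using H x by (simp add: represents_def)
  finally have rays: "foldr (\<lambda>q. ray_integral (bary ?p1 ?p2 ?p3 q)) (map (comb3 v1 v2 v3) as)
      (indicator octant) (bary ?p1 ?p2 ?p3 x) = ennreal (H a b c)" .
  have "0 \<le> H a b c" using H x by (simp add: represents_def)
  moreover have "measure lborel (triangle v1 v2 v3) = \<rho> * measure lborel (triangle ?p1 ?p2 ?p3)"
    unfolding measure_triangle using \<rho> by (simp flip: \<rho>(1) add: abs_mult)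
  moreover have "measure lborel (triangle ?p1 ?p2 ?p3) \<noteq> 0" using Dp by (simp add: measure_triangle)
  moreover have "simplex_spline v1 v2 v3 m x =
     120 * measure lborel (triangle v1 v2 v3) / measure lborel (triangle ?p1 ?p2 ?p3) * enn2real (ennreal (H a b c))"
    unfolding rays[symmetric] by (rule simplex_spline_eq_rays) (use K len Dp in auto)
  ultimately show ?thesis by simp
qed

lemma linear_pivots146: "linear pivots146" and linear_pivots126: "linear pivots126"
  by (rule linearI; auto simp: pivots146_def pivots126_def algebra_simps split: prod.splits)+

lemma coord_sum_pivots146: "coord_sum (pivots146 b) = coord_sum b" and coord_sum_pivots126: "coord_sum (pivots126 b) = coord_sum b"
  by (auto simp: pivots146_def pivots126_def coord_sum_def split: prod.splits)

lemma comb3_vertices: "comb3 v1 v2 v3 V1 = v1" "comb3 v1 v2 v3 V2 = v2" "comb3 v1 v2 v3 V3 = v3"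
  "comb3 v1 v2 v3 V4 = midpoint v1 v2" "comb3 v1 v2 v3 V5 = midpoint v2 v3" "comb3 v1 v2 v3 V6 = midpoint v1 v3"
  by (simp_all add: comb3_def midpoint_def algebra_simps)

lemma comb3_pivots146: "comb3 v1 (midpoint v1 v2) (midpoint v1 v3) (pivots146 b) = comb3 v1 v2 v3 b"
  and comb3_pivots126: "comb3 v1 v2 (midpoint v1 v3) (pivots126 b) = comb3 v1 v2 v3 b"
  by (auto simp: comb3_def pivots146_def pivots126_def midpoint_def algebra_simps split: prod.splits)

lemma cross2_146: "4 * cross2 (midpoint v1 v2 - v1) (midpoint v1 v3 - v1) = cross2 (v2 - v1) (v3 - v1)"
  and cross2_126: "2 * cross2 (v2 - v1) (midpoint v1 v3 - v1) = cross2 (v2 - v1) (v3 - v1)"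
  by (simp_all add: cross2_def midpoint_def field_simps)

text \<open>
  One formula for all triangles: this is what makes permuting the vertices, and comparing the
  two triangles, possible.
\<close>

definition closed_form :: "real \<times> nat list \<Rightarrow> (real \<Rightarrow> real \<Rightarrow> real \<Rightarrow> real) \<Rightarrow> bool" where
  "closed_form l \<phi> \<longleftrightarrow> (\<forall>v1 v2 v3 x a b c. cross2 (v2 - v1) (v3 - v1) \<noteq> 0 \<longrightarrow>
     bary v1 v2 v3 x = (a, b, c) \<longrightarrow> 0 \<le> a \<longrightarrow> 0 \<le> b \<longrightarrow> 0 \<le> c \<longrightarrow>
     basis_fun v1 v2 v3 l x = \<phi> a b c)"

lemma closed_formI:
  assumes K: "\<And>v1 v2 v3. knots v1 v2 v3 m = mset (map (comb3 v1 v2 v3) ([\<pi>1, \<pi>2, \<pi>3] @ as))"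
    and len: "length as = 5" and tot: "\<forall>q\<in>set as. coord_sum q = 1"
    and L: "linear L" "\<And>b. coord_sum (L b) = coord_sum b"
      "\<And>(v1 :: real^2) v2 v3 b. comb3 (comb3 v1 v2 v3 \<pi>1) (comb3 v1 v2 v3 \<pi>2) (comb3 v1 v2 v3 \<pi>3) (L b) = comb3 v1 v2 v3 b"
    and \<rho>: "\<And>v1 v2 v3. \<rho> * cross2 (comb3 v1 v2 v3 \<pi>2 - comb3 v1 v2 v3 \<pi>1) (comb3 v1 v2 v3 \<pi>3 - comb3 v1 v2 v3 \<pi>1)
              = cross2 (v2 - v1) (v3 - v1)" "0 < \<rho>"
    and H: "represents (foldr ray_integral as (indicator octant \<circ> L)) H"
    and \<phi>: "\<And>a b c. w * (120 * \<rho> * H a b c) = \<phi> a b c"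
  shows "closed_form (w, m) \<phi>"
  unfolding closed_form_def basis_fun_def fst_conv snd_conv
proof (intro allI impI)
  fix v1 v2 v3 x a b c
  assume D: "cross2 (v2 - v1) (v3 - v1) \<noteq> 0" and x: "bary v1 v2 v3 x = (a, b, c)" "0 \<le> a" "0 \<le> b" "0 \<le> c"
  have "simplex_spline v1 v2 v3 m x = 120 * \<rho> * H a b c"
    by (rule simplex_spline_eq_represented[OF K len D \<rho> L tot H x])
  then show "w * simplex_spline v1 v2 v3 m x = \<phi> a b c" using \<phi>[of a b c] by simp
qed

lemma coord_sum_id: "coord_sum (id b) = coord_sum b" and comb3_id: "comb3 p1 p2 p3 (id b) = comb3 p1 p2 p3 b"
  by simp_all

lemmas closed_form_146 = closed_formI[where ?\<pi>1.0 = V1 and ?\<pi>2.0 = V4 and ?\<pi>3.0 = V6 and L = pivots146 and \<rho> = 4,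
    unfolded comb3_vertices, OF _ _ _ linear_pivots146 coord_sum_pivots146 comb3_pivots146 cross2_146 zero_less_numeral]
lemmas closed_form_126 = closed_formI[where ?\<pi>1.0 = V1 and ?\<pi>2.0 = V2 and ?\<pi>3.0 = V6 and L = pivots126 and \<rho> = 2,
    unfolded comb3_vertices, OF _ _ _ linear_pivots126 coord_sum_pivots126 comb3_pivots126 cross2_126 zero_less_numeral]
lemmas closed_form_123 = closed_formI[where ?\<pi>1.0 = V1 and ?\<pi>2.0 = V2 and ?\<pi>3.0 = V3 and L = id and \<rho> = 1,
    unfolded comb3_vertices mult_1, OF _ _ _ linear_id coord_sum_id comb3_id refl zero_less_one]

lemmas knots_simps = knots_def split_points_def comb3_vertices numeral_eq_Suc

lemma closed_form_generators:
  "closed_form (1/4, [6,0,0,1,0,1]) q600101"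
  "closed_form (1/4, [5,0,0,2,0,1]) q500201"
  "closed_form (1/2, [4,1,0,2,0,1]) q410201"
  "closed_form (1/2, [3,2,0,2,0,1]) q320201"
  "closed_form (3/4, [2,2,0,2,1,1]) q220211"
  "closed_form (1, [1,4,1,1,1,0]) q141110"
  "closed_form (1/2, [1,3,1,2,1,0]) q131210"
  "closed_form (3/4, [1,2,1,2,1,1]) q121211"
proof -
  show "closed_form (1/4, [6,0,0,1,0,1]) q600101"
    by (rule closed_form_146[OF _ _ _ rays_600101]) (simp_all add: knots_simps coord_sum_def q_defs)
  show "closed_form (1/4, [5,0,0,2,0,1]) q500201"
    by (rule closed_form_146[OF _ _ _ rays_500201]) (simp_all add: knots_simps coord_sum_def q_defs)
  show "closed_form (1/2, [4,1,0,2,0,1]) q410201"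
    by (rule closed_form_126[OF _ _ _ rays_410201]) (simp_all add: knots_simps coord_sum_def q_defs field_simps)
  show "closed_form (1/2, [3,2,0,2,0,1]) q320201"
    by (rule closed_form_126[OF _ _ _ rays_320201]) (simp_all add: knots_simps coord_sum_def q_defs field_simps)
  show "closed_form (3/4, [2,2,0,2,1,1]) q220211"
    by (rule closed_form_126[OF _ _ _ rays_220211]) (simp_all add: knots_simps coord_sum_def q_defs field_simps)
  show "closed_form (1, [1,4,1,1,1,0]) q141110"
    by (rule closed_form_123[OF _ _ _ rays_141110]) (simp_all add: knots_simps coord_sum_def q_defs field_simps)
  show "closed_form (1/2, [1,3,1,2,1,0]) q131210"
    by (rule closed_form_123[OF _ _ _ rays_131210]) (simp_all add: knots_simps coord_sum_def q_defs field_simps)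
  show "closed_form (3/4, [1,2,1,2,1,1]) q121211"
    by (rule closed_form_123[OF _ _ _ rays_121211]) (simp_all add: knots_simps coord_sum_def q_defs field_simps)
qed

text \<open>
  Permuting the vertices together with the multiplicities changes neither the knots nor the
  triangle.  These two transpositions generate the whole orbit.
\<close>

lemma closed_form_swap12:
  assumes "closed_form (w, [m1, m2, m3, m4, m5, m6]) \<phi>"
  shows "closed_form (w, [m2, m1, m3, m4, m6, m5]) (\<lambda>a b c. \<phi> b a c)"
proof -
  have "knots v1 v2 v3 [m2, m1, m3, m4, m6, m5] = knots v2 v1 v3 [m1, m2, m3, m4, m5, m6]"
    and "triangle v1 v2 v3 = triangle v2 v1 v3" for v1 v2 v3
    by (simp_all add: knots_def split_points_def midpoint_sym triangle_def insert_commute)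
  then have spline: "simplex_spline v1 v2 v3 [m2, m1, m3, m4, m6, m5] x = simplex_spline v2 v1 v3 [m1, m2, m3, m4, m5, m6] x"
    for v1 v2 v3 x by (simp add: simplex_spline_def)
  have D: "cross2 (v1 - v2) (v3 - v2) = - cross2 (v2 - v1) (v3 - v1)" for v1 v2 v3
    by (simp add: cross2_def algebra_simps)
  have bary: "bary v2 v1 v3 x = (b, a, c)" if "bary v1 v2 v3 x = (a, b, c)" "cross2 (v2 - v1) (v3 - v1) \<noteq> 0"
    for v1 v2 v3 x a b c
  proof -
    have "coord_sum (b, a, c) = 1" using coord_sum_bary[of v1 v2 v3 x] that(1) by (simp add: coord_sum_def)
    moreover have "comb3 v2 v1 v3 (b, a, c) = x"
      using comb3_bary[OF that(2), of x] that(1) by (simp add: comb3_def add_ac)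
    moreover have "cross2 (v1 - v2) (v3 - v2) \<noteq> 0" using that(2) D[of v1 v2 v3] by simp
    ultimately show ?thesis using bary_comb3[of v1 v2 v3 "(b, a, c)"] by simp
  qed
  show ?thesis
    unfolding closed_form_def basis_fun_def fst_conv snd_conv
  proof (intro allI impI)
    fix v1 v2 v3 x a b c
    assume v: "cross2 (v2 - v1) (v3 - v1) \<noteq> 0" "bary v1 v2 v3 x = (a, b, c)" "0 \<le> a" "0 \<le> b" "0 \<le> c"
    have "cross2 (v1 - v2) (v3 - v2) \<noteq> 0" using v(1) D[of v1 v2 v3] by simp
    then show "w * simplex_spline v1 v2 v3 [m2, m1, m3, m4, m6, m5] x = \<phi> b a c"
      using assms bary[OF v(2,1)] v(3-5) spline[of v1 v2 v3 x]
      unfolding closed_form_def basis_fun_def fst_conv snd_conv by metis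
  qed
qed

lemma closed_form_swap23:
  assumes "closed_form (w, [m1, m2, m3, m4, m5, m6]) \<phi>"
  shows "closed_form (w, [m1, m3, m2, m6, m5, m4]) (\<lambda>a b c. \<phi> a c b)"
proof -
  have "knots v1 v2 v3 [m1, m3, m2, m6, m5, m4] = knots v1 v3 v2 [m1, m2, m3, m4, m5, m6]"
    and "triangle v1 v2 v3 = triangle v1 v3 v2" for v1 v2 v3
    by (simp_all add: knots_def split_points_def midpoint_sym triangle_def insert_commute)
  then have spline: "simplex_spline v1 v2 v3 [m1, m3, m2, m6, m5, m4] x = simplex_spline v1 v3 v2 [m1, m2, m3, m4, m5, m6] x"
    for v1 v2 v3 x by (simp add: simplex_spline_def)
  have D: "cross2 (v3 - v1) (v2 - v1) = - cross2 (v2 - v1) (v3 - v1)" for v1 v2 v3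
    by (simp add: cross2_def algebra_simps)
  have bary: "bary v1 v3 v2 x = (a, c, b)" if "bary v1 v2 v3 x = (a, b, c)" "cross2 (v2 - v1) (v3 - v1) \<noteq> 0"
    for v1 v2 v3 x a b c
  proof -
    have "coord_sum (a, c, b) = 1" using coord_sum_bary[of v1 v2 v3 x] that(1) by (simp add: coord_sum_def)
    moreover have "comb3 v1 v3 v2 (a, c, b) = x"
      using comb3_bary[OF that(2), of x] that(1) by (simp add: comb3_def add_ac)
    moreover have "cross2 (v3 - v1) (v2 - v1) \<noteq> 0" using that(2) D[of v3 v1 v2] by simp
    ultimately show ?thesis using bary_comb3[of v3 v1 v2 "(a, c, b)"] by simp
  qed
  show ?thesis
    unfolding closed_form_def basis_fun_def fst_conv snd_conv
  proof (intro allI impI)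
    fix v1 v2 v3 x a b c
    assume v: "cross2 (v2 - v1) (v3 - v1) \<noteq> 0" "bary v1 v2 v3 x = (a, b, c)" "0 \<le> a" "0 \<le> b" "0 \<le> c"
    have "cross2 (v3 - v1) (v2 - v1) \<noteq> 0" using v(1) D[of v3 v1 v2] by simp
    then show "w * simplex_spline v1 v2 v3 [m1, m3, m2, m6, m5, m4] x = \<phi> a c b"
      using assms bary[OF v(2,1)] v(3-5) spline[of v1 v2 v3 x]
      unfolding closed_form_def basis_fun_def fst_conv snd_conv by metis
  qed
qed

lemma closed_form_orbit:
  assumes "closed_form (w, [m1, m2, m3, m4, m5, m6]) \<phi>"
  shows "closed_form (w, [m1, m2, m3, m4, m5, m6]) (\<lambda>a b c. \<phi> a b c)"
    "closed_form (w, [m2, m1, m3, m4, m6, m5]) (\<lambda>a b c. \<phi> b a c)"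
    "closed_form (w, [m1, m3, m2, m6, m5, m4]) (\<lambda>a b c. \<phi> a c b)"
    "closed_form (w, [m3, m2, m1, m5, m4, m6]) (\<lambda>a b c. \<phi> c b a)"
    "closed_form (w, [m2, m3, m1, m5, m6, m4]) (\<lambda>a b c. \<phi> c a b)"
    "closed_form (w, [m3, m1, m2, m6, m4, m5]) (\<lambda>a b c. \<phi> b c a)"
  using assms closed_form_swap12[OF assms] closed_form_swap23[OF assms]
    closed_form_swap23[OF closed_form_swap12[OF assms]] closed_form_swap12[OF closed_form_swap23[OF assms]]
    closed_form_swap12[OF closed_form_swap23[OF closed_form_swap12[OF assms]]]
  by simp_all

text \<open>
  The basis as a table: labels with their formulas.  The two halves are separated because only
  the functions of the first one have nonzero 2-jets on the edge \<open>[v1, v2]\<close>.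
\<close>

definition leading_forms :: "((real \<times> nat list) \<times> (real \<Rightarrow> real \<Rightarrow> real \<Rightarrow> real)) list" where
  "leading_forms =
     [((1/4, [6,0,0,1,0,1]), \<lambda>a b c. q600101 a b c),
      ((1/4, [5,0,0,2,0,1]), \<lambda>a b c. q500201 a b c),
      ((1/2, [4,1,0,2,0,1]), \<lambda>a b c. q410201 a b c),
      ((1/2, [3,2,0,2,0,1]), \<lambda>a b c. q320201 a b c),
      ((1/2, [2,3,0,2,1,0]), \<lambda>a b c. q320201 b a c),
      ((1/2, [1,4,0,2,1,0]), \<lambda>a b c. q410201 b a c),
      ((1/4, [0,5,0,2,1,0]), \<lambda>a b c. q500201 b a c),
      ((1/4, [0,6,0,1,1,0]), \<lambda>a b c. q600101 b a c),
      ((1/4, [5,0,0,1,0,2]), \<lambda>a b c. q500201 a c b),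
      ((1, [4,1,1,1,0,1]), \<lambda>a b c. q141110 b a c),
      ((1/2, [3,1,1,2,0,1]), \<lambda>a b c. q131210 b a c),
      ((3/4, [2,2,0,2,1,1]), \<lambda>a b c. q220211 a b c),
      ((1/2, [1,3,1,2,1,0]), \<lambda>a b c. q131210 a b c),
      ((1, [1,4,1,1,1,0]), \<lambda>a b c. q141110 a b c),
      ((1/4, [0,5,0,1,2,0]), \<lambda>a b c. q500201 b c a),
      ((1/2, [4,0,1,1,0,2]), \<lambda>a b c. q410201 a c b),
      ((1/2, [3,1,1,1,0,2]), \<lambda>a b c. q131210 c a b),
      ((3/4, [2,1,1,2,1,1]), \<lambda>a b c. q121211 b a c),
      ((3/4, [1,2,1,2,1,1]), \<lambda>a b c. q121211 a b c),
      ((1/2, [1,3,1,1,2,0]), \<lambda>a b c. q131210 c b a),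
      ((1/2, [0,4,1,1,2,0]), \<lambda>a b c. q410201 b c a)]"

definition other_forms :: "((real \<times> nat list) \<times> (real \<Rightarrow> real \<Rightarrow> real \<Rightarrow> real)) list" where
  "other_forms =
     [((1/4, [0,0,6,0,1,1]), \<lambda>a b c. q600101 c b a),
      ((1/4, [0,0,5,0,2,1]), \<lambda>a b c. q500201 c b a),
      ((1/4, [0,0,5,0,1,2]), \<lambda>a b c. q500201 c a b),
      ((1/2, [0,1,4,0,2,1]), \<lambda>a b c. q410201 c b a),
      ((1/2, [1,0,4,0,1,2]), \<lambda>a b c. q410201 c a b),
      ((1/2, [3,0,2,1,0,2]), \<lambda>a b c. q320201 a c b),
      ((1/2, [0,2,3,0,2,1]), \<lambda>a b c. q320201 c b a),
      ((1/2, [2,0,3,0,1,2]), \<lambda>a b c. q320201 c a b),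
      ((1/2, [0,3,2,1,2,0]), \<lambda>a b c. q320201 b c a),
      ((3/4, [2,0,2,1,1,2]), \<lambda>a b c. q220211 a c b),
      ((3/4, [0,2,2,1,2,1]), \<lambda>a b c. q220211 c b a),
      ((1, [1,1,4,0,1,1]), \<lambda>a b c. q141110 a c b),
      ((1/2, [1,1,3,0,1,2]), \<lambda>a b c. q131210 a c b),
      ((1/2, [1,1,3,0,2,1]), \<lambda>a b c. q131210 b c a),
      ((3/4, [1,1,2,1,1,2]), \<lambda>a b c. q121211 a c b),
      ((3/4, [1,2,1,1,2,1]), \<lambda>a b c. q121211 c b a),
      ((3/4, [2,1,1,1,1,2]), \<lambda>a b c. q121211 c a b),
      ((3/4, [1,1,2,1,2,1]), \<lambda>a b c. q121211 b c a)]"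

lemma leading_labels_eq: "leading_labels = map fst leading_forms"
  by (simp add: leading_labels_def leading_forms_def)

lemma basis_labels_eq: "basis_labels = set (map fst leading_forms) \<union> set (map fst other_forms)"
  unfolding basis_labels_def generators_def leading_forms_def other_forms_def by auto

lemma closed_form_basis:
  assumes "(l, \<phi>) \<in> set leading_forms \<union> set other_forms"
  shows "closed_form l \<phi>"
proof -
  have "\<forall>(l, \<phi>) \<in> set leading_forms \<union> set other_forms. closed_form l \<phi>"
    unfolding leading_forms_def other_forms_def
    using closed_form_generators[THEN closed_form_orbit(1)] closed_form_generators[THEN closed_form_orbit(2)]
      closed_form_generators[THEN closed_form_orbit(3)] closed_form_generators[THEN closed_form_orbit(4)]
      closed_form_generators[THEN closed_form_orbit(5)] closed_form_generators[THEN closed_form_orbit(6)]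
    by simp
  then show ?thesis using assms by auto
qed

section \<open>Contact of two functions along an edge\<close>

text \<open>
  The symmetry of the second derivative is carried along with the closure properties below,
  where it is immediate.
\<close>

definition twice_diff :: "('a::real_normed_vector \<Rightarrow> real) \<Rightarrow> ('a \<Rightarrow> 'a \<Rightarrow> real) \<Rightarrow> ('a \<Rightarrow> 'a \<Rightarrow> 'a \<Rightarrow> real) \<Rightarrow> bool" where
  "twice_diff f D D2 \<longleftrightarrow>
     (\<forall>x. (f has_derivative D x) (at x)) \<and>
     (\<forall>x d. ((\<lambda>x. D x d) has_derivative D2 x d) (at x)) \<and>
     (\<forall>x d e. D2 x d e = D2 x e d)"

definition smooth2 :: "('a::real_normed_vector \<Rightarrow> real) \<Rightarrow> bool" where
  "smooth2 f \<longleftrightarrow> (\<exists>D D2. twice_diff f D D2)"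

lemma smooth2I: "twice_diff f D D2 \<Longrightarrow> smooth2 f"
  by (auto simp: smooth2_def)

lemma smooth2_linear: "bounded_linear f \<Longrightarrow> smooth2 f"
  by (rule smooth2I[of _ "\<lambda>x. f" "\<lambda>x d e. 0"])
     (auto simp: twice_diff_def bounded_linear.has_derivative[of _ "\<lambda>x. x" "\<lambda>x. x"])

lemma smooth2_const: "smooth2 (\<lambda>x. k)"
  by (rule smooth2I[of _ "\<lambda>x e. 0" "\<lambda>x d e. 0"]) (auto simp: twice_diff_def)

lemma twice_diff_add:
  "twice_diff f D D2 \<Longrightarrow> twice_diff g E E2 \<Longrightarrow>
     twice_diff (\<lambda>x. f x + g x) (\<lambda>x d. D x d + E x d) (\<lambda>x d e. D2 x d e + E2 x d e)"
  by (auto simp: twice_diff_def intro!: derivative_intros)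

lemma twice_diff_diff:
  "twice_diff f D D2 \<Longrightarrow> twice_diff g E E2 \<Longrightarrow>
     twice_diff (\<lambda>x. f x - g x) (\<lambda>x d. D x d - E x d) (\<lambda>x d e. D2 x d e - E2 x d e)"
  by (auto simp: twice_diff_def intro!: derivative_intros)

lemma smooth2_add: "smooth2 f \<Longrightarrow> smooth2 g \<Longrightarrow> smooth2 (\<lambda>x. f x + g x)"
  unfolding smooth2_def using twice_diff_add by blast

lemma smooth2_diff: "smooth2 f \<Longrightarrow> smooth2 g \<Longrightarrow> smooth2 (\<lambda>x. f x - g x)"
  unfolding smooth2_def using twice_diff_diff by blast

lemma smooth2_mult:
  assumes "smooth2 f" "smooth2 g" shows "smooth2 (\<lambda>x. f x * g x)"
proof -
  from assms obtain D D2 E E2 where f: "twice_diff f D D2" and g: "twice_diff g E E2"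
    by (auto simp: smooth2_def)
  have f': "(f has_derivative D x) (at x)" "((\<lambda>x. D x d) has_derivative D2 x d) (at x)" "D2 x d e = D2 x e d"
    and g': "(g has_derivative E x) (at x)" "((\<lambda>x. E x d) has_derivative E2 x d) (at x)" "E2 x d e = E2 x e d"
    for x d e using f g by (auto simp: twice_diff_def)
  have "twice_diff (\<lambda>x. f x * g x) (\<lambda>x d. f x * E x d + D x d * g x)
     (\<lambda>x d e. (f x * E2 x d e + D x e * E x d) + (D x d * E x e + D2 x d e * g x))"
    unfolding twice_diff_def
  proof (intro conjI allI)
    fix x d e
    show "((\<lambda>x. f x * g x) has_derivative (\<lambda>d. f x * E x d + D x d * g x)) (at x)"
      by (intro has_derivative_mult f' g')
    show "((\<lambda>x. f x * E x d + D x d * g x) has_derivative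
       (\<lambda>e. (f x * E2 x d e + D x e * E x d) + (D x d * E x e + D2 x d e * g x))) (at x)"
      by (intro has_derivative_add has_derivative_mult f' g')
    show "(f x * E2 x d e + D x e * E x d) + (D x d * E x e + D2 x d e * g x) =
          (f x * E2 x e d + D x d * E x e) + (D x e * E x d + D2 x e d * g x)"
      by (simp add: f'(3)[of x d e] g'(3)[of x d e])
  qed
  then show ?thesis by (rule smooth2I)
qed

lemma smooth2_divide: "smooth2 f \<Longrightarrow> smooth2 (\<lambda>x. f x / k)"
  using smooth2_mult[OF _ smooth2_const[of "inverse k"]] by (simp add: divide_inverse)

lemma smooth2_sum: "(\<And>i. i \<in> I \<Longrightarrow> smooth2 (f i)) \<Longrightarrow> smooth2 (\<lambda>x. \<Sum>i\<in>I. f i x)"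
  by (induction I rule: infinite_finite_induct) (auto intro: smooth2_const smooth2_add)

lemma smooth2_compose:
  assumes "smooth2 f" and g: "\<And>y. (g has_real_derivative g1 y) (at y)" "\<And>y. (g1 has_real_derivative g2 y) (at y)"
  shows "smooth2 (\<lambda>x. g (f x))"
proof -
  from assms obtain D D2 where f: "twice_diff f D D2" by (auto simp: smooth2_def)
  have f': "(f has_derivative D x) (at x)" "((\<lambda>x. D x d) has_derivative D2 x d) (at x)" "D2 x d e = D2 x e d"
    for x d e using f by (auto simp: twice_diff_def)
  have chain: "((\<lambda>x. h (f x)) has_derivative (\<lambda>d. h' (f x) * D x d)) (at x)"
    if "\<And>y. (h has_real_derivative h' y) (at y)" for h h' x
    using has_derivative_compose[OF f'(1)[of x], of h "(*) (h' (f x))"] that[of "f x"]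
    by (simp add: has_field_derivative_def)
  have "twice_diff (\<lambda>x. g (f x)) (\<lambda>x d. g1 (f x) * D x d)
     (\<lambda>x d e. g1 (f x) * D2 x d e + g2 (f x) * D x e * D x d)"
    unfolding twice_diff_def
  proof (intro conjI allI)
    fix x d e
    show "((\<lambda>x. g (f x)) has_derivative (\<lambda>d. g1 (f x) * D x d)) (at x)" by (rule chain) (rule g)
    show "((\<lambda>x. g1 (f x) * D x d) has_derivative (\<lambda>e. g1 (f x) * D2 x d e + g2 (f x) * D x e * D x d)) (at x)"
      by (intro has_derivative_mult chain g f')
    show "g1 (f x) * D2 x d e + g2 (f x) * D x e * D x d = g1 (f x) * D2 x e d + g2 (f x) * D x d * D x e"
      by (simp add: f'(3)[of x d e])
  qed
  then show ?thesis by (rule smooth2I)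
qed

lemma smooth2_pos_pow:
  assumes "smooth2 f" "n \<ge> 3" shows "smooth2 (\<lambda>x. pos_pow n (f x))"
proof (rule smooth2_compose[OF assms(1)])
  fix y
  show "(pos_pow n has_real_derivative real n * pos_pow (n - 1) y) (at y)"
    using DERIV_pos_pow_chain[OF DERIV_ident, of n y UNIV] assms(2) by simp
  show "((\<lambda>y. real n * pos_pow (n - 1) y) has_real_derivative real n * (real (n - 1) * pos_pow (n - 1 - 1) y)) (at y)"
    using DERIV_cmult[OF DERIV_pos_pow_chain[OF DERIV_ident, of "n - 1" y UNIV], of "real n"] assms(2) by simp
qed

lemmas smooth2_intros = smooth2_const smooth2_add smooth2_diff smooth2_mult smooth2_divide smooth2_pos_pow

lemma spans_plane:
  assumes "cross2 e u \<noteq> 0" shows "\<exists>\<alpha> \<gamma>. w = \<alpha> *\<^sub>R e + \<gamma> *\<^sub>R u"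
proof -
  have "w = (cross2 w u / cross2 e u) *\<^sub>R e + (cross2 e w / cross2 e u) *\<^sub>R u"
    using comb3_bary[of e 0 u w] assms by (simp add: comb3_def bary_def Let_def)
  then show ?thesis by blast
qed

lemma linear_eq_plane:
  assumes "linear D" "linear D'" "cross2 e u \<noteq> 0" "D e = D' e" "D u = (D' u :: real)"
  shows "D = D'"
proof
  fix w
  obtain \<alpha> \<gamma> where "w = \<alpha> *\<^sub>R e + \<gamma> *\<^sub>R u" using spans_plane[OF assms(3)] by blast
  then show "D w = D' w"
    using assms(4,5) by (simp add: linear_add[OF assms(1)] linear_add[OF assms(2)]
        linear_cmul[OF assms(1)] linear_cmul[OF assms(2)])
qed

lemma has_derivative_along_segment:
  fixes f :: "'a::real_normed_vector \<Rightarrow> real"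
  assumes f: "(f has_derivative D) (at (p + s *\<^sub>R e) within S)" and "(\<lambda>t. p + t *\<^sub>R e) ` {0..1} \<subseteq> S"
  shows "((\<lambda>t. f (p + t *\<^sub>R e)) has_real_derivative D e) (at s within {0..1})"
proof -
  have "((\<lambda>t. p + t *\<^sub>R e) has_derivative (\<lambda>t. t *\<^sub>R e)) (at s within {0..1})"
    by (auto intro!: derivative_eq_intros)
  from has_derivative_in_compose[OF this has_derivative_subset[OF f assms(2)]]
  have "((\<lambda>t. f (p + t *\<^sub>R e)) has_derivative (\<lambda>t. D (t *\<^sub>R e))) (at s within {0..1})" .
  moreover have "(\<lambda>t. D (t *\<^sub>R e)) = (*) (D e)"
    using linear_cmul[OF has_derivative_linear[OF f]] by (auto simp: mult.commute)
  ultimately show ?thesis by (simp add: has_field_derivative_def)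
qed

lemma DERIV_unique_unit_interval:
  assumes "(f has_real_derivative c) (at s within {0..1})" "(f has_real_derivative d) (at s within {0..1})"
    "s \<in> {0..1}"
  shows "c = d"
  using vector_derivative_unique_within_closed_interval[of 0 1 s f c d] assms
  by (simp add: has_real_derivative_iff_has_vector_derivative)

text \<open>
  A coordinate direction need not point into the triangle at a corner, but the directions from
  \<open>x\<close> to the three vertices do, and their differences span the plane.
\<close>

lemma has_derivative_unique_triangle:
  fixes f :: "real^2 \<Rightarrow> real"
  assumes D: "cross2 (v2 - v1) (v3 - v1) \<noteq> 0" and x: "x \<in> triangle v1 v2 v3"
    and f: "(f has_derivative F) (at x within triangle v1 v2 v3)"
           "(f has_derivative F') (at x within triangle v1 v2 v3)"
  shows "F = F'"
proof -
  have lin: "linear F" "linear F'" using f by (auto dest: has_derivative_linear)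
  have dir: "F (y - x) = F' (y - x)" if "y \<in> triangle v1 v2 v3" for y
  proof -
    have "x + t *\<^sub>R (y - x) \<in> triangle v1 v2 v3" if "t \<in> {0..1}" for t
    proof -
      have "x + t *\<^sub>R (y - x) = (1 - t) *\<^sub>R x + t *\<^sub>R y" by (simp add: algebra_simps)
      then show ?thesis using that x \<open>y \<in> _\<close> unfolding triangle_def
        by (metis atLeastAtMost_iff convex_alt convex_convex_hull)
    qed
    then have "(\<lambda>t. x + t *\<^sub>R (y - x)) ` {0..1} \<subseteq> triangle v1 v2 v3" by blast
    from has_derivative_along_segment[of f F x 0, OF _ this] has_derivative_along_segment[of f F' x 0, OF _ this]
    show ?thesis using f DERIV_unique_unit_interval[of _ "F (y - x)" 0 "F' (y - x)"] by simp
  qed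
  have v: "v1 \<in> triangle v1 v2 v3" "v2 \<in> triangle v1 v2 v3" "v3 \<in> triangle v1 v2 v3"
    by (simp_all add: triangle_def hull_inc)
  have "v2 - v1 = (v2 - x) - (v1 - x)" "v3 - v1 = (v3 - x) - (v1 - x)" by simp_all
  then have "F (v2 - v1) = F' (v2 - v1)" "F (v3 - v1) = F' (v3 - v1)"
    using dir v by (simp_all only: linear_diff[OF lin(1)] linear_diff[OF lin(2)])
  then show ?thesis using linear_eq_plane[OF lin D] by simp
qed

lemma has_partial_step:
  assumes D: "cross2 (v2 - v1) (v3 - v1) \<noteq> 0"
    and ds: "\<And>g. has_partial (triangle v1 v2 v3) ds f g \<longleftrightarrow> (\<forall>x\<in>triangle v1 v2 v3. g x = F x)"
    and F: "\<And>x. (F has_derivative F1 x) (at x)"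
  shows "has_partial (triangle v1 v2 v3) (d # ds) f g \<longleftrightarrow> (\<forall>x\<in>triangle v1 v2 v3. g x = F1 x (axis d 1))"
proof
  let ?T = "triangle v1 v2 v3"
  assume "has_partial ?T (d # ds) f g"
  then obtain h where h: "\<forall>x\<in>?T. h x = F x"
    and "\<forall>x\<in>?T. \<exists>D. (h has_derivative D) (at x within ?T) \<and> g x = D (axis d 1)"
    using ds by auto
  then have "\<exists>D. (h has_derivative D) (at x within ?T) \<and> g x = D (axis d 1)" if "x \<in> ?T" for x
    using that by blast
  moreover have "D = F1 x" if "x \<in> ?T" "(h has_derivative D) (at x within ?T)" for x D
  proof -
    have "(F has_derivative D) (at x within ?T)"
      by (rule has_derivative_transform[OF that(1) _ that(2)]) (use h in auto)
    then show ?thesis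
      using has_derivative_unique_triangle[OF assms(1) that(1)] has_derivative_at_withinI[OF F] by blast
  qed
  ultimately show "\<forall>x\<in>?T. g x = F1 x (axis d 1)" by blast
next
  let ?T = "triangle v1 v2 v3"
  assume "\<forall>x\<in>?T. g x = F1 x (axis d 1)"
  then have "\<forall>x\<in>?T. \<exists>D. (F has_derivative D) (at x within ?T) \<and> g x = D (axis d 1)"
    using has_derivative_at_withinI[OF F] by blast
  then show "has_partial ?T (d # ds) f g"
    using ds[of F] by auto
qed

text \<open>
  One-sided partial derivatives on the triangle are the restrictions of those of any twice
  differentiable extension.
\<close>

lemma has_partial_iff:
  assumes D: "cross2 (v2 - v1) (v3 - v1) \<noteq> 0" and F: "twice_diff F F1 F2"
    and f: "\<forall>x\<in>triangle v1 v2 v3. f x = F x"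
  shows "has_partial (triangle v1 v2 v3) [] f g \<longleftrightarrow> (\<forall>x\<in>triangle v1 v2 v3. g x = F x)"
    "has_partial (triangle v1 v2 v3) [d] f g \<longleftrightarrow> (\<forall>x\<in>triangle v1 v2 v3. g x = F1 x (axis d 1))"
    "has_partial (triangle v1 v2 v3) [d', d] f g \<longleftrightarrow> (\<forall>x\<in>triangle v1 v2 v3. g x = F2 x (axis d 1) (axis d' 1))"
proof -
  show 0: "has_partial (triangle v1 v2 v3) [] f g \<longleftrightarrow> (\<forall>x\<in>triangle v1 v2 v3. g x = F x)" for g
    using f by auto
  show 1: "has_partial (triangle v1 v2 v3) [d] f g \<longleftrightarrow> (\<forall>x\<in>triangle v1 v2 v3. g x = F1 x (axis d 1))" for g
    by (rule has_partial_step[OF D 0]) (use F in \<open>auto simp: twice_diff_def\<close>)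
  show "has_partial (triangle v1 v2 v3) [d', d] f g \<longleftrightarrow> (\<forall>x\<in>triangle v1 v2 v3. g x = F2 x (axis d 1) (axis d' 1))"
    by (rule has_partial_step[OF D 1, where ?F1.0 = "\<lambda>x. F2 x (axis d 1)"]) (use F in \<open>auto simp: twice_diff_def\<close>)
qed

lemma cross2_axis: "cross2 (axis 1 1) (axis 2 1) = 1"
  by (simp add: cross2_def axis_def)

definition jet2 :: "(real \<Rightarrow> real) \<Rightarrow> real \<Rightarrow> real \<Rightarrow> real \<Rightarrow> bool" where
  "jet2 g x0 x1 x2 \<longleftrightarrow> g 0 = x0 \<and>
     (\<exists>g'. (\<forall>t. (g has_real_derivative g' t) (at t)) \<and> g' 0 = x1 \<and> (g' has_real_derivative x2) (at 0))"

lemma jet2_along_line: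
  assumes F: "twice_diff F F1 F2" and j: "jet2 (\<lambda>t. F (p + t *\<^sub>R u)) x0 x1 x2"
  shows "x0 = F p" "x1 = F1 p u" "x2 = F2 p u u"
proof -
  have line: "((\<lambda>t. h (p + t *\<^sub>R u)) has_real_derivative h1 (p + t *\<^sub>R u) u) (at t)"
    if "\<And>x. (h has_derivative h1 x) (at x)" for h :: "_ \<Rightarrow> real" and h1 t
  proof -
    have "((\<lambda>t. p + t *\<^sub>R u) has_derivative (\<lambda>t. t *\<^sub>R u)) (at t)"
      by (auto intro!: derivative_eq_intros)
    from has_derivative_compose[OF this that]
    have "((\<lambda>t. h (p + t *\<^sub>R u)) has_derivative (\<lambda>s. h1 (p + t *\<^sub>R u) (s *\<^sub>R u))) (at t)" .
    moreover have "(\<lambda>s. h1 (p + t *\<^sub>R u) (s *\<^sub>R u)) = (*) (h1 (p + t *\<^sub>R u) u)"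
      using linear_cmul[OF has_derivative_linear[OF that]] by (auto simp: mult.commute)
    ultimately show ?thesis by (simp add: has_field_derivative_def)
  qed
  obtain g' where g': "\<And>t. ((\<lambda>t. F (p + t *\<^sub>R u)) has_real_derivative g' t) (at t)" "g' 0 = x1"
    "(g' has_real_derivative x2) (at 0)" using j by (auto simp: jet2_def)
  show "x0 = F p" using j by (auto simp: jet2_def)
  have F1: "((\<lambda>t. F (p + t *\<^sub>R u)) has_real_derivative F1 (p + t *\<^sub>R u) u) (at t)" for t
    by (rule line) (use F in \<open>simp add: twice_diff_def\<close>)
  have g'_eq: "g' = (\<lambda>t. F1 (p + t *\<^sub>R u) u)" using DERIV_unique[OF g'(1) F1] by auto
  then show "x1 = F1 p u" using g'(2) by auto
  have "((\<lambda>t. F1 (p + t *\<^sub>R u) u) has_real_derivative F2 (p + 0 *\<^sub>R u) u u) (at 0)"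
    by (rule line[of "\<lambda>x. F1 x u" "\<lambda>x. F2 x u"]) (use F in \<open>simp add: twice_diff_def\<close>)
  then show "x2 = F2 p u u" using g'(3) DERIV_unique unfolding g'_eq by fastforce
qed

lemma closed_segment_eq_image_line:
  fixes v1 v2 :: "'a::real_vector"
  shows "closed_segment v1 v2 = (\<lambda>s. v1 + s *\<^sub>R (v2 - v1)) ` {0..1}"
proof -
  have "(1 - u) *\<^sub>R v1 + u *\<^sub>R v2 = v1 + u *\<^sub>R (v2 - v1)" for u by (simp add: algebra_simps)
  then show ?thesis by (auto simp: closed_segment_def)
qed

lemma vanishing_along_segment:
  fixes f :: "real^2 \<Rightarrow> real"
  assumes "\<And>p. p \<in> closed_segment v1 v2 \<Longrightarrow> f p = 0" "(f has_derivative D) (at p)" "p \<in> closed_segment v1 v2"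
  shows "D (v2 - v1) = 0"
proof -
  obtain s where s: "0 \<le> s" "s \<le> 1" and p: "p = v1 + s *\<^sub>R (v2 - v1)"
    using assms(3) by (auto simp: closed_segment_eq_image_line)
  have seg: "v1 + t *\<^sub>R (v2 - v1) \<in> closed_segment v1 v2" if "t \<in> {0..1}" for t
    using that by (auto simp: closed_segment_eq_image_line)
  have "((\<lambda>t. f (v1 + t *\<^sub>R (v2 - v1))) has_real_derivative D (v2 - v1)) (at s within {0..1})"
    using assms(2) p by (intro has_derivative_along_segment[where S = UNIV]) auto
  moreover have "((\<lambda>t. f (v1 + t *\<^sub>R (v2 - v1))) has_real_derivative 0) (at s within {0..1})"
  proof (rule has_field_derivative_transform_within[where d = 1])
    show "((\<lambda>t. 0) has_real_derivative 0) (at s within {0..1})" by simp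
  qed (use s seg assms(1) in auto)
  ultimately show ?thesis using DERIV_unique_unit_interval[of _ "D (v2 - v1)" s 0] s by simp
qed

text \<open>
  Let \<open>G\<close> be the difference of the two functions.  If \<open>G\<close> and its \<open>u\<close>-derivative vanish on the edge, so does
  the derivative of \<open>G\<close> along the edge, hence the gradient; differentiating the gradient along
  the edge kills one row of the Hessian, by symmetry one column as well, and only the
  \<open>u\<close>-\<open>u\<close> entry is left.
\<close>

theorem meet_smoothly_iff_transversal:
  fixes F F' :: "real^2 \<Rightarrow> real"
  assumes D: "cross2 (v2 - v1) (v3 - v1) \<noteq> 0" and D': "cross2 (v2 - v1) (v3' - v1) \<noteq> 0"
    and smooth: "smooth2 F" "smooth2 F'"
    and f: "\<forall>x\<in>triangle v1 v2 v3. f x = F x" and f': "\<forall>x\<in>triangle v1 v2 v3'. f' x = F' x"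
    and jet: "\<And>s. 0 \<le> s \<Longrightarrow> s \<le> 1 \<Longrightarrow>
        jet2 (\<lambda>t. F' (v1 + s *\<^sub>R (v2 - v1) + t *\<^sub>R (v3' - v1)) - F (v1 + s *\<^sub>R (v2 - v1) + t *\<^sub>R (v3' - v1)))
          (x0 s) (x1 s) (x2 s)"
  defines "meet \<equiv> \<lambda>r. meet_smoothly r (closed_segment v1 v2) (triangle v1 v2 v3) (triangle v1 v2 v3') f f'"
  shows "meet 0 \<longleftrightarrow> (\<forall>s\<in>{0..1}. x0 s = 0)"
    "meet 1 \<longleftrightarrow> (\<forall>s\<in>{0..1}. x0 s = 0) \<and> (\<forall>s\<in>{0..1}. x1 s = 0)"
    "meet 2 \<longleftrightarrow> (\<forall>s\<in>{0..1}. x0 s = 0) \<and> (\<forall>s\<in>{0..1}. x1 s = 0) \<and> (\<forall>s\<in>{0..1}. x2 s = 0)"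
proof -
  let ?E = "closed_segment v1 v2" and ?T = "triangle v1 v2 v3" and ?T' = "triangle v1 v2 v3'"
  let ?e = "v2 - v1" and ?u = "v3' - v1"
  obtain F1 F2 F1' F2' where F: "twice_diff F F1 F2" and F': "twice_diff F' F1' F2'"
    using smooth by (auto simp: smooth2_def)
  define G G1 G2 where "G = (\<lambda>x. F' x - F x)" and "G1 = (\<lambda>x d. F1' x d - F1 x d)"
    and "G2 = (\<lambda>x d e. F2' x d e - F2 x d e)"
  have G: "twice_diff G G1 G2" unfolding G_def G1_def G2_def by (rule twice_diff_diff[OF F' F])
  then have G_deriv: "(G has_derivative G1 x) (at x)" "((\<lambda>x. G1 x d) has_derivative G2 x d) (at x)"
      "G2 x d e = G2 x e d" for x d e
    by (auto simp: twice_diff_def)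
  have lin: "linear (G1 x)" "linear (G2 x d)" for x d
    using G_deriv by (auto dest: has_derivative_linear)
  have ET: "?E \<subseteq> ?T" "?E \<subseteq> ?T'"
    unfolding triangle_def segment_convex_hull by (auto intro!: hull_mono)
  note P = has_partial_iff[OF D F f] and P' = has_partial_iff[OF D' F' f']
  have ex: "(\<exists>g g'. (\<forall>x\<in>?T. g x = h x) \<and> (\<forall>x\<in>?T'. g' x = h' x) \<and> (\<forall>p\<in>?E. g p = g' p))
      \<longleftrightarrow> (\<forall>p\<in>?E. h p = h' p)" for h h' :: "real^2 \<Rightarrow> real"
    using ET by (auto 0 4)
  have upto: "(\<forall>ds. length ds \<le> 0 \<longrightarrow> Q ds) \<longleftrightarrow> Q []"
    "(\<forall>ds. length ds \<le> 1 \<longrightarrow> Q ds) \<longleftrightarrow> Q [] \<and> (\<forall>d. Q [d])"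
    "(\<forall>ds. length ds \<le> 2 \<longrightarrow> Q ds) \<longleftrightarrow> Q [] \<and> (\<forall>d. Q [d]) \<and> (\<forall>d d'. Q [d', d])" for Q :: "2 list \<Rightarrow> bool"
    by (auto simp: le_Suc_eq length_Suc_conv numeral_2_eq_2 simp del: One_nat_def) (auto simp: le_Suc_eq length_Suc_conv)
  have m0: "meet 0 \<longleftrightarrow> (\<forall>p\<in>?E. G p = 0)"
    unfolding meet_def meet_smoothly_def upto P P' ex G_def by auto
  have m1: "meet 1 \<longleftrightarrow> (\<forall>p\<in>?E. G p = 0) \<and> (\<forall>d. \<forall>p\<in>?E. G1 p (axis d 1) = 0)"
    unfolding meet_def meet_smoothly_def upto P P' ex G_def G1_def by auto
  have m2: "meet 2 \<longleftrightarrow> (\<forall>p\<in>?E. G p = 0) \<and> (\<forall>d. \<forall>p\<in>?E. G1 p (axis d 1) = 0) \<and>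
      (\<forall>d d'. \<forall>p\<in>?E. G2 p (axis d 1) (axis d' 1) = 0)"
    unfolding meet_def meet_smoothly_def upto P P' ex G_def G1_def G2_def by auto
  have jets: "x0 s = G (v1 + s *\<^sub>R ?e)" "x1 s = G1 (v1 + s *\<^sub>R ?e) ?u" "x2 s = G2 (v1 + s *\<^sub>R ?e) ?u ?u"
    if "s \<in> {0..1}" for s
    using jet2_along_line[OF G, of "v1 + s *\<^sub>R ?e" ?u "x0 s" "x1 s" "x2 s"] jet[of s] that
    by (simp_all add: G_def)
  have e0: "(\<forall>s\<in>{0..1}. x0 s = 0) \<longleftrightarrow> (\<forall>p\<in>?E. G p = 0)"
    and e1: "(\<forall>s\<in>{0..1}. x1 s = 0) \<longleftrightarrow> (\<forall>p\<in>?E. G1 p ?u = 0)"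
    and e2: "(\<forall>s\<in>{0..1}. x2 s = 0) \<longleftrightarrow> (\<forall>p\<in>?E. G2 p ?u ?u = 0)"
    by (simp_all add: closed_segment_eq_image_line jets)
  have zero: "L = (\<lambda>_. 0)" if "linear L" "cross2 e u \<noteq> 0" "L e = 0" "L u = 0" for L :: "real^2 \<Rightarrow> real" and e u
    by (rule linear_eq_plane[OF that(1) _ that(2)]) (use that in \<open>auto intro: linearI\<close>)
  have axis_zero: "L = (\<lambda>_. 0)" if "linear L" "\<And>d. L (axis d 1) = 0" for L :: "real^2 \<Rightarrow> real"
    by (rule zero[of _ "axis 1 1" "axis 2 1"]) (use that in \<open>auto simp: cross2_axis\<close>)
  have g1: "G1 p = (\<lambda>_. 0)" if "\<forall>p\<in>?E. G p = 0" "\<forall>p\<in>?E. G1 p ?u = 0" "p \<in> ?E" for p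
    by (rule zero[OF lin(1) D'])
       (use that vanishing_along_segment[of v1 v2 G, OF _ G_deriv(1)] in auto)
  have g2: "G2 p d = (\<lambda>_. 0)" if G0: "\<forall>p\<in>?E. G p = 0" "\<forall>p\<in>?E. G1 p ?u = 0" and G2u: "\<forall>p\<in>?E. G2 p ?u ?u = 0"
    and p: "p \<in> ?E" for p d
  proof -
    have e: "G2 p d ?e = 0" for d
      by (rule vanishing_along_segment[of v1 v2 "\<lambda>x. G1 x d", OF _ G_deriv(2) p]) (simp add: g1[OF G0])
    have u: "G2 p ?u = (\<lambda>_. 0)" by (rule zero[OF lin(2) D']) (use e G2u p in auto)
    show ?thesis by (rule zero[OF lin(2) D']) (use e u G_deriv(3)[of p d ?u] in auto)
  qed
  show "meet 0 \<longleftrightarrow> (\<forall>s\<in>{0..1}. x0 s = 0)" unfolding m0 e0 ..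
  show "meet 1 \<longleftrightarrow> (\<forall>s\<in>{0..1}. x0 s = 0) \<and> (\<forall>s\<in>{0..1}. x1 s = 0)"
    unfolding m1 e0 e1 using g1 axis_zero[OF lin(1)] by metis
  show "meet 2 \<longleftrightarrow> (\<forall>s\<in>{0..1}. x0 s = 0) \<and> (\<forall>s\<in>{0..1}. x1 s = 0) \<and> (\<forall>s\<in>{0..1}. x2 s = 0)"
  proof
    assume "meet 2"
    then have m: "\<forall>p\<in>?E. G p = 0" "\<And>d p. p \<in> ?E \<Longrightarrow> G1 p (axis d 1) = 0"
      "\<And>d d' p. p \<in> ?E \<Longrightarrow> G2 p (axis d 1) (axis d' 1) = 0"
      unfolding m2 by auto
    have "G1 p = (\<lambda>_. 0)" if "p \<in> ?E" for p using axis_zero[OF lin(1)] m(2)[OF that] by blast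
    moreover have "G2 p ?u ?u = 0" if p: "p \<in> ?E" for p
    proof -
      have a: "G2 p (axis d 1) = (\<lambda>_. 0)" for d using axis_zero[OF lin(2)] m(3)[OF p] by blast
      have "G2 p ?u (axis d 1) = 0" for d using a[of d] G_deriv(3)[of p ?u "axis d 1"] by simp
      then show ?thesis using axis_zero[OF lin(2), of p ?u] by simp
    qed
    ultimately show "(\<forall>s\<in>{0..1}. x0 s = 0) \<and> (\<forall>s\<in>{0..1}. x1 s = 0) \<and> (\<forall>s\<in>{0..1}. x2 s = 0)"
      unfolding e0 e1 e2 using m(1) by simp
  next
    assume "(\<forall>s\<in>{0..1}. x0 s = 0) \<and> (\<forall>s\<in>{0..1}. x1 s = 0) \<and> (\<forall>s\<in>{0..1}. x2 s = 0)"
    then show "meet 2" unfolding m2 e0 e1 e2 using g1 g2 by auto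
  qed
qed

section \<open>Jets of the basis functions on the edge\<close>

text \<open>
  First and second derivatives of a function of barycentric coordinates in the direction
  \<open>(x, y, z)\<close>.  They are defined by \<open>deriv\<close>, which needs no proof of differentiability, so that
  permuting the arguments of \<open>\<phi>\<close> commutes with them by definition.
\<close>

definition slope :: "(real \<Rightarrow> real \<Rightarrow> real \<Rightarrow> real) \<Rightarrow> real \<Rightarrow> real \<Rightarrow> real \<Rightarrow> real \<Rightarrow> real \<Rightarrow> real \<Rightarrow> real" where
  "slope \<phi> a b c x y z = deriv (\<lambda>t. \<phi> (a + t * x) (b + t * y) (c + t * z)) 0"

definition curvature :: "(real \<Rightarrow> real \<Rightarrow> real \<Rightarrow> real) \<Rightarrow> real \<Rightarrow> real \<Rightarrow> real \<Rightarrow> real \<Rightarrow> real \<Rightarrow> real \<Rightarrow> real" where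
  "curvature \<phi> a b c x y z = deriv (\<lambda>t. slope \<phi> (a + t * x) (b + t * y) (c + t * z) x y z) 0"

lemma jet2_slope_curvature:
  assumes "smooth2 (\<lambda>t. \<phi> (a + t * x) (b + t * y) (c + t * z))"
  shows "jet2 (\<lambda>t. \<phi> (a + t * x) (b + t * y) (c + t * z)) (\<phi> a b c) (slope \<phi> a b c x y z) (curvature \<phi> a b c x y z)"
proof -
  let ?f = "\<lambda>t. \<phi> (a + t * x) (b + t * y) (c + t * z)"
  obtain D D2 where f: "twice_diff ?f D D2" using assms by (auto simp: smooth2_def)
  have DERIV: "(g has_real_derivative G 1) (at t)" if "(g has_derivative G) (at t)" for g :: "real \<Rightarrow> real" and G t
  proof -
    have "G s = G 1 * s" for s
    proof -
      have "G (s *\<^sub>R 1) = s *\<^sub>R G 1" by (rule linear_cmul[OF has_derivative_linear[OF that]])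
      then show ?thesis by simp
    qed
    then have "G = (*) (G 1)" by (rule ext)
    then show ?thesis using that by (simp add: has_field_derivative_def)
  qed
  have D1: "(?f has_real_derivative D t 1) (at t)" for t
    by (rule DERIV) (use f in \<open>simp add: twice_diff_def\<close>)
  have D2: "((\<lambda>t. D t 1) has_real_derivative D2 0 1 1) (at 0)"
    by (rule DERIV[where G = "D2 0 1"]) (use f in \<open>simp add: twice_diff_def\<close>)
  have slope: "slope \<phi> (a + t * x) (b + t * y) (c + t * z) x y z = D t 1" for t
  proof -
    have "((\<lambda>\<tau>. ?f (\<tau> + t)) has_real_derivative D t 1) (at 0)"
      using D1[of t] DERIV_shift[of ?f "D t 1" 0 t] by simp
    then have "((\<lambda>\<tau>. \<phi> (a + t * x + \<tau> * x) (b + t * y + \<tau> * y) (c + t * z + \<tau> * z)) has_real_derivative D t 1) (at 0)"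
      by (simp add: algebra_simps)
    then show ?thesis unfolding slope_def by (rule DERIV_imp_deriv)
  qed
  have "curvature \<phi> a b c x y z = D2 0 1 1"
    unfolding curvature_def slope using D2 by (rule DERIV_imp_deriv)
  moreover have "slope \<phi> a b c x y z = D 0 1" using slope[of 0] by simp
  ultimately show ?thesis
    unfolding jet2_def using D1 D2 by (auto intro!: exI[of _ "\<lambda>t. D t 1"])
qed

lemma jet2_diff: "jet2 f x0 x1 x2 \<Longrightarrow> jet2 g y0 y1 y2 \<Longrightarrow> jet2 (\<lambda>t. f t - g t) (x0 - y0) (x1 - y1) (x2 - y2)"
  unfolding jet2_def
proof (elim conjE exE, intro conjI)
  fix f' g' assume h: "\<forall>t. (f has_real_derivative f' t) (at t)" "\<forall>t. (g has_real_derivative g' t) (at t)"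
    "f' 0 = x1" "g' 0 = y1" "(f' has_real_derivative x2) (at 0)" "(g' has_real_derivative y2) (at 0)"
  show "\<exists>k. (\<forall>t. ((\<lambda>t. f t - g t) has_real_derivative k t) (at t)) \<and> k 0 = x1 - y1 \<and>
      (k has_real_derivative x2 - y2) (at 0)"
    using h by (intro exI[of _ "\<lambda>t. f' t - g' t"]) (auto intro!: DERIV_diff)
qed auto

lemma jet2_linear_combination:
  assumes "\<And>i. i \<in> I \<Longrightarrow> jet2 (f i) (x0 i) (x1 i) (x2 i)"
  shows "jet2 (\<lambda>t. \<Sum>i\<in>I. k i * f i t) (\<Sum>i\<in>I. k i * x0 i) (\<Sum>i\<in>I. k i * x1 i) (\<Sum>i\<in>I. k i * x2 i)"
proof -
  have "\<forall>i\<in>I. \<exists>f'. (\<forall>t. (f i has_real_derivative f' t) (at t)) \<and> f' 0 = x1 i \<and> (f' has_real_derivative x2 i) (at 0)"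
    using assms by (auto simp: jet2_def)
  then obtain f' where f': "\<And>i t. i \<in> I \<Longrightarrow> (f i has_real_derivative f' i t) (at t)"
      "\<And>i. i \<in> I \<Longrightarrow> f' i 0 = x1 i" "\<And>i. i \<in> I \<Longrightarrow> (f' i has_real_derivative x2 i) (at 0)"
    by metis
  show ?thesis unfolding jet2_def
  proof (intro conjI exI[of _ "\<lambda>t. \<Sum>i\<in>I. k i * f' i t"] allI)
    show "(\<Sum>i\<in>I. k i * f i 0) = (\<Sum>i\<in>I. k i * x0 i)"
      using assms by (auto simp: jet2_def intro!: sum.cong)
    show "((\<lambda>t. \<Sum>i\<in>I. k i * f i t) has_real_derivative (\<Sum>i\<in>I. k i * f' i t)) (at t)" for t
      by (intro DERIV_sum DERIV_cmult f')
    show "((\<lambda>t. \<Sum>i\<in>I. k i * f' i t) has_real_derivative (\<Sum>i\<in>I. k i * x2 i)) (at 0)"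
      by (intro DERIV_sum DERIV_cmult f')
  qed (use f'(2) in \<open>auto intro!: sum.cong\<close>)
qed

lemma smooth2_q:
  assumes "smooth2 A" "smooth2 B" "smooth2 C"
  shows "smooth2 (\<lambda>x. q600101 (A x) (B x) (C x))" "smooth2 (\<lambda>x. q500201 (A x) (B x) (C x))"
    "smooth2 (\<lambda>x. q410201 (A x) (B x) (C x))" "smooth2 (\<lambda>x. q320201 (A x) (B x) (C x))"
    "smooth2 (\<lambda>x. q220211 (A x) (B x) (C x))" "smooth2 (\<lambda>x. q141110 (A x) (B x) (C x))"
    "smooth2 (\<lambda>x. q131210 (A x) (B x) (C x))" "smooth2 (\<lambda>x. q121211 (A x) (B x) (C x))"
  unfolding q_defs by (intro smooth2_intros assms; simp)+

lemma smooth2_forms: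
  assumes "(l, \<phi>) \<in> set leading_forms \<union> set other_forms" "smooth2 A" "smooth2 B" "smooth2 C"
  shows "smooth2 (\<lambda>x. \<phi> (A x) (B x) (C x))"
proof -
  have "\<forall>(l, \<phi>) \<in> set leading_forms \<union> set other_forms. smooth2 (\<lambda>x. \<phi> (A x) (B x) (C x))"
    unfolding leading_forms_def other_forms_def using assms(2-4)
    by (simp add: smooth2_q)
  then show ?thesis using assms(1) by auto
qed

lemma slope_q:
  "slope q600101 a b c x y z = 5 * pos_pow 4 (a - b - c) * (x - y - z)"
  "slope q500201 a b c x y z = 10 * y * pos_pow 4 (a - b - c) + 40 * b * pos_pow 3 (a - b - c) * (x - y - z)"
  "slope q410201 a b c x y z = 20 * pos_pow 4 (a - c) * (x - z) - 20 * pos_pow 4 (a - b - c) * (x - z)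
     - 80 * b * pos_pow 3 (a - b - c) * (x - y - z)"
  "slope q320201 a b c x y z = 20 * y * (pos_pow 4 (a - c) + pos_pow 4 (a - b - c))
     + 80 * b * (pos_pow 3 (a - c) * (x - z) + pos_pow 3 (a - b - c) * (x - y - z))
     - 40 * (pos_pow 4 (a - c) * (x - z) - pos_pow 4 (a - b - c) * (x - y - z))"
  "slope q220211 a b c x y z = 60 * pos_pow 4 (a - c) * (x - y - z) - 240 * b * pos_pow 3 (a - c) * (x - z)
     + 60 * pos_pow 4 (b - c) * (y - x - z) - 240 * a * pos_pow 3 (b - c) * (y - z)
     - 15 * (x + y - z) * (pos_pow 4 (a - b - c) + pos_pow 4 (b - a - c))
     - 60 * (a + b - c) * (pos_pow 3 (a - b - c) * (x - y - z) + pos_pow 3 (b - a - c) * (y - x - z))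
     + 15 * pos_pow 4 (a + b - c) * (x + y - z)"
  "slope q141110 a b c x y z = 20 * (pos_pow 4 b * y - pos_pow 4 (b - c) * (y - z) - pos_pow 4 (b - a) * (y - x)
     + pos_pow 4 (b - a - c) * (y - x - z))"
  "slope q131210 a b c x y z = 20 * (pos_pow 4 b * y - pos_pow 4 (b - c) * (y - z) - pos_pow 4 (b - a) * y
     + pos_pow 4 (b - a - c) * (y - z))
     - 80 * a * (pos_pow 3 (b - a) * (y - x) - pos_pow 3 (b - a - c) * (y - x - z))"
  "slope q121211 a b c x y z = 60 * x * pos_pow 4 b + 240 * a * pos_pow 3 b * y - 120 * pos_pow 4 b * y
     + 60 * pos_pow 4 (b - c) * (y - z) + 120 * pos_pow 4 (b - a) * (y - x) + 60 * x * pos_pow 4 (b - a)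
     + 240 * a * pos_pow 3 (b - a) * (y - x)
     - 45 * pos_pow 4 (b - a - c) * (y - x - z) - 30 * x * pos_pow 4 (b - a - c)
     - 120 * a * pos_pow 3 (b - a - c) * (y - x - z)
     - 15 * pos_pow 4 (a + b - c) * (x + y - z) + 60 * y * pos_pow 4 (a - c) + 240 * b * pos_pow 3 (a - c) * (x - z)
     - 60 * pos_pow 4 (a - c) * (x - z)
     + 15 * (x + y - z) * pos_pow 4 (a - b - c) + 60 * (a + b - c) * pos_pow 3 (a - b - c) * (x - y - z)"
  unfolding slope_def q_defs
  by ((rule DERIV_imp_deriv, (rule derivative_eq_intros refl | simp)+, (simp add: algebra_simps)?)[1])+

lemma curvature_q:
  "curvature q600101 a b c x y z = 20 * pos_pow 3 (a - b - c) * (x - y - z)\<^sup>2"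
  "curvature q500201 a b c x y z = 80 * y * pos_pow 3 (a - b - c) * (x - y - z)
     + 120 * b * pos_pow 2 (a - b - c) * (x - y - z)\<^sup>2"
  "curvature q410201 a b c x y z = 80 * pos_pow 3 (a - c) * (x - z)\<^sup>2
     - 80 * pos_pow 3 (a - b - c) * (x - y - z) * (x + y - z)
     - 240 * b * pos_pow 2 (a - b - c) * (x - y - z)\<^sup>2"
  "curvature q320201 a b c x y z = 160 * y * (pos_pow 3 (a - c) * (x - z) + pos_pow 3 (a - b - c) * (x - y - z))
     + 240 * b * (pos_pow 2 (a - c) * (x - z)\<^sup>2 + pos_pow 2 (a - b - c) * (x - y - z)\<^sup>2)
     - 160 * (pos_pow 3 (a - c) * (x - z)\<^sup>2 - pos_pow 3 (a - b - c) * (x - y - z)\<^sup>2)"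
  "curvature q220211 a b c x y z = 240 * pos_pow 3 (a - c) * (x - z) * (x - 2 * y - z)
     - 720 * b * pos_pow 2 (a - c) * (x - z)\<^sup>2
     + 240 * pos_pow 3 (b - c) * (y - z) * (y - 2 * x - z) - 720 * a * pos_pow 2 (b - c) * (y - z)\<^sup>2
     - 120 * (x + y - z) * (pos_pow 3 (a - b - c) * (x - y - z) + pos_pow 3 (b - a - c) * (y - x - z))
     - 180 * (a + b - c) * (pos_pow 2 (a - b - c) * (x - y - z)\<^sup>2 + pos_pow 2 (b - a - c) * (y - x - z)\<^sup>2)
     + 60 * pos_pow 3 (a + b - c) * (x + y - z)\<^sup>2"
  "curvature q141110 a b c x y z = 80 * (pos_pow 3 b * y\<^sup>2 - pos_pow 3 (b - c) * (y - z)\<^sup>2 - pos_pow 3 (b - a) * (y - x)\<^sup>2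
     + pos_pow 3 (b - a - c) * (y - x - z)\<^sup>2)"
  "curvature q131210 a b c x y z = 80 * (pos_pow 3 b * y\<^sup>2 - pos_pow 3 (b - c) * (y - z)\<^sup>2
     - pos_pow 3 (b - a) * (y - x) * (y + x) + pos_pow 3 (b - a - c) * (y - x - z) * (y + x - z))
     - 240 * a * (pos_pow 2 (b - a) * (y - x)\<^sup>2 - pos_pow 2 (b - a - c) * (y - x - z)\<^sup>2)"
  "curvature q121211 a b c x y z = 480 * x * y * pos_pow 3 b + 720 * a * pos_pow 2 b * y\<^sup>2 - 480 * pos_pow 3 b * y\<^sup>2
     + 240 * pos_pow 3 (b - c) * (y - z)\<^sup>2 + 480 * pos_pow 3 (b - a) * (y - x) * y
     + 720 * a * pos_pow 2 (b - a) * (y - x)\<^sup>2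
     - 180 * pos_pow 3 (b - a - c) * (y - x - z)\<^sup>2 - 240 * x * pos_pow 3 (b - a - c) * (y - x - z)
     - 360 * a * pos_pow 2 (b - a - c) * (y - x - z)\<^sup>2
     - 60 * pos_pow 3 (a + b - c) * (x + y - z)\<^sup>2 + 480 * y * pos_pow 3 (a - c) * (x - z)
     + 720 * b * pos_pow 2 (a - c) * (x - z)\<^sup>2 - 240 * pos_pow 3 (a - c) * (x - z)\<^sup>2
     + 120 * (x + y - z) * pos_pow 3 (a - b - c) * (x - y - z)
     + 180 * (a + b - c) * pos_pow 2 (a - b - c) * (x - y - z)\<^sup>2"
  unfolding curvature_def slope_q
  by ((rule DERIV_imp_deriv, (rule derivative_eq_intros refl | simp)+, (simp add: algebra_simps power2_eq_square)?)[1])+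

definition leading_form :: "nat \<Rightarrow> real \<Rightarrow> real \<Rightarrow> real \<Rightarrow> real" where
  "leading_form i = snd (leading_forms ! (i - 1))"

lemma leading_form_simps:
  "leading_form 1 = q600101"
  "leading_form 2 = q500201"
  "leading_form 3 = q410201"
  "leading_form 4 = q320201"
  "leading_form 5 = (\<lambda>a b c. q320201 b a c)"
  "leading_form 6 = (\<lambda>a b c. q410201 b a c)"
  "leading_form 7 = (\<lambda>a b c. q500201 b a c)"
  "leading_form 8 = (\<lambda>a b c. q600101 b a c)"
  "leading_form 9 = (\<lambda>a b c. q500201 a c b)"
  "leading_form 10 = (\<lambda>a b c. q141110 b a c)"
  "leading_form 11 = (\<lambda>a b c. q131210 b a c)"
  "leading_form 12 = q220211"
  "leading_form 13 = q131210"
  "leading_form 14 = q141110"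
  "leading_form 15 = (\<lambda>a b c. q500201 b c a)"
  "leading_form 16 = (\<lambda>a b c. q410201 a c b)"
  "leading_form 17 = (\<lambda>a b c. q131210 c a b)"
  "leading_form 18 = (\<lambda>a b c. q121211 b a c)"
  "leading_form 19 = q121211"
  "leading_form 20 = (\<lambda>a b c. q131210 c b a)"
  "leading_form 21 = (\<lambda>a b c. q410201 b c a)"
  by (simp_all add: leading_form_def leading_forms_def)

lemma slope_permuted:
  "slope (\<lambda>a b c. \<phi> b a c) a b c x y z = slope \<phi> b a c y x z"
  "slope (\<lambda>a b c. \<phi> a c b) a b c x y z = slope \<phi> a c b x z y"
  "slope (\<lambda>a b c. \<phi> c b a) a b c x y z = slope \<phi> c b a z y x"
  "slope (\<lambda>a b c. \<phi> c a b) a b c x y z = slope \<phi> c a b z x y"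
  "slope (\<lambda>a b c. \<phi> b c a) a b c x y z = slope \<phi> b c a y z x"
  by (simp_all add: slope_def)

lemma curvature_permuted:
  "curvature (\<lambda>a b c. \<phi> b a c) a b c x y z = curvature \<phi> b a c y x z"
  "curvature (\<lambda>a b c. \<phi> a c b) a b c x y z = curvature \<phi> a c b x z y"
  "curvature (\<lambda>a b c. \<phi> c b a) a b c x y z = curvature \<phi> c b a z y x"
  "curvature (\<lambda>a b c. \<phi> c a b) a b c x y z = curvature \<phi> c a b z x y"
  "curvature (\<lambda>a b c. \<phi> b c a) a b c x y z = curvature \<phi> b c a y z x"
  by (simp_all add: curvature_def slope_def)

lemmas slope_simps = slope_q
  slope_permuted[of q600101] slope_permuted[of q500201] slope_permuted[of q410201] slope_permuted[of q320201]
  slope_permuted[of q220211] slope_permuted[of q141110] slope_permuted[of q131210] slope_permuted[of q121211]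

lemmas curvature_simps = curvature_q
  curvature_permuted[of q600101] curvature_permuted[of q500201] curvature_permuted[of q410201]
  curvature_permuted[of q320201] curvature_permuted[of q220211] curvature_permuted[of q141110]
  curvature_permuted[of q131210] curvature_permuted[of q121211]

text \<open>
  On the edge, at the point with coordinates \<open>(1 - s, s, 0)\<close>, the sign of every linear form is
  the same for all \<open>s\<close> in one half of the edge, so each truncated power is a power or zero.
\<close>

lemma other_forms_flat:
  assumes "(l, \<phi>) \<in> set other_forms" "0 \<le> s" "s \<le> 1"
  shows "\<phi> (1 - s) s 0 = 0" "slope \<phi> (1 - s) s 0 x y z = 0" "curvature \<phi> (1 - s) s 0 x y z = 0"
proof -
  \<comment> \<open>the only breakpoint of the splines on the edge is its midpoint\<close>
  have h: "s \<le> 1/2 \<or> 1/2 \<le> s" by linarith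
  have "\<forall>(l, \<phi>) \<in> set other_forms. \<phi> (1 - s) s 0 = 0"
    unfolding other_forms_def using h assms(2,3)
    by (elim disjE) (simp_all add: q_defs pos_pow_nonneg_arg pos_pow_nonpos_arg,
        simp_all add: eval_nat_numeral algebra_simps)
  then show "\<phi> (1 - s) s 0 = 0" using assms(1) by auto
  have "\<forall>(l, \<phi>) \<in> set other_forms. slope \<phi> (1 - s) s 0 x y z = 0"
    unfolding other_forms_def using h assms(2,3)
    by (elim disjE) (simp_all add: slope_simps pos_pow_nonneg_arg pos_pow_nonpos_arg,
        simp_all add: eval_nat_numeral algebra_simps)
  then show "slope \<phi> (1 - s) s 0 x y z = 0" using assms(1) by auto
  have "\<forall>(l, \<phi>) \<in> set other_forms. curvature \<phi> (1 - s) s 0 x y z = 0"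
    unfolding other_forms_def using h assms(2,3)
    by (elim disjE) (simp_all add: curvature_simps pos_pow_nonneg_arg pos_pow_nonpos_arg,
        simp_all add: eval_nat_numeral algebra_simps)
  then show "curvature \<phi> (1 - s) s 0 x y z = 0" using assms(1) by auto
qed

section \<open>The coefficients that continue a spline across the edge\<close>

text \<open>
  The coefficients on the second triangle of a spline with the same 2-jet on the edge as the one with
  coefficients \<open>c\<close> on the first.
\<close>

definition continuation :: "real \<Rightarrow> real \<Rightarrow> real \<Rightarrow> (nat \<Rightarrow> real) \<Rightarrow> nat \<Rightarrow> real" where
  "continuation \<beta>1 \<beta>2 \<beta>3 c = c(
     9 := \<beta>1 * c 1 + \<beta>2 * c 2 + \<beta>3 * c 9,
     10 := \<beta>1 * c 2 + \<beta>2 * c 3 + \<beta>3 * c 10,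
     11 := \<beta>1 * (2 * c 3 - c 2) + \<beta>2 * c 4 + \<beta>3 * c 11,
     12 := \<beta>1 * ((2 * c 4 + c 5) / 3) + \<beta>2 * ((c 4 + 2 * c 5) / 3) + \<beta>3 * c 12,
     13 := \<beta>1 * c 5 + \<beta>2 * (2 * c 6 - c 7) + \<beta>3 * c 13,
     14 := \<beta>1 * c 6 + \<beta>2 * c 7 + \<beta>3 * c 14,
     15 := \<beta>1 * c 7 + \<beta>2 * c 8 + \<beta>3 * c 15,
     16 := \<beta>1^2 * c 1 + 2 * \<beta>1 * \<beta>2 * c 2 + \<beta>2^2 * c 3
       + 2 * \<beta>1 * \<beta>3 * c 9 + 2 * \<beta>2 * \<beta>3 * c 10 + \<beta>3^2 * c 16,
     17 := \<beta>1^2 * c 2 + \<beta>2^2 * c 4 + \<beta>3^2 * c 17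
       + 2 * \<beta>1 * \<beta>2 * ((3 * c 3 - c 2) / 2)
       + 2 * \<beta>1 * \<beta>3 * ((3 * c 10 - c 2) / 2)
       + 2 * \<beta>2 * \<beta>3 * ((c 10 + 2 * c 11 - c 3) / 2),
     18 := \<beta>1^2 * ((2 * c 3 + 2 * c 4 - c 2) / 3)
       + \<beta>2^2 * ((c 4 + 2 * c 5) / 3) + \<beta>3^2 * c 18
       + 2 * \<beta>1 * \<beta>2 * ((c 2 - 2 * c 3 + 6 * c 4 + c 5) / 6)
       + 2 * \<beta>1 * \<beta>3 * ((c 2 - 2 * c 3 + 2 * c 4 - c 5 + 3 * c 11 + 3 * c 12) / 6)
       + 2 * \<beta>2 * \<beta>3 * ((9 * c 12 - 2 * c 5 - c 11) / 6),
     19 := \<beta>2^2 * ((2 * c 6 + 2 * c 5 - c 7) / 3)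
       + \<beta>1^2 * ((c 5 + 2 * c 4) / 3) + \<beta>3^2 * c 19
       + 2 * \<beta>1 * \<beta>2 * ((c 7 - 2 * c 6 + 6 * c 5 + c 4) / 6)
       + 2 * \<beta>2 * \<beta>3 * ((c 7 - 2 * c 6 + 2 * c 5 - c 4 + 3 * c 13 + 3 * c 12) / 6)
       + 2 * \<beta>1 * \<beta>3 * ((9 * c 12 - 2 * c 4 - c 13) / 6),
     20 := \<beta>2^2 * c 7 + \<beta>1^2 * c 5 + \<beta>3^2 * c 20
       + 2 * \<beta>1 * \<beta>2 * ((3 * c 6 - c 7) / 2)
       + 2 * \<beta>2 * \<beta>3 * ((3 * c 14 - c 7) / 2)
       + 2 * \<beta>1 * \<beta>3 * ((c 14 + 2 * c 13 - c 6) / 2),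
     21 := \<beta>2^2 * c 8 + 2 * \<beta>1 * \<beta>2 * c 7 + \<beta>1^2 * c 6
       + 2 * \<beta>2 * \<beta>3 * c 15 + 2 * \<beta>1 * \<beta>3 * c 14 + \<beta>3^2 * c 21)"

lemma continuation_simps:
  "continuation \<beta>1 \<beta>2 \<beta>3 c 1 = c 1"
  "continuation \<beta>1 \<beta>2 \<beta>3 c 2 = c 2"
  "continuation \<beta>1 \<beta>2 \<beta>3 c 3 = c 3"
  "continuation \<beta>1 \<beta>2 \<beta>3 c 4 = c 4"
  "continuation \<beta>1 \<beta>2 \<beta>3 c 5 = c 5"
  "continuation \<beta>1 \<beta>2 \<beta>3 c 6 = c 6"
  "continuation \<beta>1 \<beta>2 \<beta>3 c 7 = c 7"
  "continuation \<beta>1 \<beta>2 \<beta>3 c 8 = c 8"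
  "continuation \<beta>1 \<beta>2 \<beta>3 c 9 = \<beta>1 * c 1 + \<beta>2 * c 2 + \<beta>3 * c 9"
  "continuation \<beta>1 \<beta>2 \<beta>3 c 10 = \<beta>1 * c 2 + \<beta>2 * c 3 + \<beta>3 * c 10"
  "continuation \<beta>1 \<beta>2 \<beta>3 c 11 = \<beta>1 * (2 * c 3 - c 2) + \<beta>2 * c 4 + \<beta>3 * c 11"
  "continuation \<beta>1 \<beta>2 \<beta>3 c 12 = \<beta>1 * ((2 * c 4 + c 5) / 3) + \<beta>2 * ((c 4 + 2 * c 5) / 3) + \<beta>3 * c 12"
  "continuation \<beta>1 \<beta>2 \<beta>3 c 13 = \<beta>1 * c 5 + \<beta>2 * (2 * c 6 - c 7) + \<beta>3 * c 13"
  "continuation \<beta>1 \<beta>2 \<beta>3 c 14 = \<beta>1 * c 6 + \<beta>2 * c 7 + \<beta>3 * c 14"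
  "continuation \<beta>1 \<beta>2 \<beta>3 c 15 = \<beta>1 * c 7 + \<beta>2 * c 8 + \<beta>3 * c 15"
  "continuation \<beta>1 \<beta>2 \<beta>3 c 16 = \<beta>1^2 * c 1 + 2 * \<beta>1 * \<beta>2 * c 2 + \<beta>2^2 * c 3
       + 2 * \<beta>1 * \<beta>3 * c 9 + 2 * \<beta>2 * \<beta>3 * c 10 + \<beta>3^2 * c 16"
  "continuation \<beta>1 \<beta>2 \<beta>3 c 17 = \<beta>1^2 * c 2 + \<beta>2^2 * c 4 + \<beta>3^2 * c 17
       + 2 * \<beta>1 * \<beta>2 * ((3 * c 3 - c 2) / 2)
       + 2 * \<beta>1 * \<beta>3 * ((3 * c 10 - c 2) / 2)
       + 2 * \<beta>2 * \<beta>3 * ((c 10 + 2 * c 11 - c 3) / 2)"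
  "continuation \<beta>1 \<beta>2 \<beta>3 c 18 = \<beta>1^2 * ((2 * c 3 + 2 * c 4 - c 2) / 3)
       + \<beta>2^2 * ((c 4 + 2 * c 5) / 3) + \<beta>3^2 * c 18
       + 2 * \<beta>1 * \<beta>2 * ((c 2 - 2 * c 3 + 6 * c 4 + c 5) / 6)
       + 2 * \<beta>1 * \<beta>3 * ((c 2 - 2 * c 3 + 2 * c 4 - c 5 + 3 * c 11 + 3 * c 12) / 6)
       + 2 * \<beta>2 * \<beta>3 * ((9 * c 12 - 2 * c 5 - c 11) / 6)"
  "continuation \<beta>1 \<beta>2 \<beta>3 c 19 = \<beta>2^2 * ((2 * c 6 + 2 * c 5 - c 7) / 3)
       + \<beta>1^2 * ((c 5 + 2 * c 4) / 3) + \<beta>3^2 * c 19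
       + 2 * \<beta>1 * \<beta>2 * ((c 7 - 2 * c 6 + 6 * c 5 + c 4) / 6)
       + 2 * \<beta>2 * \<beta>3 * ((c 7 - 2 * c 6 + 2 * c 5 - c 4 + 3 * c 13 + 3 * c 12) / 6)
       + 2 * \<beta>1 * \<beta>3 * ((9 * c 12 - 2 * c 4 - c 13) / 6)"
  "continuation \<beta>1 \<beta>2 \<beta>3 c 20 = \<beta>2^2 * c 7 + \<beta>1^2 * c 5 + \<beta>3^2 * c 20
       + 2 * \<beta>1 * \<beta>2 * ((3 * c 6 - c 7) / 2)
       + 2 * \<beta>2 * \<beta>3 * ((3 * c 14 - c 7) / 2)
       + 2 * \<beta>1 * \<beta>3 * ((c 14 + 2 * c 13 - c 6) / 2)"
  "continuation \<beta>1 \<beta>2 \<beta>3 c 21 = \<beta>2^2 * c 8 + 2 * \<beta>1 * \<beta>2 * c 7 + \<beta>1^2 * c 6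
       + 2 * \<beta>2 * \<beta>3 * c 15 + 2 * \<beta>1 * \<beta>3 * c 14 + \<beta>3^2 * c 21"
  by (simp_all add: continuation_def)

lemma sum_8: "(\<Sum>i=1..8::nat. f i) = f 1 + f 2 + f 3 + f 4 + f 5 + f 6 + f 7 + (f 8 :: real)"
  by (simp add: numeral_eq_Suc)

lemma sum_9_15: "(\<Sum>i=9..15::nat. f i) = f 9 + f 10 + f 11 + f 12 + f 13 + f 14 + (f 15 :: real)"
  by (simp add: numeral_eq_Suc)

lemma sum_16_21: "(\<Sum>i=16..21::nat. f i) = f 16 + f 17 + f 18 + f 19 + f 20 + (f 21 :: real)"
  by (simp add: numeral_eq_Suc)

lemma sum_split_21: "(\<Sum>i=1..21::nat. f i) = (\<Sum>i=1..8. f i) + (\<Sum>i=9..15. f i) + (\<Sum>i=16..21. f i :: real)"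
  by (simp add: numeral_eq_Suc)

lemma edge_value_9_21:
  assumes "i \<in> {9..21}" "0 \<le> s" "s \<le> 1" shows "leading_form i (1 - s) s 0 = 0"
proof -
  have h: "s \<le> 1/2 \<or> 1/2 \<le> s" by linarith
  have "i = 9 \<or> i = 10 \<or> i = 11 \<or> i = 12 \<or> i = 13 \<or> i = 14 \<or> i = 15 \<or> i = 16 \<or> i = 17 \<or> i = 18
     \<or> i = 19 \<or> i = 20 \<or> i = 21"
    using assms(1) unfolding atLeastAtMost_iff by presburger
  then show ?thesis using h assms(2,3)
    by (elim disjE; simp add: leading_form_simps q_defs pos_pow_nonneg_arg pos_pow_nonpos_arg)
       (simp_all add: eval_nat_numeral algebra_simps)
qed

lemma edge_slope_16_21:
  assumes "i \<in> {16..21}" "0 \<le> s" "s \<le> 1" shows "slope (leading_form i) (1 - s) s 0 x y z = 0"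
proof -
  have h: "s \<le> 1/2 \<or> 1/2 \<le> s" by linarith
  have "i = 16 \<or> i = 17 \<or> i = 18 \<or> i = 19 \<or> i = 20 \<or> i = 21"
    using assms(1) unfolding atLeastAtMost_iff by presburger
  then show ?thesis using h assms(2,3)
    by (elim disjE; simp add: leading_form_simps slope_simps pos_pow_nonneg_arg pos_pow_nonpos_arg)
       (simp_all add: eval_nat_numeral algebra_simps)
qed

text \<open>
  A case distinction that leaves no hypothesis about \<open>i\<close> behind, so that the remaining goals
  are purely polynomial.
\<close>

lemma nat_1_21_cases:
  assumes "i \<in> {1..21::nat}"
    and "P 1" "P 2" "P 3" "P 4" "P 5" "P 6" "P 7" "P 8" "P 9" "P 10" "P 11" "P 12" "P 13" "P 14" "P 15" "P 16" "P 17" "P 18" "P 19" "P 20" "P 21"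
  shows "P i"
proof -
  have "i = 1 \<or> i = 2 \<or> i = 3 \<or> i = 4 \<or> i = 5 \<or> i = 6 \<or> i = 7 \<or> i = 8 \<or> i = 9 \<or> i = 10 \<or> i = 11
     \<or> i = 12 \<or> i = 13 \<or> i = 14 \<or> i = 15 \<or> i = 16 \<or> i = 17 \<or> i = 18 \<or> i = 19 \<or> i = 20 \<or> i = 21"
    using assms(1) unfolding atLeastAtMost_iff by presburger
  then show ?thesis by (elim disjE; simp only: assms)
qed

text \<open>
  Both sides of the identities below are linear in \<open>c\<close>, so it is enough to prove them for unit
  vectors; this keeps the polynomials small.
\<close>

lemma continuation_unit_expansion:
  assumes "i \<in> {1..21}"
  shows "continuation \<beta>1 \<beta>2 \<beta>3 c i =
     (\<Sum>k=1..21. c k * continuation \<beta>1 \<beta>2 \<beta>3 (\<lambda>j. of_bool (j = k)) i)"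
proof -
  \<comment> \<open>quotients are turned into multiples of a constant, so that both sides become polynomials\<close>
  define t :: real where "t = 1 / 6"
  have sixths: "x / 2 = 3 * t * x" "x / 3 = 2 * t * x" "x / 6 = t * x" for x by (simp_all add: t_def)
  show ?thesis
    unfolding sum_split_21 sum_8 sum_9_15 sum_16_21
    by (rule nat_1_21_cases[OF assms]; simp add: continuation_simps del: One_nat_def; (simp only: sixths)?; (simp only: t_def)?; algebra)
qed

lemma continuation_sum:
  assumes "\<And>k. k \<in> {1..21} \<Longrightarrow> (\<Sum>i=1..21. continuation \<beta>1 \<beta>2 \<beta>3 (\<lambda>j. of_bool (j = k)) i * N i) = S k"
  shows "(\<Sum>i=1..21. continuation \<beta>1 \<beta>2 \<beta>3 c i * N i) = (\<Sum>k=1..21. c k * S k)"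
proof -
  have "(\<Sum>i=1..21. continuation \<beta>1 \<beta>2 \<beta>3 c i * N i)
      = (\<Sum>i=1..21. (\<Sum>k=1..21. c k * continuation \<beta>1 \<beta>2 \<beta>3 (\<lambda>j. of_bool (j = k)) i * N i))"
    by (intro sum.cong refl)
      (simp only: continuation_unit_expansion[of _ \<beta>1 \<beta>2 \<beta>3 c] sum_distrib_right)
  also have "\<dots> = (\<Sum>k=1..21. c k * (\<Sum>i=1..21. continuation \<beta>1 \<beta>2 \<beta>3 (\<lambda>j. of_bool (j = k)) i * N i))"
    by (subst sum.swap) (simp add: sum_distrib_left mult.assoc)
  also have "\<dots> = (\<Sum>k=1..21. c k * S k)"
    using assms by (intro sum.cong refl) simp
  finally show ?thesis .
qed

text \<open>
  In the coordinates of the second triangle the direction \<open>v3' - v1\<close> is \<open>(-1, 0, 1)\<close>, in those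
  of the first it is \<open>(\<beta>1 - 1, \<beta>2, \<beta>3)\<close>.
\<close>

lemma continuation_slope:
  assumes s: "0 \<le> s" "s \<le> 1" and \<beta>: "\<beta>1 + \<beta>2 + \<beta>3 = 1"
  shows "(\<Sum>i=1..21. continuation \<beta>1 \<beta>2 \<beta>3 c i * slope (leading_form i) (1 - s) s 0 (-1) 0 1)
       = (\<Sum>i=1..21. c i * slope (leading_form i) (1 - s) s 0 (\<beta>1 - 1) \<beta>2 \<beta>3)"
proof (rule continuation_sum)
  fix k :: nat assume k: "k \<in> {1..21}"
  have b: "\<beta>1 = 1 - \<beta>2 - \<beta>3" using \<beta> by simp
  define t :: real where "t = 1 / 6"
  have sixths: "x / 2 = 3 * t * x" "x / 3 = 2 * t * x" "x / 6 = t * x" for x by (simp_all add: t_def)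
  consider "s \<le> 1/2" | "1/2 \<le> s" by linarith
  then show "(\<Sum>i=1..21. continuation \<beta>1 \<beta>2 \<beta>3 (\<lambda>j. of_bool (j = k)) i * slope (leading_form i) (1 - s) s 0 (-1) 0 1)
      = slope (leading_form k) (1 - s) s 0 (\<beta>1 - 1) \<beta>2 \<beta>3"
  proof cases
    case 1
    show ?thesis
      unfolding sum_split_21 sum_8 sum_9_15 sum_16_21 b
      by (rule nat_1_21_cases[OF k]; insert 1 s; simp add: continuation_simps del: One_nat_def;
          simp add: leading_form_simps slope_simps pos_pow_nonneg_arg pos_pow_nonpos_arg del: One_nat_def;
          (simp only: sixths)?; (simp only: t_def)?; algebra)
  next
    case 2
    show ?thesis
      unfolding sum_split_21 sum_8 sum_9_15 sum_16_21 b
      by (rule nat_1_21_cases[OF k]; insert 2 s; simp add: continuation_simps del: One_nat_def;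
          simp add: leading_form_simps slope_simps pos_pow_nonneg_arg pos_pow_nonpos_arg del: One_nat_def;
          (simp only: sixths)?; (simp only: t_def)?; algebra)
  qed
qed

lemma continuation_curvature:
  assumes s: "0 \<le> s" "s \<le> 1" and \<beta>: "\<beta>1 + \<beta>2 + \<beta>3 = 1"
  shows "(\<Sum>i=1..21. continuation \<beta>1 \<beta>2 \<beta>3 c i * curvature (leading_form i) (1 - s) s 0 (-1) 0 1)
       = (\<Sum>i=1..21. c i * curvature (leading_form i) (1 - s) s 0 (\<beta>1 - 1) \<beta>2 \<beta>3)"
proof (rule continuation_sum)
  fix k :: nat assume k: "k \<in> {1..21}"
  have b: "\<beta>1 = 1 - \<beta>2 - \<beta>3" using \<beta> by simp
  define t :: real where "t = 1 / 6"
  have sixths: "x / 2 = 3 * t * x" "x / 3 = 2 * t * x" "x / 6 = t * x" for x by (simp_all add: t_def)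
  consider "s \<le> 1/2" | "1/2 \<le> s" by linarith
  then show "(\<Sum>i=1..21. continuation \<beta>1 \<beta>2 \<beta>3 (\<lambda>j. of_bool (j = k)) i * curvature (leading_form i) (1 - s) s 0 (-1) 0 1)
      = curvature (leading_form k) (1 - s) s 0 (\<beta>1 - 1) \<beta>2 \<beta>3"
  proof cases
    case 1
    show ?thesis
      unfolding sum_split_21 sum_8 sum_9_15 sum_16_21 b
      by (rule nat_1_21_cases[OF k]; insert 1 s; simp add: continuation_simps del: One_nat_def;
          simp add: leading_form_simps curvature_simps pos_pow_nonneg_arg pos_pow_nonpos_arg del: One_nat_def;
          (simp only: sixths)?; (simp only: t_def)?; algebra)
  next
    case 2
    show ?thesis
      unfolding sum_split_21 sum_8 sum_9_15 sum_16_21 b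
      by (rule nat_1_21_cases[OF k]; insert 2 s; simp add: continuation_simps del: One_nat_def;
          simp add: leading_form_simps curvature_simps pos_pow_nonneg_arg pos_pow_nonpos_arg del: One_nat_def;
          (simp only: sixths)?; (simp only: t_def)?; algebra)
  qed
qed

section \<open>The smoothness conditions\<close>

text \<open>
  Evaluating at as many points as there are functions gives a regular linear system, provided
  that the points are spread over both halves of the edge like the breakpoints of the splines.
  The same applies to the next two lemmas.
\<close>

lemma edge_values_independent:
  assumes "\<And>s. 0 \<le> s \<Longrightarrow> s \<le> 1 \<Longrightarrow> (\<Sum>i=1..8. e i * leading_form i (1 - s) s 0) = 0" and "i \<in> {1..8}"
  shows "e i = 0"
proof -
  note at = assms(1)[unfolded sum_8 leading_form_simps q_defs]
  have "e 1 = 0 \<and> e 2 = 0 \<and> e 3 = 0 \<and> e 4 = 0 \<and> e 5 = 0 \<and> e 6 = 0 \<and> e 7 = 0 \<and> e 8 = 0"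
    using at[of 0] at[of "1/8"] at[of "1/4"] at[of "3/8"] at[of "5/8"] at[of "3/4"] at[of "7/8"] at[of 1]
    by (simp add: pos_pow_nonneg_arg pos_pow_nonpos_arg power_divide del: One_nat_def)
  moreover have "i = 1 \<or> i = 2 \<or> i = 3 \<or> i = 4 \<or> i = 5 \<or> i = 6 \<or> i = 7 \<or> i = 8"
    using assms(2) unfolding atLeastAtMost_iff by presburger
  ultimately show ?thesis by blast
qed

lemma edge_slopes_independent:
  assumes "\<And>s. 0 \<le> s \<Longrightarrow> s \<le> 1 \<Longrightarrow> (\<Sum>i=9..15. e i * slope (leading_form i) (1 - s) s 0 (-1) 0 1) = 0"
    and "i \<in> {9..15}"
  shows "e i = 0"
proof -
  note at = assms(1)[unfolded sum_9_15 leading_form_simps slope_simps]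
  have "e 9 = 0 \<and> e 10 = 0 \<and> e 11 = 0 \<and> e 12 = 0 \<and> e 13 = 0 \<and> e 14 = 0 \<and> e 15 = 0"
    using at[of 0] at[of "1/8"] at[of "1/4"] at[of "1/2"] at[of "3/4"] at[of "7/8"] at[of 1]
    by (simp add: pos_pow_nonneg_arg pos_pow_nonpos_arg power_divide del: One_nat_def)
  moreover have "i = 9 \<or> i = 10 \<or> i = 11 \<or> i = 12 \<or> i = 13 \<or> i = 14 \<or> i = 15"
    using assms(2) unfolding atLeastAtMost_iff by presburger
  ultimately show ?thesis by blast
qed

lemma edge_curvatures_independent:
  assumes "\<And>s. 0 \<le> s \<Longrightarrow> s \<le> 1 \<Longrightarrow> (\<Sum>i=16..21. e i * curvature (leading_form i) (1 - s) s 0 (-1) 0 1) = 0"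
    and "i \<in> {16..21}"
  shows "e i = 0"
proof -
  note at = assms(1)[unfolded sum_16_21 leading_form_simps curvature_simps]
  have "e 16 = 0 \<and> e 17 = 0 \<and> e 18 = 0 \<and> e 19 = 0 \<and> e 20 = 0 \<and> e 21 = 0"
    using at[of 0] at[of "1/8"] at[of "1/4"] at[of "3/4"] at[of "7/8"] at[of 1]
    by (simp add: pos_pow_nonneg_arg pos_pow_nonpos_arg power_divide power2_eq_square del: One_nat_def)
  moreover have "i = 16 \<or> i = 17 \<or> i = 18 \<or> i = 19 \<or> i = 20 \<or> i = 21"
    using assms(2) unfolding atLeastAtMost_iff by presburger
  ultimately show ?thesis by blast
qed

lemma bary_of_triangle:
  assumes "cross2 (v2 - v1) (v3 - v1) \<noteq> 0" "x \<in> triangle v1 v2 v3"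
  shows "bary v1 v2 v3 x \<in> octant"
proof -
  obtain u v w where "0 \<le> u" "0 \<le> v" "0 \<le> w" "u + v + w = 1" "x = u *\<^sub>R v1 + v *\<^sub>R v2 + w *\<^sub>R v3"
    using assms(2) unfolding triangle_def convex_hull_3 by auto
  then show ?thesis
    using bary_comb3[OF assms(1), of "(u, v, w)"] by (simp add: comb3_def coord_sum_def octant_def)
qed

lemma smooth2_bary:
  "smooth2 (\<lambda>x. fst (bary v1 v2 v3 x))" "smooth2 (\<lambda>x. fst (snd (bary v1 v2 v3 x)))"
  "smooth2 (\<lambda>x. snd (snd (bary v1 v2 v3 x)))"
  unfolding bary_def Let_def cross2_def fst_conv snd_conv vector_minus_component
  by (intro smooth2_intros smooth2_linear bounded_linear_vec_nth)+

lemma cross2_nonzero: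
  assumes "\<not> collinear {v1, v2, v3}" shows "cross2 (v2 - v1) (v3 - v1) \<noteq> 0"
proof
  assume D: "cross2 (v2 - v1) (v3 - v1) = 0"
  have "collinear {0, u, w}" if "cross2 u w = 0" for u w
  proof (cases "u = 0")
    case False
    then obtain i where i: "u $ i \<noteq> 0" by (auto simp: vec_eq_iff)
    have "w = (w $ i / u $ i) *\<^sub>R u"
      using that i exhaust_2[of i] by (auto simp: vec_eq_iff forall_2 cross2_def field_simps)
    then show ?thesis unfolding collinear_lemma by blast
  qed simp
  then have "collinear {0, v2 - v1, v3 - v1}" using D by blast
  then have "collinear {v2, v1, v3}" by (subst collinear_3) simp
  then show False using assms by (simp add: insert_commute)
qed

lemma basis_forms_of_ordering:
  assumes "basis_ordering lab"
  obtains \<phi> where "\<And>i. i \<in> {1..39} \<Longrightarrow> (lab i, \<phi> i) \<in> set leading_forms \<union> set other_forms"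
    "\<And>i. i \<in> {1..21} \<Longrightarrow> \<phi> i = leading_form i"
    "\<And>i. i \<in> {22..39} \<Longrightarrow> (lab i, \<phi> i) \<in> set other_forms"
proof -
  have bij: "bij_betw lab {1..39} basis_labels" and lead: "map lab [1..<22] = leading_labels"
    using assms by (auto simp: basis_ordering_def)
  have len: "length leading_forms = 21" by (simp add: leading_forms_def)
  have l1: "(lab i, leading_form i) \<in> set leading_forms" if "i \<in> {1..21}" for i
  proof -
    have "[1..<22] ! (i - 1) = i" using that by (subst nth_upt) auto
    then have "lab i = map lab [1..<22] ! (i - 1)" using that by (subst nth_map) auto
    also have "\<dots> = fst (leading_forms ! (i - 1))"
      unfolding lead leading_labels_eq using that len by (subst nth_map) auto
    finally have "(lab i, leading_form i) = leading_forms ! (i - 1)"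
      by (simp add: leading_form_def)
    moreover have "i - 1 < length leading_forms" using that len by auto
    ultimately show ?thesis using nth_mem[of "i - 1" leading_forms] by simp
  qed
  have "\<exists>f. (lab i, f) \<in> set other_forms" if i: "i \<in> {22..39}" for i
  proof -
    have "lab i \<notin> lab ` {1..21}"
    proof
      assume "lab i \<in> lab ` {1..21}"
      then obtain j where j: "j \<in> {1..21}" "lab i = lab j" by blast
      have "inj_on lab {1..39}" using bij by (rule bij_betw_imp_inj_on)
      then have "i = j" by (rule inj_onD) (use i j in auto)
      then show False using i j by simp
    qed
    moreover have "set (map fst leading_forms) = lab ` {1..21}"
    proof -
      have "set (map fst leading_forms) = lab ` {1..<22}"
        unfolding leading_labels_eq[symmetric] lead[symmetric] by simp
      also have "{1..<22} = {1..21::nat}" by auto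
      finally show ?thesis .
    qed
    moreover have "lab i \<in> basis_labels" using bij i by (auto simp: bij_betw_def)
    ultimately have "lab i \<in> set (map fst other_forms)" unfolding basis_labels_eq by auto
    then show ?thesis by auto
  qed
  then obtain g where g: "\<And>i. i \<in> {22..39} \<Longrightarrow> (lab i, g i) \<in> set other_forms" by metis
  show ?thesis
  proof (rule that[of "\<lambda>i. if i \<le> 21 then leading_form i else g i"])
    fix i :: nat assume "i \<in> {1..39}"
    then show "(lab i, if i \<le> 21 then leading_form i else g i) \<in> set leading_forms \<union> set other_forms"
      using l1[of i] g[of i] by (cases "i \<le> 21") auto
  qed (use g in auto)
qed

text \<open>
  One side of the edge.  It is used for both triangles, with the same ordering of the basis.
\<close>

locale spline_sum =
  fixes v1 v2 v3 :: "real^2" and lab :: "nat \<Rightarrow> real \<times> nat list" and \<phi> :: "nat \<Rightarrow> real \<Rightarrow> real \<Rightarrow> real \<Rightarrow> real"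
    and c :: "nat \<Rightarrow> real"
  assumes nondegenerate: "cross2 (v2 - v1) (v3 - v1) \<noteq> 0"
    and forms: "\<And>i. i \<in> {1..39} \<Longrightarrow> (lab i, \<phi> i) \<in> set leading_forms \<union> set other_forms"
    and leading: "\<And>i. i \<in> {1..21} \<Longrightarrow> \<phi> i = leading_form i"
    and others: "\<And>i. i \<in> {22..39} \<Longrightarrow> (lab i, \<phi> i) \<in> set other_forms"
begin

text \<open>
  The function of the plane given by the formulas, regardless of the signs of the barycentric
  coordinates.
\<close>

definition extension :: "real^2 \<Rightarrow> real" where
  "extension x = (\<Sum>i=1..39. c i * \<phi> i (fst (bary v1 v2 v3 x)) (fst (snd (bary v1 v2 v3 x))) (snd (snd (bary v1 v2 v3 x))))"

lemma extension_eq: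
  assumes "x \<in> triangle v1 v2 v3"
  shows "(\<Sum>i=1..39. c i * basis_fun v1 v2 v3 (lab i) x) = extension x"
  unfolding extension_def
proof (intro sum.cong refl, goal_cases)
  case (1 i)
  have "closed_form (lab i) (\<phi> i)" by (rule closed_form_basis[OF forms[OF 1]])
  then show ?case
    using nondegenerate bary_of_triangle[OF nondegenerate assms]
    by (cases "bary v1 v2 v3 x") (auto simp: closed_form_def octant_def)
qed

lemma smooth2_extension: "smooth2 extension"
  unfolding extension_def
  by (intro smooth2_sum smooth2_mult smooth2_const smooth2_forms[OF forms] smooth2_bary)

lemma jet2_extension:
  assumes s: "0 \<le> s" "s \<le> 1" and u: "u = comb3 v1 v2 v3 (\<beta>1, \<beta>2, \<beta>3) - v1" "\<beta>1 + \<beta>2 + \<beta>3 = 1"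
  shows "jet2 (\<lambda>t. extension (v1 + s *\<^sub>R (v2 - v1) + t *\<^sub>R u))
     (\<Sum>i=1..21. c i * leading_form i (1 - s) s 0)
     (\<Sum>i=1..21. c i * slope (leading_form i) (1 - s) s 0 (\<beta>1 - 1) \<beta>2 \<beta>3)
     (\<Sum>i=1..21. c i * curvature (leading_form i) (1 - s) s 0 (\<beta>1 - 1) \<beta>2 \<beta>3)"
proof -
  have bary: "bary v1 v2 v3 (v1 + s *\<^sub>R (v2 - v1) + t *\<^sub>R u)
     = (1 - s + t * (\<beta>1 - 1), s + t * \<beta>2, 0 + t * \<beta>3)" for t
  proof -
    have "v1 + s *\<^sub>R (v2 - v1) + t *\<^sub>R u = comb3 v1 v2 v3 (1 - s + t * (\<beta>1 - 1), s + t * \<beta>2, 0 + t * \<beta>3)"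
      by (simp add: u(1) comb3_def algebra_simps)
    moreover have "1 - s + t * (\<beta>1 - 1) + (s + t * \<beta>2) + (0 + t * \<beta>3) = 1 + t * (\<beta>1 + \<beta>2 + \<beta>3 - 1)"
      by (simp add: algebra_simps)
    then have "coord_sum (1 - s + t * (\<beta>1 - 1), s + t * \<beta>2, 0 + t * \<beta>3) = 1"
      using u(2) by (simp add: coord_sum_def)
    ultimately show ?thesis using bary_comb3[OF nondegenerate] by simp
  qed
  have line: "smooth2 (\<lambda>t. k + t * d)" for k d :: real
    by (intro smooth2_add smooth2_mult smooth2_const smooth2_linear bounded_linear_ident)
  have restrict: "(\<Sum>i=1..39. c i * g i) = (\<Sum>i=1..21. c i * h i)"
    if "\<And>i. i \<in> {1..21} \<Longrightarrow> g i = h i" "\<And>i. i \<in> {22..39} \<Longrightarrow> g i = 0" for g h :: "nat \<Rightarrow> real"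
  proof -
    have "(\<Sum>i=1..39. c i * g i) = (\<Sum>i=1..21. c i * g i)"
      using that(2) by (intro sum.mono_neutral_right) auto
    then show ?thesis using that(1) by simp
  qed
  have "jet2 (\<lambda>t. \<Sum>i=1..39. c i * \<phi> i (1 - s + t * (\<beta>1 - 1)) (s + t * \<beta>2) (0 + t * \<beta>3))
     (\<Sum>i=1..39. c i * \<phi> i (1 - s) s 0)
     (\<Sum>i=1..39. c i * slope (\<phi> i) (1 - s) s 0 (\<beta>1 - 1) \<beta>2 \<beta>3)
     (\<Sum>i=1..39. c i * curvature (\<phi> i) (1 - s) s 0 (\<beta>1 - 1) \<beta>2 \<beta>3)"
    by (intro jet2_linear_combination jet2_slope_curvature smooth2_forms[OF forms] line)
  also have "(\<Sum>i=1..39. c i * \<phi> i (1 - s) s 0) = (\<Sum>i=1..21. c i * leading_form i (1 - s) s 0)"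
    by (rule restrict) (use leading other_forms_flat(1)[OF others s] in auto)
  also have "(\<Sum>i=1..39. c i * slope (\<phi> i) (1 - s) s 0 (\<beta>1 - 1) \<beta>2 \<beta>3)
      = (\<Sum>i=1..21. c i * slope (leading_form i) (1 - s) s 0 (\<beta>1 - 1) \<beta>2 \<beta>3)"
    by (rule restrict) (use leading other_forms_flat(2)[OF others s] in auto)
  also have "(\<Sum>i=1..39. c i * curvature (\<phi> i) (1 - s) s 0 (\<beta>1 - 1) \<beta>2 \<beta>3)
      = (\<Sum>i=1..21. c i * curvature (leading_form i) (1 - s) s 0 (\<beta>1 - 1) \<beta>2 \<beta>3)"
    by (rule restrict) (use leading other_forms_flat(3)[OF others s] in auto)
  finally show ?thesis unfolding extension_def bary by simp
qed

end

text \<open>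
  Order by order: once the coefficients of a group vanish, the next derivative involves only
  the next group.
\<close>

lemma triangular_vanishing:
  assumes v: "\<And>s. s \<in> {0..1} \<Longrightarrow> x0 s = (\<Sum>i=1..21. e i * leading_form i (1 - s) s 0)"
      "\<And>s. s \<in> {0..1} \<Longrightarrow> x1 s = (\<Sum>i=1..21. e i * slope (leading_form i) (1 - s) s 0 (-1) 0 1)"
      "\<And>s. s \<in> {0..1} \<Longrightarrow> x2 s = (\<Sum>i=1..21. e i * curvature (leading_form i) (1 - s) s 0 (-1) 0 1)"
  shows "(\<forall>s\<in>{0..1}. x0 s = 0) \<longleftrightarrow> (\<forall>i\<in>{1..8}. e i = 0)"
    "(\<forall>i\<in>{1..8}. e i = 0) \<Longrightarrow> (\<forall>s\<in>{0..1}. x1 s = 0) \<longleftrightarrow> (\<forall>i\<in>{9..15}. e i = 0)"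
    "(\<forall>i\<in>{1..8}. e i = 0) \<Longrightarrow> (\<forall>i\<in>{9..15}. e i = 0) \<Longrightarrow>
       (\<forall>s\<in>{0..1}. x2 s = 0) \<longleftrightarrow> (\<forall>i\<in>{16..21}. e i = 0)"
proof -
  have x0: "x0 s = (\<Sum>i=1..8. e i * leading_form i (1 - s) s 0)" if "s \<in> {0..1}" for s
    using that edge_value_9_21 v(1)[OF that] unfolding sum_split_21 by simp
  show "(\<forall>s\<in>{0..1}. x0 s = 0) \<longleftrightarrow> (\<forall>i\<in>{1..8}. e i = 0)"
    using edge_values_independent[of e] x0 by (auto intro!: sum.neutral)
  show "(\<forall>s\<in>{0..1}. x1 s = 0) \<longleftrightarrow> (\<forall>i\<in>{9..15}. e i = 0)" if "\<forall>i\<in>{1..8}. e i = 0"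
  proof -
    have "x1 s = (\<Sum>i=9..15. e i * slope (leading_form i) (1 - s) s 0 (-1) 0 1)" if "s \<in> {0..1}" for s
      using that \<open>\<forall>i\<in>{1..8}. e i = 0\<close> edge_slope_16_21 v(2)[OF that] unfolding sum_split_21 by simp
    then show ?thesis using edge_slopes_independent[of e] by (auto intro!: sum.neutral)
  qed
  show "(\<forall>s\<in>{0..1}. x2 s = 0) \<longleftrightarrow> (\<forall>i\<in>{16..21}. e i = 0)" if "\<forall>i\<in>{1..8}. e i = 0" "\<forall>i\<in>{9..15}. e i = 0"
  proof -
    have "x2 s = (\<Sum>i=16..21. e i * curvature (leading_form i) (1 - s) s 0 (-1) 0 1)" if "s \<in> {0..1}" for s
      using that \<open>\<forall>i\<in>{1..8}. e i = 0\<close> \<open>\<forall>i\<in>{9..15}. e i = 0\<close> v(3)[OF that] unfolding sum_split_21 by simp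
    then show ?thesis using edge_curvatures_independent[of e] by (auto intro!: sum.neutral)
  qed
qed

lemma meet_smoothly_iff_continuation:
  assumes "spline_sum v1 v2 v3 lab \<phi>" "spline_sum v1 v2 v3' lab \<phi>"
    and \<beta>: "\<beta>1 + \<beta>2 + \<beta>3 = 1" "v3' = \<beta>1 *\<^sub>R v1 + \<beta>2 *\<^sub>R v2 + \<beta>3 *\<^sub>R v3"
    and f: "\<forall>v \<in> triangle v1 v2 v3. f v = (\<Sum>i=1..39. c i * basis_fun v1 v2 v3 (lab i) v)"
    and f': "\<forall>v \<in> triangle v1 v2 v3'. f' v = (\<Sum>i=1..39. c' i * basis_fun v1 v2 v3' (lab i) v)"
  defines "meet \<equiv> \<lambda>r. meet_smoothly r (closed_segment v1 v2) (triangle v1 v2 v3) (triangle v1 v2 v3') f f'"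
    and "agree \<equiv> \<lambda>I. \<forall>i\<in>I. c' i = continuation \<beta>1 \<beta>2 \<beta>3 c i"
  shows "meet 0 \<longleftrightarrow> agree {1..8}" "meet 1 \<longleftrightarrow> agree {1..8} \<and> agree {9..15}"
    "meet 2 \<longleftrightarrow> agree {1..8} \<and> agree {9..15} \<and> agree {16..21}"
proof -
  interpret S: spline_sum v1 v2 v3 lab \<phi> c by fact
  interpret S': spline_sum v1 v2 v3' lab \<phi> c' by fact
  define e where "e i = c' i - continuation \<beta>1 \<beta>2 \<beta>3 c i" for i
  define x0 x1 x2 where
    "x0 s = (\<Sum>i=1..21. c' i * leading_form i (1 - s) s 0) - (\<Sum>i=1..21. c i * leading_form i (1 - s) s 0)" and
    "x1 s = (\<Sum>i=1..21. c' i * slope (leading_form i) (1 - s) s 0 (0 - 1) 0 1)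
        - (\<Sum>i=1..21. c i * slope (leading_form i) (1 - s) s 0 (\<beta>1 - 1) \<beta>2 \<beta>3)" and
    "x2 s = (\<Sum>i=1..21. c' i * curvature (leading_form i) (1 - s) s 0 (0 - 1) 0 1)
        - (\<Sum>i=1..21. c i * curvature (leading_form i) (1 - s) s 0 (\<beta>1 - 1) \<beta>2 \<beta>3)" for s
  have jet: "jet2 (\<lambda>t. S'.extension (v1 + s *\<^sub>R (v2 - v1) + t *\<^sub>R (v3' - v1)) - S.extension (v1 + s *\<^sub>R (v2 - v1) + t *\<^sub>R (v3' - v1)))
          (x0 s) (x1 s) (x2 s)" if "0 \<le> s" "s \<le> 1" for s
    unfolding x0_def x1_def x2_def
    by (intro jet2_diff S.jet2_extension S'.jet2_extension that) (simp_all add: \<beta> comb3_def)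
  have fF: "\<forall>x\<in>triangle v1 v2 v3. f x = S.extension x"
    and fF': "\<forall>x\<in>triangle v1 v2 v3'. f' x = S'.extension x"
    using f f' S.extension_eq S'.extension_eq by metis+
  have meet: "meet 0 \<longleftrightarrow> (\<forall>s\<in>{0..1}. x0 s = 0)"
    "meet 1 \<longleftrightarrow> (\<forall>s\<in>{0..1}. x0 s = 0) \<and> (\<forall>s\<in>{0..1}. x1 s = 0)"
    "meet 2 \<longleftrightarrow> (\<forall>s\<in>{0..1}. x0 s = 0) \<and> (\<forall>s\<in>{0..1}. x1 s = 0) \<and> (\<forall>s\<in>{0..1}. x2 s = 0)"
    unfolding meet_def
    by (rule meet_smoothly_iff_transversal[OF S.nondegenerate S'.nondegenerate
          S.smooth2_extension S'.smooth2_extension fF fF' jet]; assumption)+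
  have x0: "x0 s = (\<Sum>i=1..21. e i * leading_form i (1 - s) s 0)" if "s \<in> {0..1}" for s
  proof -
    have z: "(\<Sum>i=9..15. k i * leading_form i (1 - s) s 0) = 0" "(\<Sum>i=16..21. k i * leading_form i (1 - s) s 0) = 0" for k :: "nat \<Rightarrow> real"
      using edge_value_9_21 that by (intro sum.neutral; simp)+
    show ?thesis unfolding x0_def sum_split_21 z sum_8 e_def continuation_simps by (simp add: algebra_simps)
  qed
  have x1: "x1 s = (\<Sum>i=1..21. e i * slope (leading_form i) (1 - s) s 0 (-1) 0 1)" if "s \<in> {0..1}" for s
    using that continuation_slope[of s \<beta>1 \<beta>2 \<beta>3 c] \<beta>(1)
    by (simp add: x1_def e_def left_diff_distrib sum_subtractf)
  have x2: "x2 s = (\<Sum>i=1..21. e i * curvature (leading_form i) (1 - s) s 0 (-1) 0 1)" if "s \<in> {0..1}" for s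
    using that continuation_curvature[of s \<beta>1 \<beta>2 \<beta>3 c] \<beta>(1)
    by (simp add: x2_def e_def left_diff_distrib sum_subtractf)
  have agree: "agree I \<longleftrightarrow> (\<forall>i\<in>I. e i = 0)" for I by (simp add: agree_def e_def)
  show "meet 0 \<longleftrightarrow> agree {1..8}" "meet 1 \<longleftrightarrow> agree {1..8} \<and> agree {9..15}"
    "meet 2 \<longleftrightarrow> agree {1..8} \<and> agree {9..15} \<and> agree {16..21}"
    unfolding meet agree using triangular_vanishing[of x0 e x1 x2, OF x0 x1 x2] by blast+
qed

lemma ball_1_8: "(\<forall>i\<in>{1..8::nat}. P i) \<longleftrightarrow> P 1 \<and> P 2 \<and> P 3 \<and> P 4 \<and> P 5 \<and> P 6 \<and> P 7 \<and> P 8"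
  and ball_9_15: "(\<forall>i\<in>{9..15::nat}. P i) \<longleftrightarrow> P 9 \<and> P 10 \<and> P 11 \<and> P 12 \<and> P 13 \<and> P 14 \<and> P 15"
  and ball_16_21: "(\<forall>i\<in>{16..21::nat}. P i) \<longleftrightarrow> P 16 \<and> P 17 \<and> P 18 \<and> P 19 \<and> P 20 \<and> P 21"
  by (simp_all add: numeral_eq_Suc atLeastAtMostSuc_conv conj_ac)

theorem theorem3:
  fixes v1 v2 v3 v3' :: "real^2"
    and \<beta>1 \<beta>2 \<beta>3 :: real
    and lab :: "nat \<Rightarrow> real \<times> nat list"
    and c c' :: "nat \<Rightarrow> real"
    and f f' :: "real^2 \<Rightarrow> real"
  assumes "\<not> collinear {v1, v2, v3}"
    and "\<not> collinear {v1, v2, v3'}"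
    and "interior (triangle v1 v2 v3) \<inter> interior (triangle v1 v2 v3') = {}"
    and "\<beta>1 + \<beta>2 + \<beta>3 = 1"
    and "v3' = \<beta>1 *\<^sub>R v1 + \<beta>2 *\<^sub>R v2 + \<beta>3 *\<^sub>R v3"
    and "basis_ordering lab"
    and "\<forall>v \<in> triangle v1 v2 v3. f v = (\<Sum>i=1..39. c i * basis_fun v1 v2 v3 (lab i) v)"
    and "\<forall>v \<in> triangle v1 v2 v3'. f' v = (\<Sum>i=1..39. c' i * basis_fun v1 v2 v3' (lab i) v)"
  shows
    "let meet = (\<lambda>r. meet_smoothly r (closed_segment v1 v2)
                       (triangle v1 v2 v3) (triangle v1 v2 v3') f f');
         C0 = (\<forall>i\<in>{1..8}. c' i = c i);
         C1 = (c' 9 = \<beta>1 * c 1 + \<beta>2 * c 2 + \<beta>3 * c 9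
             \<and> c' 10 = \<beta>1 * c 2 + \<beta>2 * c 3 + \<beta>3 * c 10
             \<and> c' 11 = \<beta>1 * (2 * c 3 - c 2) + \<beta>2 * c 4 + \<beta>3 * c 11
             \<and> c' 12 = \<beta>1 * ((2 * c 4 + c 5) / 3) + \<beta>2 * ((c 4 + 2 * c 5) / 3) + \<beta>3 * c 12
             \<and> c' 13 = \<beta>1 * c 5 + \<beta>2 * (2 * c 6 - c 7) + \<beta>3 * c 13
             \<and> c' 14 = \<beta>1 * c 6 + \<beta>2 * c 7 + \<beta>3 * c 14
             \<and> c' 15 = \<beta>1 * c 7 + \<beta>2 * c 8 + \<beta>3 * c 15);
         C2 = (c' 16 = \<beta>1^2 * c 1 + 2 * \<beta>1 * \<beta>2 * c 2 + \<beta>2^2 * c 3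
                 + 2 * \<beta>1 * \<beta>3 * c 9 + 2 * \<beta>2 * \<beta>3 * c 10 + \<beta>3^2 * c 16
             \<and> c' 17 = \<beta>1^2 * c 2 + \<beta>2^2 * c 4 + \<beta>3^2 * c 17
                 + 2 * \<beta>1 * \<beta>2 * ((3 * c 3 - c 2) / 2)
                 + 2 * \<beta>1 * \<beta>3 * ((3 * c 10 - c 2) / 2)
                 + 2 * \<beta>2 * \<beta>3 * ((c 10 + 2 * c 11 - c 3) / 2)
             \<and> c' 18 = \<beta>1^2 * ((2 * c 3 + 2 * c 4 - c 2) / 3)
                 + \<beta>2^2 * ((c 4 + 2 * c 5) / 3) + \<beta>3^2 * c 18
                 + 2 * \<beta>1 * \<beta>2 * ((c 2 - 2 * c 3 + 6 * c 4 + c 5) / 6)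
                 + 2 * \<beta>1 * \<beta>3 * ((c 2 - 2 * c 3 + 2 * c 4 - c 5 + 3 * c 11 + 3 * c 12) / 6)
                 + 2 * \<beta>2 * \<beta>3 * ((9 * c 12 - 2 * c 5 - c 11) / 6)
             \<and> c' 19 = \<beta>2^2 * ((2 * c 6 + 2 * c 5 - c 7) / 3)
                 + \<beta>1^2 * ((c 5 + 2 * c 4) / 3) + \<beta>3^2 * c 19
                 + 2 * \<beta>1 * \<beta>2 * ((c 7 - 2 * c 6 + 6 * c 5 + c 4) / 6)
                 + 2 * \<beta>2 * \<beta>3 * ((c 7 - 2 * c 6 + 2 * c 5 - c 4 + 3 * c 13 + 3 * c 12) / 6)
                 + 2 * \<beta>1 * \<beta>3 * ((9 * c 12 - 2 * c 4 - c 13) / 6)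
             \<and> c' 20 = \<beta>2^2 * c 7 + \<beta>1^2 * c 5 + \<beta>3^2 * c 20
                 + 2 * \<beta>1 * \<beta>2 * ((3 * c 6 - c 7) / 2)
                 + 2 * \<beta>2 * \<beta>3 * ((3 * c 14 - c 7) / 2)
                 + 2 * \<beta>1 * \<beta>3 * ((c 14 + 2 * c 13 - c 6) / 2)
             \<and> c' 21 = \<beta>2^2 * c 8 + 2 * \<beta>1 * \<beta>2 * c 7 + \<beta>1^2 * c 6
                 + 2 * \<beta>2 * \<beta>3 * c 15 + 2 * \<beta>1 * \<beta>3 * c 14 + \<beta>3^2 * c 21)
     in (meet 0 \<longleftrightarrow> C0)
      \<and> (meet 1 \<longleftrightarrow> C0 \<and> C1)
      \<and> (meet 2 \<longleftrightarrow> C0 \<and> C1 \<and> C2)"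
proof -
  note D = cross2_nonzero[OF assms(1)] and D' = cross2_nonzero[OF assms(2)]
  obtain \<phi> where \<phi>: "\<And>i. i \<in> {1..39} \<Longrightarrow> (lab i, \<phi> i) \<in> set leading_forms \<union> set other_forms"
    "\<And>i. i \<in> {1..21} \<Longrightarrow> \<phi> i = leading_form i"
    "\<And>i. i \<in> {22..39} \<Longrightarrow> (lab i, \<phi> i) \<in> set other_forms"
    using basis_forms_of_ordering[OF assms(6)] by blast
  have "spline_sum v1 v2 v3 lab \<phi>" "spline_sum v1 v2 v3' lab \<phi>"
    using D D' \<phi> by (simp_all add: spline_sum_def)
  note iff = meet_smoothly_iff_continuation[OF this assms(4,5,7,8)]
  show ?thesis
    unfolding Let_def iff ball_1_8 ball_9_15 ball_16_21 continuation_simps by (intro conjI refl)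
qed

end
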